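(* Let $1<p\le d$. Then $$\sup\{F_{p,1}(\Omega) : \Omega\subset\mathbb{R}^d\text{ open},\ 0<|\Omega|<+\infty\}=1.$$
   Context: $|\Omega|$ is the Lebesgue measure. For $\Omega\subset\mathbb{R}^d$ open with $0<|\Omega|<\infty$ and $1<p<\infty$, $W^{1,p}_0(\Omega)$ is the completion of $C_c^\infty(\Omega)$ with respect to the norm $\|\nabla u\|_{L^p(\Omega)}$. The $p$-torsional rigidity is $$T_p(\Omega)=\max\Big\{\Big[\int_\Omega|u|\,dx\Big]^p\Big[\int_\Omega|\nabla u|^p\,dx\Big]^{-1} : u\in W^{1,p}_0(\Omega),\ u\neq0\Big\},$$ the $p$-principal eigenvalue is $$\lambda_p(\Omega)=\min\Big\{\Big[\int_\Omega|\nabla u|^p\,dx\Big]\Big[\int_\Omega|u|^p\,dx\Big]^{-1} : u\in W^{1,p}_0(\Omega),\ u\neq0\Big\},$$ and $$F_{p,1}(\Omega)=\frac{\lambda_p(\Omega)\,T_p(\Omega)}{|\Omega|^{p-1}}.$$ *)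

theory Defs
  imports "HOL-Analysis.Analysis"
begin

primrec C_k :: "nat \<Rightarrow> ('a::euclidean_space \<Rightarrow> real) \<Rightarrow> bool" where
  "C_k 0 f \<longleftrightarrow> continuous_on UNIV f"
| "C_k (Suc k) f \<longleftrightarrow> (\<forall>x. f differentiable (at x)) \<and>
     (\<forall>b\<in>Basis. C_k k (\<lambda>x. frechet_derivative f (at x) b))"

text \<open>Test functions on \<open>\<Omega>\<close> are regarded as functions on the whole space, extended by zero.\<close>

definition test_functions :: "'a::euclidean_space set \<Rightarrow> ('a \<Rightarrow> real) set" where
  "test_functions \<Omega> =
     {\<phi>. (\<forall>k. C_k k \<phi>) \<and> compact (closure {x. \<phi> x \<noteq> 0}) \<and> closure {x. \<phi> x \<noteq> 0} \<subseteq> \<Omega>}"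

definition grad :: "('a::euclidean_space \<Rightarrow> real) \<Rightarrow> 'a \<Rightarrow> 'a" where
  "grad f x = (\<Sum>b\<in>Basis. frechet_derivative f (at x) b *\<^sub>R b)"

definition Lp_tendsto ::
  "real \<Rightarrow> 'a measure \<Rightarrow> (nat \<Rightarrow> 'a \<Rightarrow> 'b::euclidean_space) \<Rightarrow> ('a \<Rightarrow> 'b) \<Rightarrow> bool" where
  "Lp_tendsto p M f g \<longleftrightarrow> g \<in> borel_measurable M \<and>
     (\<lambda>n. \<integral>\<^sup>+ x. ennreal (norm (f n x - g x) powr p) \<partial>M) \<longlonglongrightarrow> 0"

text \<open>
  The completion of the test functions under the norm \<open>\<phi> \<mapsto> \<parallel>grad \<phi>\<parallel>\<close> in \<open>L\<^sup>p(\<Omega>)\<close>, realised by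
  functions.  When \<open>\<Omega>\<close> has finite measure, the Poincare inequality makes every sequence that is
  Cauchy for this norm converge in \<open>L\<^sup>p(\<Omega>)\<close> together with its gradients.  An element is given
  as a pair \<open>(u, G)\<close> of these limits: \<open>G\<close> is the weak gradient of \<open>u\<close>, hence determined by \<open>u\<close>
  almost everywhere.  Pairs that agree almost everywhere on \<open>\<Omega>\<close> represent the same element;
  values outside \<open>\<Omega>\<close> are irrelevant.
\<close>

definition W0 :: "real \<Rightarrow> 'a::euclidean_space set \<Rightarrow> (('a \<Rightarrow> real) \<times> ('a \<Rightarrow> 'a)) set" where
  "W0 p \<Omega> = {(u, G). \<exists>\<phi>. (\<forall>n. \<phi> n \<in> test_functions \<Omega>) \<and>
     Lp_tendsto p (lebesgue_on \<Omega>) \<phi> u \<and>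
     Lp_tendsto p (lebesgue_on \<Omega>) (\<lambda>n. grad (\<phi> n)) G}"

definition W0_nonzero :: "real \<Rightarrow> 'a::euclidean_space set \<Rightarrow> (('a \<Rightarrow> real) \<times> ('a \<Rightarrow> 'a)) set" where
  "W0_nonzero p \<Omega> = {(u, G) \<in> W0 p \<Omega>. \<not> (AE x in lebesgue_on \<Omega>. u x = 0)}"

text \<open>
  The extremal values are taken in the extended reals, so that supremum and infimum have their
  usual meaning without a boundedness side condition; for \<open>0 < |\<Omega>| < \<infinity>\<close> and \<open>1 < p\<close> both are
  finite and attained.
\<close>

definition torsional_rigidity :: "real \<Rightarrow> 'a::euclidean_space set \<Rightarrow> ereal" where
  "torsional_rigidity p \<Omega> = (SUP (u, G) \<in> W0_nonzero p \<Omega>.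
     ereal ((LINT x|lebesgue_on \<Omega>. \<bar>u x\<bar>) powr p / (LINT x|lebesgue_on \<Omega>. norm (G x) powr p)))"

definition principal_eigenvalue :: "real \<Rightarrow> 'a::euclidean_space set \<Rightarrow> ereal" where
  "principal_eigenvalue p \<Omega> = (INF (u, G) \<in> W0_nonzero p \<Omega>.
     ereal ((LINT x|lebesgue_on \<Omega>. norm (G x) powr p) / (LINT x|lebesgue_on \<Omega>. \<bar>u x\<bar> powr p)))"

definition F_p1 :: "real \<Rightarrow> 'a::euclidean_space set \<Rightarrow> ereal" where
  "F_p1 p \<Omega> = principal_eigenvalue p \<Omega> * torsional_rigidity p \<Omega>
     / ereal (measure lebesgue \<Omega> powr (p - 1))"

end

theory Submission
  imports Defs
begin

text \<open>
  For the upper bound, Hoelder's inequality \<open>(\<integral>|u|)\<^sup>p \<le> |\<Omega>|\<^bsup>p-1\<^esup> \<integral>|u|\<^sup>p\<close> bounds the torsion quotient of \<open>u\<close>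
  by \<open>|\<Omega>|\<^bsup>p-1\<^esup>\<close> divided by its Rayleigh quotient.

  For the lower bound, remove from the whole space a small hole around each lattice point, and let \<open>\<Lambda>\<close>
  be the infimum of the Rayleigh quotients of the test functions of this perforated space.  It is
  positive, since there is a hole within bounded distance of every point, but it tends to \<open>0\<close> with the
  size of the holes, since points have vanishing \<open>p\<close>-capacity for \<open>p \<le> d\<close>.  Let \<open>u\<close> be an almost
  minimiser and \<open>W = (\<Sum> |u(\<cdot> - k)|\<^sup>p)\<^bsup>1/p\<^esup>\<close>, where \<open>k\<close> runs over \<open>N\<^sup>d\<close> lattice points forming a cube.
  Since \<open>|\<nabla>W|\<^sup>p \<le> \<Sum> |\<nabla>u(\<cdot> - k)|\<^sup>p\<close>, the Rayleigh quotient of \<open>W\<close> is at most that of \<open>u\<close>.  Away from the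
  boundary of the cube \<open>W\<close> is periodic, and its small energy makes it almost constant in each
  cell.  So Hoelder's inequality is almost an equality for \<open>W\<close>, and on the cube without the holes
  (slightly enlarged) \<open>W\<close> shows that the product is close to \<open>1\<close> once \<open>\<Lambda>\<close> is small and \<open>N\<close> is large.
\<close>

subsection \<open>Smooth functions\<close>

text \<open>Every test function of a bounded piece is a test function of the whole perforated space.
  So \<Lambda> bounds the eigenvalues of all pieces from below at once, and one competitor for the
  torsion remains to be exhibited. In the final quotient \<Lambda> cancels: the energy of
  \<open>W\<close> is at most (1+\<theta>) \<Lambda> N^d times the mass of \<open>u\<close>. The
  smallness of \<Lambda> serves to make \<open>W\<close> nearly constant.

  The obstacle is that \<open>u\<close> has compact support but overlaps its translates in an
  uncontrolled way, while the quotient may grow only by a factor near 1. The l^p norm handles this: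
  before smoothing, the p-th powers of the translates add exactly, and by Hoelder's inequality the
  energies add at most. For the same reason sums are split with weights 1-\<theta> and \<theta>, so
  that the main term keeps a factor near 1.

  The choices depend on each other in this order: \<theta> fixes the tolerated quotient \<eta>, this
  the size of the holes, these \<Lambda> and \<open>u\<close>, the support of \<open>u\<close> the
  radius M, and M the number N. The smoothing parameter \<delta> comes last, because its error in a
  cell is of order N^d \<delta>^p.\<close>

lemma C_k_cont: "C_k k f \<Longrightarrow> continuous_on UNIV f"
proof (cases k)
  case (Suc n)
  assume "C_k k f"
  with Suc have "\<And>x. f differentiable (at x)" by simp
  then show ?thesis
    by (meson continuous_at_imp_continuous_on differentiable_imp_continuous_within)
qed simp

lemma C_k_Suc_imp: "C_k (Suc k) f \<Longrightarrow> C_k k f"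
proof (induction k arbitrary: f)
  case 0
  then show ?case using C_k_cont by (metis C_k.simps(1))
next
  case (Suc k)
  from Suc.prems have *: "\<forall>x. f differentiable (at x)"
    "\<forall>b\<in>Basis. C_k (Suc k) (\<lambda>x. frechet_derivative f (at x) b)"
    unfolding C_k.simps(2)[of "Suc k" f] by auto
  then show ?case using Suc.IH by auto
qed

lemma C_k_const: "C_k k (\<lambda>x::'a::euclidean_space. c)"
proof (induction k arbitrary: c)
  case (Suc k)
  have "frechet_derivative (\<lambda>x::'a. c) (at x) = (\<lambda>h. 0)" for x
    by simp
  with Suc show ?case by simp
qed simp

lemma C_k_inner: "C_k k (\<lambda>x::'a::euclidean_space. x \<bullet> b)"
proof (cases k)
  case (Suc n)
  have d: "((\<lambda>x::'a. x \<bullet> b) has_derivative (\<lambda>h. h \<bullet> b)) (at x)" for x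
    by (auto intro!: derivative_eq_intros)
  then have "frechet_derivative (\<lambda>x::'a. x \<bullet> b) (at x) = (\<lambda>h. h \<bullet> b)" for x
    using frechet_derivative_at by metis
  then show ?thesis using d Suc by (auto simp: C_k_const differentiable_def)
qed (auto intro!: continuous_intros)

lemma C_k_add: "C_k k f \<Longrightarrow> C_k k g \<Longrightarrow> C_k k (\<lambda>x. f x + g x)"
proof (induction k arbitrary: f g)
  case 0
  then show ?case by (auto intro!: continuous_intros)
next
  case (Suc k)
  then have d: "f differentiable (at x)" "g differentiable (at x)" for x by auto
  have "frechet_derivative (\<lambda>x. f x + g x) (at x) =
      (\<lambda>h. frechet_derivative f (at x) h + frechet_derivative g (at x) h)" for x
    by (rule frechet_derivative_at[symmetric])
       (intro has_derivative_add d[unfolded frechet_derivative_works])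
  with Suc d show ?case by auto
qed

lemma C_k_mult: "C_k k f \<Longrightarrow> C_k k g \<Longrightarrow> C_k k (\<lambda>x. f x * g x)"
proof (induction k arbitrary: f g)
  case 0
  then show ?case by (auto intro!: continuous_intros)
next
  case (Suc k)
  then have d: "f differentiable (at x)" "g differentiable (at x)" for x by auto
  have eq: "frechet_derivative (\<lambda>x. f x * g x) (at x) =
      (\<lambda>h. f x * frechet_derivative g (at x) h + frechet_derivative f (at x) h * g x)" for x
    by (rule frechet_derivative_at[symmetric])
       (intro has_derivative_mult d[unfolded frechet_derivative_works])
  have "C_k k f" "C_k k g" using Suc.prems C_k_Suc_imp by auto
  then have "C_k k (\<lambda>x. frechet_derivative (\<lambda>x. f x * g x) (at x) b)" if "b \<in> Basis" for b
    unfolding eq using Suc that by (intro C_k_add Suc.IH) auto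
  with d show ?case by auto
qed

lemma C_k_sum:
  assumes "finite I" "\<And>i. i \<in> I \<Longrightarrow> C_k k (f i)"
  shows "C_k k (\<lambda>x. \<Sum>i\<in>I. f i x)"
  using assms by (induction I rule: finite_induct) (auto intro: C_k_const C_k_add)

lemma C_k_translate: "C_k k f \<Longrightarrow> C_k k (\<lambda>x. f (x + a))"
proof (induction k arbitrary: f)
  case 0
  then show ?case by (auto intro!: continuous_on_compose2[of UNIV f] continuous_intros)
next
  case (Suc k)
  then have d: "f differentiable (at x)" for x by auto
  have 1: "((\<lambda>x. f (x + a)) has_derivative frechet_derivative f (at (x + a))) (at x)" for x
  proof -
    have "((\<lambda>x. x + a) has_derivative (\<lambda>h. h)) (at x)" by (auto intro!: derivative_eq_intros)
    from has_derivative_compose[OF this d[of "x + a", unfolded frechet_derivative_works]]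
    show ?thesis by simp
  qed
  then have eq: "frechet_derivative (\<lambda>x. f (x + a)) (at x) = frechet_derivative f (at (x + a))" for x
    using frechet_derivative_at by metis
  have "C_k k (\<lambda>x. frechet_derivative (\<lambda>x. f (x + a)) (at x) b)" if "b \<in> Basis" for b
    unfolding eq using Suc that by auto
  with 1 show ?case by (auto simp: differentiable_def)
qed

text \<open>Differentiating \<open>g (f x)\<close> replaces \<open>g\<close> by another function, so
  the induction has to run over a family \<open>G\<close> closed under differentiation. Closure is
  asked only on a set \<open>U\<close> containing the values of \<open>f\<close>, which admits
  powers and logarithms on the positive half-line.\<close>

lemma C_k_compose:
  fixes f :: "'a::euclidean_space \<Rightarrow> real" and U :: "real set"
  assumes G: "\<And>g. g \<in> G \<Longrightarrow> \<exists>g'\<in>G. \<forall>t\<in>U. (g has_real_derivative g' t) (at t)"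
    and "g \<in> G" "\<And>x. f x \<in> U" "C_k k f"
  shows "C_k k (\<lambda>x. g (f x))"
  using assms(2-4)
proof (induction k arbitrary: g)
  case 0
  obtain g' where g': "\<And>t. t \<in> U \<Longrightarrow> (g has_real_derivative g' t) (at t)"
    using G 0 by blast
  then have "continuous_on (range f) g"
    using 0(2) by (intro continuous_at_imp_continuous_on) (auto dest: DERIV_isCont)
  with 0 show ?case by (auto intro: continuous_on_compose2)
next
  case (Suc k)
  obtain g' where g': "g' \<in> G" "\<And>t. t \<in> U \<Longrightarrow> (g has_real_derivative g' t) (at t)"
    using G Suc by blast
  have 1: "((\<lambda>x. g (f x)) has_derivative (\<lambda>h. g' (f x) * frechet_derivative f (at x) h)) (at x)" for x
  proof -
    have "f differentiable (at x)" using Suc by auto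
    from has_derivative_compose[OF this[unfolded frechet_derivative_works]
        g'(2)[OF Suc(3), of x, unfolded has_field_derivative_def]]
    show ?thesis by simp
  qed
  then have eq: "frechet_derivative (\<lambda>x. g (f x)) (at x)
      = (\<lambda>h. g' (f x) * frechet_derivative f (at x) h)" for x
    using frechet_derivative_at by metis
  have "C_k k f" using Suc.prems C_k_Suc_imp by auto
  then have "C_k k (\<lambda>x. g' (f x))" using Suc g' by auto
  then have "C_k k (\<lambda>x. frechet_derivative (\<lambda>x. g (f x)) (at x) b)" if "b \<in> Basis" for b
    unfolding eq using Suc that by (intro C_k_mult) auto
  with 1 show ?case by (auto simp: differentiable_def)
qed

lemma C_k_powr:
  assumes "C_k k f" "\<And>x. f x > 0"
  shows "C_k k (\<lambda>x. f x powr a)"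
proof (rule C_k_compose[where G="range (\<lambda>(c, a) t::real. c * t powr a)" and g="\<lambda>t. t powr a" and U="{0<..}"])
  fix g :: "real \<Rightarrow> real" assume "g \<in> range (\<lambda>(c, a) t::real. c * t powr a)"
  then obtain c a' where g: "g = (\<lambda>t. c * t powr a')" by auto
  have "\<forall>t\<in>{0<..}. (g has_real_derivative ((c * a') * t powr (a' - 1))) (at t)"
    unfolding g by (auto intro!: derivative_eq_intros)
  then show "\<exists>g'\<in>range (\<lambda>(c, a) t::real. c * t powr a). \<forall>t\<in>{0<..}. (g has_real_derivative g' t) (at t)"
    by (intro bexI[OF _ range_eqI[of _ _ "(c * a', a' - 1)"]]) auto
next
  show "(\<lambda>t. t powr a) \<in> range (\<lambda>(c, a) t::real. c * t powr a)"
    by (rule range_eqI[of _ _ "(1, a)"]) auto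
qed (use assms in auto)

lemma C_k_ln:
  assumes "C_k k f" "\<And>x. f x > 0"
  shows "C_k k (\<lambda>x. ln (f x))"
proof (rule C_k_compose[where G="insert ln (range (\<lambda>(c, a) t::real. c * t powr a))" and g=ln and U="{0<..}"])
  fix g :: "real \<Rightarrow> real" assume "g \<in> insert ln (range (\<lambda>(c, a) t::real. c * t powr a))"
  then consider "g = ln" | c a where "g = (\<lambda>t. c * t powr a)" by auto
  then show "\<exists>g'\<in>insert ln (range (\<lambda>(c, a) t::real. c * t powr a)). \<forall>t\<in>{0<..}. (g has_real_derivative g' t) (at t)"
  proof cases
    case 1
    have "\<forall>t\<in>{0<..}. (g has_real_derivative (1 * t powr (-1))) (at t)"
      unfolding 1 by (auto intro!: derivative_eq_intros simp: powr_minus field_simps)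
    then show ?thesis by (intro bexI[OF _ insertI2[OF range_eqI[of _ _ "(1, - 1)"]]]) auto
  next
    case 2
    have "\<forall>t\<in>{0<..}. (g has_real_derivative ((c * a) * t powr (a - 1))) (at t)"
      unfolding 2 by (auto intro!: derivative_eq_intros)
    then show ?thesis by (intro bexI[OF _ insertI2[OF range_eqI[of _ _ "(c * a, a - 1)"]]]) auto
  qed
qed (use assms in auto)

lemma C_k_sin:
  assumes "C_k k f"
  shows "C_k k (\<lambda>x. sin (f x))"
proof (rule C_k_compose[where G="{sin, cos, \<lambda>t. - sin t, \<lambda>t. - cos t}" and g=sin and U=UNIV])
  fix g :: "real \<Rightarrow> real" assume "g \<in> {sin, cos, \<lambda>t. - sin t, \<lambda>t. - cos t}"
  moreover have "\<forall>t. (sin has_real_derivative cos t) (at t)"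
    "\<forall>t. (cos has_real_derivative - sin t) (at t)"
    "\<forall>t. ((\<lambda>t. - sin t) has_real_derivative - cos t) (at t)"
    "\<forall>t. ((\<lambda>t. - cos t) has_real_derivative sin t) (at t)"
    by (auto intro!: derivative_eq_intros)
  ultimately show "\<exists>g'\<in>{sin, cos, \<lambda>t. - sin t, \<lambda>t. - cos t}. \<forall>t\<in>UNIV. (g has_real_derivative g' t) (at t)"
    by auto
qed (use assms in auto)

text \<open>The classical smooth function with all derivatives zero at the origin. It is monotone
  with values in [0, 1), so composing it with a smooth function that becomes negative already gives
  a bounded cutoff.\<close>

definition flat :: "real \<Rightarrow> real" where
  "flat t = (if t > 0 then exp (- 1 / t) else 0)"

lemma poly_exp_tendsto_0: "((\<lambda>t. poly q t * exp (- t)) \<longlongrightarrow> (0::real)) at_top"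
proof (induction q)
  case (pCons a q)
  have e: "((\<lambda>t::real. exp (- t)) \<longlongrightarrow> 0) at_top"
    using filterlim_compose[OF exp_at_bot filterlim_uminus_at_bot_at_top] by simp
  have "((\<lambda>t::real. poly [:0, 1:] t * (poly q t * exp (- t))) \<longlongrightarrow> 0) at_top"
  proof -
    have 1: "((\<lambda>t. \<Sum>i\<le>degree q. coeff q i * (t ^ Suc i * exp (- t))) \<longlongrightarrow> (\<Sum>i\<le>degree q. coeff q i * 0)) at_top"
      using tendsto_power_div_exp_0
      by (intro tendsto_sum tendsto_mult[OF tendsto_const]) (auto simp: exp_minus divide_inverse simp del: power_Suc)
    then show ?thesis
      by (simp add: poly_altdef sum_distrib_left sum_distrib_right mult_ac)
  qed
  from tendsto_add[OF tendsto_mult[OF tendsto_const[of a] e] this]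
  show ?case by (simp add: algebra_simps)
qed simp

text \<open>For t > 0 the derivative of q(1/t) exp(-1/t) is (q - q')(1/t) exp(-1/t) / t^2, again of
  this form with the polynomial X^2 (q - q'). This is the closed family that
  \<open>C_k_compose\<close> asks for.\<close>

lemma flat_family_deriv:
  fixes q :: "real poly"
  defines "F \<equiv> \<lambda>q t. if t > 0 then poly q (1 / t) * exp (- 1 / t) else (0::real)"
  shows "(F q has_real_derivative F ([:0, 0, 1:] * (q - pderiv q)) t) (at t)"
proof -
  consider "t > 0" | "t < 0" | "t = 0" by linarith
  then show ?thesis
  proof cases
    case 1
    have "((\<lambda>t. poly q (1 / t) * exp (- 1 / t)) has_real_derivative
        F ([:0, 0, 1:] * (q - pderiv q)) t) (at t)"
      using 1 unfolding F_def
      by (auto intro!: derivative_eq_intros DERIV_chain2[of "poly q"] poly_DERIV simp: field_simps power2_eq_square)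
    then show ?thesis
      by (rule DERIV_cong_ev[THEN iffD1, rotated 3])
         (use 1 in \<open>auto simp: F_def eventually_nhds intro!: exI[of _ "{0<..}"]\<close>)
  next
    case 2
    have "((\<lambda>t. 0) has_real_derivative F ([:0, 0, 1:] * (q - pderiv q)) t) (at t)"
      using 2 unfolding F_def by simp
    then show ?thesis
      by (rule DERIV_cong_ev[THEN iffD1, rotated 3])
         (use 2 in \<open>auto simp: F_def eventually_nhds intro!: exI[of _ "{..<0}"]\<close>)
  next
    case 3
    \<comment> \<open>Dividing by \<open>h\<close> multiplies the polynomial in 1/h by its variable,
      which is \<open>pCons 0 q\<close>; after substituting 1/h the exponential beats it.\<close>
    have r: "((\<lambda>h. F q h / h) \<longlongrightarrow> 0) (at_right 0)"
    proof -
      have "((\<lambda>h. poly (pCons 0 q) (inverse h) * exp (- inverse h)) \<longlongrightarrow> 0) (at_right 0)"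
        by (rule filterlim_compose[OF poly_exp_tendsto_0 filterlim_inverse_at_top_right])
      then show ?thesis
        by (rule filterlim_cong[THEN iffD1, rotated 3, OF _ refl refl])
           (auto simp: F_def eventually_at_right_less field_simps inverse_eq_divide
             intro!: eventually_mono[OF eventually_at_right_less])
    qed
    have l: "((\<lambda>h. F q h / h) \<longlongrightarrow> 0) (at_left 0)"
      by (rule tendsto_eventually) (auto simp: F_def eventually_at_left_field intro!: exI[of _ "-1"])
    have "((\<lambda>h. F q h / h) \<longlongrightarrow> 0) (at 0)"
      using l r by (simp add: filterlim_split_at)
    then show ?thesis using 3 by (simp add: DERIV_def F_def cong: if_cong)
  qed
qed

lemma C_k_flat:
  assumes "C_k k f"
  shows "C_k k (\<lambda>x. flat (f x))"
proof (rule C_k_compose[where G="range (\<lambda>q t. if t > 0 then poly q (1 / t) * exp (- 1 / t) else 0)" 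
      and g=flat and U=UNIV])
  show "flat \<in> range (\<lambda>q t. if t > 0 then poly q (1 / t) * exp (- 1 / t) else 0)"
    by (rule image_eqI[of _ _ 1]) (auto simp: flat_def fun_eq_iff)
next
  fix g :: "real \<Rightarrow> real"
  assume "g \<in> range (\<lambda>q t. if t > 0 then poly q (1 / t) * exp (- 1 / t) else 0)"
  then obtain q where g: "g = (\<lambda>t. if t > 0 then poly q (1 / t) * exp (- 1 / t) else 0)"
    by blast
  show "\<exists>g'\<in>range (\<lambda>q t. if t > 0 then poly q (1 / t) * exp (- 1 / t) else 0).
      \<forall>t\<in>UNIV. (g has_real_derivative g' t) (at t)"
    unfolding g
    by (rule bexI[OF _ rangeI[of _ "[:0, 0, 1:] * (q - pderiv q)"]]) (use flat_family_deriv[of q] in blast)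
qed (use assms in auto)

definition flat' :: "real \<Rightarrow> real" where
  "flat' t = (if t > 0 then exp (- 1 / t) / t\<^sup>2 else 0)"

lemma flat_deriv: "(flat has_real_derivative flat' t) (at t)"
proof -
  have "(\<lambda>t. if t > 0 then poly 1 (1 / t) * exp (- 1 / t) else 0) = flat"
    by (auto simp: flat_def fun_eq_iff)
  then show ?thesis using flat_family_deriv[of 1 t]
    by (auto simp: flat'_def power2_eq_square field_simps split: if_splits)
qed

subsection \<open>Convexity of powers\<close>

lemma powr_above_tangent:
  fixes t m p :: real
  assumes "t \<ge> 0" "m > 0" "p \<ge> 1"
  shows "m powr p + p * m powr (p - 1) * (t - m) \<le> t powr p"
\<comment> \<open>Convexity and the derivative are used on the open half-line; at t = 0 the claim
  reduces to (1 - p) m^p \<le> 0.\<close>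
proof (cases "t = 0")
  case True
  have "m powr (p - 1) * m = m powr p"
    using assms powr_add[of m "p - 1" 1] by simp
  then have "p * m powr (p - 1) * (t - m) = - p * m powr p"
    using True by (simp add: mult.assoc)
  moreover have "1 * m powr p \<le> p * m powr p" using assms by (intro mult_right_mono) auto
  ultimately show ?thesis
    unfolding \<open>p * m powr (p - 1) * (t - m) = - p * m powr p\<close> using True by simp
next
  case False
  have "t powr p - m powr p \<ge> p * m powr (p - 1) * (t - m)"
    using assms False
    by (intro convex_on_imp_above_tangent[where A="{0<..}"] powr_convex)
       (auto intro!: derivative_eq_intros simp: interior_open)
  then show ?thesis by simp
qed

text \<open>Jensen's inequality: average the tangent inequality at the mean \<open>m\<close>; the
  linear terms cancel.\<close>

lemma powr_weighted_sum_le: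
  fixes q z :: "'i \<Rightarrow> real"
  assumes "finite K" "\<And>k. k \<in> K \<Longrightarrow> q k \<ge> 0" "(\<Sum>k\<in>K. q k) = 1"
    "\<And>k. k \<in> K \<Longrightarrow> z k \<ge> 0" "p \<ge> 1"
  shows "(\<Sum>k\<in>K. q k * z k) powr p \<le> (\<Sum>k\<in>K. q k * z k powr p)"
proof -
  define m where "m = (\<Sum>k\<in>K. q k * z k)"
  have "m \<ge> 0" unfolding m_def using assms by (intro sum_nonneg) auto
  show ?thesis
  proof (cases "m = 0")
    case True
    then show ?thesis using assms unfolding m_def[symmetric] by (auto intro!: sum_nonneg)
  next
    case False
    have "m powr p = (\<Sum>k\<in>K. q k * (m powr p + p * m powr (p - 1) * (z k - m)))"
    proof -
      have "(\<Sum>k\<in>K. q k * (m powr p + p * m powr (p - 1) * (z k - m)))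
         = (\<Sum>k\<in>K. q k) * m powr p + p * m powr (p - 1) * ((\<Sum>k\<in>K. q k * z k) - (\<Sum>k\<in>K. q k) * m)"
        by (simp add: algebra_simps sum.distrib sum_distrib_left sum_distrib_right sum_subtractf)
      also have "\<dots> = m powr p" using assms(3) by (simp add: m_def)
      finally show ?thesis by simp
    qed
    also have "\<dots> \<le> (\<Sum>k\<in>K. q k * z k powr p)"
      using assms False \<open>m \<ge> 0\<close> by (intro sum_mono mult_left_mono powr_above_tangent) auto
    finally show ?thesis by (simp add: m_def)
  qed
qed

text \<open>Jensen with weights 1 - \<theta> and \<theta> at the points a / (1 - \<theta>) and b /
  \<theta>. For small \<theta> the coefficient of \<open>a powr p\<close> is close to 1, so a
  dominant term is separated from an error with almost no loss; equal weights would cost a factor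
  2^(p-1).\<close>

lemma powr_add_le_split:
  fixes a b \<theta> p :: real
  assumes "a \<ge> 0" "b \<ge> 0" "0 < \<theta>" "\<theta> < 1" "p \<ge> 1"
  shows "(a + b) powr p \<le> (1 - \<theta>) powr (1 - p) * a powr p + \<theta> powr (1 - p) * b powr p"
proof -
  have "(\<Sum>k\<in>{True, False}. (if k then 1 - \<theta> else \<theta>) * (if k then a / (1 - \<theta>) else b / \<theta>)) powr p
    \<le> (\<Sum>k\<in>{True, False}. (if k then 1 - \<theta> else \<theta>) * (if k then a / (1 - \<theta>) else b / \<theta>) powr p)"
    using assms by (intro powr_weighted_sum_le) auto
  then have 1: "(a + b) powr p \<le> (1 - \<theta>) * (a / (1 - \<theta>)) powr p + \<theta> * (b / \<theta>) powr p"
    using assms by simp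
  have 2: "c * (x / c) powr p = c powr (1 - p) * x powr p" if "c > 0" "x \<ge> 0" for c x :: real
    using that by (simp add: powr_divide powr_diff)
  show ?thesis using 1 2[of "1 - \<theta>" a] 2[of \<theta> b] assms by simp
qed

lemma powr_add_le:
  fixes a b p :: real
  assumes "a \<ge> 0" "b \<ge> 0" "p \<ge> 1"
  shows "(a + b) powr p \<le> 2 powr (p - 1) * (a powr p + b powr p)"
proof -
  have "(1 / 2 :: real) powr (1 - p) = 2 powr (p - 1)"
    by (simp add: powr_divide powr_diff)
  then show ?thesis using powr_add_le_split[OF assms(1,2), of "1/2" p] assms
    by (simp add: algebra_simps)
qed

text \<open>Hoelder's inequality for the vectors \<open>a k powr (p - 1)\<close> and
  \<open>g k\<close>, obtained from Jensen with weights \<open>a k powr p / S\<close> at the points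
  \<open>g k * S powr (1 / p) / a k\<close>. The left side is what the chain rule yields for the
  gradient of an l^p norm.\<close>

lemma holder_sum_normalised:
  fixes a g :: "'i \<Rightarrow> real"
  assumes "finite K" "K \<noteq> {}" "\<And>k. k \<in> K \<Longrightarrow> a k > 0" "\<And>k. k \<in> K \<Longrightarrow> g k \<ge> 0" "p \<ge> 1"
  defines "S \<equiv> \<Sum>k\<in>K. a k powr p"
  shows "(S powr (1 / p - 1) * (\<Sum>k\<in>K. a k powr (p - 1) * g k)) powr p \<le> (\<Sum>k\<in>K. g k powr p)"
proof -
  have nz: "a k \<noteq> 0" if "k \<in> K" for k using assms(3)[OF that] by simp
  have S: "S > 0" unfolding S_def using assms nz by (intro sum_pos) auto
  have "(\<Sum>k\<in>K. a k powr p / S * (g k * S powr (1 / p) / a k)) powr p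
      \<le> (\<Sum>k\<in>K. a k powr p / S * (g k * S powr (1 / p) / a k) powr p)"
    using assms S
    by (intro powr_weighted_sum_le) (auto simp: S_def sum_divide_distrib[symmetric] less_imp_le)
  also have "(\<Sum>k\<in>K. a k powr p / S * (g k * S powr (1 / p) / a k))
      = S powr (1 / p - 1) * (\<Sum>k\<in>K. a k powr (p - 1) * g k)"
    unfolding sum_distrib_left
  proof (intro sum.cong refl)
    fix k assume "k \<in> K"
    then show "a k powr p / S * (g k * S powr (1 / p) / a k)
        = S powr (1 / p - 1) * (a k powr (p - 1) * g k)"
      using S assms(3) by (simp add: powr_diff less_imp_le)
  qed
  also have "(\<Sum>k\<in>K. a k powr p / S * (g k * S powr (1 / p) / a k) powr p) = (\<Sum>k\<in>K. g k powr p)"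
    using S assms nz
    by (intro sum.cong refl) (auto simp: powr_divide powr_mult powr_powr less_imp_le)
  finally show ?thesis .
qed

text \<open>Jensen again, by integrating the tangent inequality at the mean value of
  \<open>f\<close>.\<close>

lemma integral_powr_le:
  fixes f :: "'a \<Rightarrow> real"
  assumes "finite_measure M" "p \<ge> 1" "\<And>x. x \<in> space M \<Longrightarrow> f x \<ge> 0"
    "integrable M (\<lambda>x. f x powr p)"
  shows "(\<integral>x. f x \<partial>M) powr p \<le> measure M (space M) powr (p - 1) * (\<integral>x. f x powr p \<partial>M)"
proof -
  interpret finite_measure M by fact
  define \<mu> where "\<mu> = measure M (space M)"
  define I where "I = (\<integral>x. f x \<partial>M)"
  have I0: "I \<ge> 0" unfolding I_def by (intro Bochner_Integration.integral_nonneg) (use assms in auto)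
  have R0: "(\<integral>x. f x powr p \<partial>M) \<ge> 0" by (intro Bochner_Integration.integral_nonneg) auto
  show ?thesis
  proof (cases "I = 0")
    case True
    then show ?thesis using R0 by (simp add: I_def[symmetric])
  next
    case False
    \<comment> \<open>The Bochner integral of a non-integrable function is 0 by convention, so a
      nonzero \<open>I\<close> carries integrability; for \<open>I = 0\<close> the left side
      vanishes.\<close>
    then have int: "integrable M f" unfolding I_def using not_integrable_integral_eq by blast
    have "\<mu> \<noteq> 0"
    proof
      assume "\<mu> = 0"
      then have "emeasure M (space M) = 0" by (simp add: \<mu>_def emeasure_eq_measure)
      then have "AE x in M. f x = 0"
        by (intro AE_I[where N="space M"]) auto
      then have "I = 0" unfolding I_def by (simp add: integral_eq_zero_AE)
      with False show False by simp
    qed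
    then have \<mu>: "\<mu> > 0" by (simp add: \<mu>_def zero_less_measure_iff)
    define m where "m = I / \<mu>"
    have m: "m > 0" using \<mu> I0 False by (simp add: m_def)
    have "\<mu> * m powr p = (\<integral>x. m powr p + p * m powr (p - 1) * (f x - m) \<partial>M)"
      using int \<mu> by (simp add: \<mu>_def[symmetric] I_def[symmetric] m_def)
    also have "\<dots> \<le> (\<integral>x. f x powr p \<partial>M)"
      using assms int m by (intro integral_mono powr_above_tangent) auto
    finally have "\<mu> * m powr p \<le> (\<integral>x. f x powr p \<partial>M)" .
    then have "\<mu> powr (p - 1) * (\<mu> * m powr p) \<le> \<mu> powr (p - 1) * (\<integral>x. f x powr p \<partial>M)"
      by (intro mult_left_mono) auto
    moreover have "\<mu> powr (p - 1) * (\<mu> * m powr p) = I powr p"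
      using \<mu> I0 by (simp add: m_def powr_divide powr_diff)
    ultimately show ?thesis by (simp add: I_def \<mu>_def)
  qed
qed

subsection \<open>Gradients and test functions\<close>

lemma GDERIV_grad:
  fixes f :: "'a::euclidean_space \<Rightarrow> real"
  assumes "f differentiable (at x)"
  shows "GDERIV f x :> grad f x"
proof -
  let ?D = "frechet_derivative f (at x)"
  have d: "(f has_derivative ?D) (at x)" using assms by (simp add: frechet_derivative_works)
  then have lin: "linear ?D" by (rule has_derivative_linear)
  have "?D h = h \<bullet> grad f x" for h
  proof -
    have "?D h = ?D (\<Sum>b\<in>Basis. (h \<bullet> b) *\<^sub>R b)" by (simp add: euclidean_representation)
    also have "\<dots> = (\<Sum>b\<in>Basis. (h \<bullet> b) * ?D b)"
      using lin by (simp add: linear_sum linear_cmul)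
    also have "\<dots> = h \<bullet> grad f x"
      by (simp add: grad_def inner_sum_right mult.commute)
    finally show ?thesis .
  qed
  then have "?D = (\<lambda>h. h \<bullet> grad f x)" by auto
  then show ?thesis using d by (simp add: gderiv_def)
qed

lemma grad_eqI:
  fixes f :: "'a::euclidean_space \<Rightarrow> real"
  assumes "GDERIV f x :> d"
  shows "grad f x = d"
proof -
  have "frechet_derivative f (at x) = (\<lambda>h. h \<bullet> d)"
    using assms frechet_derivative_at unfolding gderiv_def by metis
  then show ?thesis by (simp add: grad_def inner_commute[of _ d] euclidean_representation)
qed

lemma GDERIV_sum:
  assumes "finite I" "\<And>i. i \<in> I \<Longrightarrow> GDERIV (f i) x :> d i"
  shows "GDERIV (\<lambda>x. \<Sum>i\<in>I. f i x) x :> (\<Sum>i\<in>I. d i)"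
  using assms by (induction I rule: finite_induct) (auto intro: GDERIV_const GDERIV_add)

lemma GDERIV_translate:
  "GDERIV f (x + a) :> d \<Longrightarrow> GDERIV (\<lambda>x. f (x + a)) x :> d"
  unfolding gderiv_def
  by (rule has_derivative_compose[of "\<lambda>x. x + a" "\<lambda>h. h" x UNIV f "\<lambda>h. h \<bullet> d"])
     (auto intro!: derivative_eq_intros)

lemma test_functionsD:
  assumes "\<phi> \<in> test_functions \<Omega>"
  shows "C_k k \<phi>" "compact (closure {x. \<phi> x \<noteq> 0})" "closure {x. \<phi> x \<noteq> 0} \<subseteq> \<Omega>"
    "continuous_on UNIV \<phi>" "\<phi> differentiable (at x)"
proof -
  have "C_k 0 \<phi>" "C_k (Suc 0) \<phi>" using assms unfolding test_functions_def by blast+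
  then show "continuous_on UNIV \<phi>" "\<phi> differentiable (at x)" by auto
qed (use assms in \<open>auto simp: test_functions_def\<close>)

lemma GDERIV_test_function:
  "\<phi> \<in> test_functions \<Omega> \<Longrightarrow> GDERIV \<phi> x :> grad \<phi> x"
  by (rule GDERIV_grad[OF test_functionsD(5)])

lemma continuous_grad_test_function:
  assumes "\<phi> \<in> test_functions \<Omega>"
  shows "continuous_on UNIV (grad \<phi>)"
proof -
  have "C_k (Suc 0) \<phi>" using test_functionsD(1)[OF assms] .
  then show ?thesis unfolding grad_def[abs_def] by (auto intro!: continuous_intros)
qed

lemma test_function_outside:
  assumes "x \<notin> closure {x. \<phi> x \<noteq> 0}"
  shows "\<phi> x = 0" "grad \<phi> x = 0"
proof -
  show "\<phi> x = 0" using assms closure_subset[of "{x. \<phi> x \<noteq> 0}"] by auto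
  have "((\<lambda>x. 0) has_derivative (\<lambda>h. h \<bullet> 0)) (at x)" by simp
  then have "(\<phi> has_derivative (\<lambda>h. h \<bullet> 0)) (at x)"
    by (rule has_derivative_transform_within_open[where s="- closure {x. \<phi> x \<noteq> 0}"])
       (use assms closure_subset[of "{x. \<phi> x \<noteq> 0}"] in auto)
  then show "grad \<phi> x = 0" by (intro grad_eqI) (simp add: gderiv_def)
qed

lemma test_functionsI:
  assumes "\<And>k. C_k k \<phi>" "compact S" "S \<subseteq> \<Omega>" "\<And>x. \<phi> x \<noteq> 0 \<Longrightarrow> x \<in> S"
  shows "\<phi> \<in> test_functions \<Omega>"
proof -
  have "closure {x. \<phi> x \<noteq> 0} \<subseteq> S"
    using assms by (intro closure_minimal) (auto simp: compact_imp_closed)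
  moreover from this have "compact (closure {x. \<phi> x \<noteq> 0})"
    using assms(2) compact_Int_closed[of S "closure {x. \<phi> x \<noteq> 0}"] by (simp add: Int_absorb1)
  ultimately show ?thesis using assms by (auto simp: test_functions_def)
qed

lemma integrable_continuous_compact_support:
  fixes f :: "'a::euclidean_space \<Rightarrow> real"
  assumes "continuous_on UNIV f" "compact S" "\<And>x. x \<notin> S \<Longrightarrow> f x = 0"
  shows "integrable lborel f"
proof -
  have "integrable lborel (\<lambda>x. indicator S x *\<^sub>R f x)"
    using assms by (intro borel_integrable_compact) (auto intro: continuous_on_subset)
  moreover have "(\<lambda>x. indicator S x *\<^sub>R f x) = f"
    using assms by (auto simp: fun_eq_iff indicator_def)
  ultimately show ?thesis by simp
qed

lemma continuous_on_powr_const: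
  fixes f :: "'a::topological_space \<Rightarrow> real"
  assumes "continuous_on S f" "p > 0" "\<And>x. f x \<ge> 0"
  shows "continuous_on S (\<lambda>x. f x powr p)"
  using assms by (intro continuous_on_powr') (auto intro!: continuous_intros)

lemma integrable_test_function:
  assumes "\<phi> \<in> test_functions \<Omega>" "p > 0"
  shows "integrable lborel \<phi>" "integrable lborel (\<lambda>x. \<bar>\<phi> x\<bar> powr p)"
    "integrable lborel (\<lambda>x. norm (grad \<phi> x) powr p)"
proof -
  note S = integrable_continuous_compact_support[OF _ test_functionsD(2)[OF assms(1)]]
  have "continuous_on UNIV (\<lambda>x. \<bar>\<phi> x\<bar> powr p)" "continuous_on UNIV (\<lambda>x. norm (grad \<phi> x) powr p)"
    by (intro continuous_on_powr_const continuous_on_norm continuous_on_rabs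
        test_functionsD(4)[OF assms(1)] continuous_grad_test_function[OF assms(1)] assms; simp)+
  note c = this
  show "integrable lborel \<phi>"
    by (rule S[OF test_functionsD(4)[OF assms(1)]]) (rule test_function_outside)
  show "integrable lborel (\<lambda>x. \<bar>\<phi> x\<bar> powr p)"
    by (rule S[OF c(1)]) (use test_function_outside in simp)
  show "integrable lborel (\<lambda>x. norm (grad \<phi> x) powr p)"
    by (rule S[OF c(2)]) (use test_function_outside in simp)
qed

subsection \<open>Bounds for the eigenvalue, the torsional rigidity and their product\<close>

text \<open>Stands in for the triangle inequality in L^p at the level of p-th powers: once the
  difference tends to 0, letting \<theta> tend to 0 brings the factor of the main term back to
  1.\<close>

lemma nn_integral_powr_split:
  fixes f g :: "'a \<Rightarrow> 'b::euclidean_space"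
  assumes [measurable]: "f \<in> borel_measurable M" "g \<in> borel_measurable M"
    and \<theta>: "0 < \<theta>" "\<theta> < 1" "p \<ge> 1"
  shows "(\<integral>\<^sup>+ x. ennreal (norm (f x) powr p) \<partial>M) \<le>
     ennreal ((1 - \<theta>) powr (1 - p)) * (\<integral>\<^sup>+ x. ennreal (norm (g x) powr p) \<partial>M) +
     ennreal (\<theta> powr (1 - p)) * (\<integral>\<^sup>+ x. ennreal (norm (f x - g x) powr p) \<partial>M)"
proof -
  have "norm (f x) powr p \<le> (1 - \<theta>) powr (1 - p) * norm (g x) powr p
      + \<theta> powr (1 - p) * norm (f x - g x) powr p" for x
  proof -
    have "norm (f x) powr p \<le> (norm (g x) + norm (f x - g x)) powr p"
      using \<theta> norm_triangle_sub[of "f x" "g x"] by (intro powr_mono2) auto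
    also have "\<dots> \<le> (1 - \<theta>) powr (1 - p) * norm (g x) powr p + \<theta> powr (1 - p) * norm (f x - g x) powr p"
      using \<theta> by (intro powr_add_le_split) auto
    finally show ?thesis .
  qed
  then have "(\<integral>\<^sup>+ x. ennreal (norm (f x) powr p) \<partial>M) \<le>
    (\<integral>\<^sup>+ x. ennreal ((1 - \<theta>) powr (1 - p)) * ennreal (norm (g x) powr p) +
       ennreal (\<theta> powr (1 - p)) * ennreal (norm (f x - g x) powr p) \<partial>M)"
    by (intro nn_integral_mono) (simp add: ennreal_mult[symmetric] ennreal_plus[symmetric] del: ennreal_plus)
  also have "\<dots> = ennreal ((1 - \<theta>) powr (1 - p)) * (\<integral>\<^sup>+ x. ennreal (norm (g x) powr p) \<partial>M) +
     ennreal (\<theta> powr (1 - p)) * (\<integral>\<^sup>+ x. ennreal (norm (f x - g x) powr p) \<partial>M)"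
    by (subst nn_integral_add) (auto simp: nn_integral_cmult)
  finally show ?thesis .
qed

lemma continuous_imp_measurable_lebesgue_on:
  fixes f :: "'a::euclidean_space \<Rightarrow> 'b::euclidean_space"
  assumes "continuous_on UNIV f"
  shows "f \<in> borel_measurable (lebesgue_on \<Omega>)"
proof -
  have "f \<in> borel_measurable borel" using assms by (rule borel_measurable_continuous_onI)
  then have "f \<in> borel_measurable lebesgue" by (auto intro: measurable_completion)
  then show ?thesis by (rule measurable_restrict_space1)
qed

lemma nn_integral_lebesgue_on_support:
  assumes "\<Omega> \<in> sets lebesgue" "\<And>x. x \<notin> \<Omega> \<Longrightarrow> f x = 0"
  shows "(\<integral>\<^sup>+ x. f x \<partial>lebesgue_on \<Omega>) = (\<integral>\<^sup>+ x. f x \<partial>lborel)"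
proof -
  have "(\<lambda>x. f x * indicator \<Omega> x) = f" using assms by (auto simp: indicator_def)
  then show ?thesis using assms
    by (simp add: nn_integral_restrict_space nn_integral_completion)
qed

lemma integral_lebesgue_on_support:
  fixes f :: "'a::euclidean_space \<Rightarrow> real"
  assumes "\<Omega> \<in> sets lebesgue" "\<And>x. x \<notin> \<Omega> \<Longrightarrow> f x = 0" "f \<in> borel_measurable borel"
  shows "(\<integral> x. f x \<partial>lebesgue_on \<Omega>) = (\<integral> x. f x \<partial>lborel)"
proof -
  have "(\<lambda>x. indicator \<Omega> x *\<^sub>R f x) = f"
    using assms(2) by (auto simp: indicator_def fun_eq_iff)
  then show ?thesis using assms
    by (simp add: integral_restrict_space integral_completion)
qed

lemma nn_integral_test_function:
  assumes "\<phi> \<in> test_functions \<Omega>" "\<Omega> \<in> sets lebesgue" "p > 0"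
  shows "(\<integral>\<^sup>+ x. ennreal (norm (\<phi> x) powr p) \<partial>lebesgue_on \<Omega>) = ennreal (LINT x|lborel. \<bar>\<phi> x\<bar> powr p)"
    "(\<integral>\<^sup>+ x. ennreal (norm (grad \<phi> x) powr p) \<partial>lebesgue_on \<Omega>) = ennreal (LINT x|lborel. norm (grad \<phi> x) powr p)"
proof -
  have 0: "\<phi> x = 0" "grad \<phi> x = 0" if "x \<notin> \<Omega>" for x
    using test_function_outside[of x \<phi>] test_functionsD(3)[OF assms(1)] that by auto
  have "(\<integral>\<^sup>+ x. ennreal (norm (\<phi> x) powr p) \<partial>lebesgue_on \<Omega>) = (\<integral>\<^sup>+ x. ennreal (norm (\<phi> x) powr p) \<partial>lborel)"
    using 0 assms by (intro nn_integral_lebesgue_on_support) auto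
  also have "\<dots> = ennreal (LINT x|lborel. \<bar>\<phi> x\<bar> powr p)"
    using integrable_test_function(2)[OF assms(1,3)] by (subst nn_integral_eq_integral) auto
  finally show "(\<integral>\<^sup>+ x. ennreal (norm (\<phi> x) powr p) \<partial>lebesgue_on \<Omega>) = ennreal (LINT x|lborel. \<bar>\<phi> x\<bar> powr p)" .
  have "(\<integral>\<^sup>+ x. ennreal (norm (grad \<phi> x) powr p) \<partial>lebesgue_on \<Omega>)
      = (\<integral>\<^sup>+ x. ennreal (norm (grad \<phi> x) powr p) \<partial>lborel)"
    using 0 assms by (intro nn_integral_lebesgue_on_support) auto
  also have "\<dots> = ennreal (LINT x|lborel. norm (grad \<phi> x) powr p)"
    using integrable_test_function(3)[OF assms(1,3)] by (subst nn_integral_eq_integral) auto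
  finally show "(\<integral>\<^sup>+ x. ennreal (norm (grad \<phi> x) powr p) \<partial>lebesgue_on \<Omega>)
      = ennreal (LINT x|lborel. norm (grad \<phi> x) powr p)" .
qed

lemma Lp_tendsto_nn_integral_finite:
  assumes "Lp_tendsto p M f g" "\<And>n. f n \<in> borel_measurable M" "p \<ge> 1"
    "\<And>n. (\<integral>\<^sup>+ x. ennreal (norm (f n x) powr p) \<partial>M) < \<infinity>"
  shows "(\<integral>\<^sup>+ x. ennreal (norm (g x) powr p) \<partial>M) < \<infinity>"
proof -
  let ?e = "\<lambda>n. \<integral>\<^sup>+ x. ennreal (norm (f n x - g x) powr p) \<partial>M"
  have [measurable]: "g \<in> borel_measurable M" and lim: "?e \<longlonglongrightarrow> 0"
    using assms(1) by (auto simp: Lp_tendsto_def)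
  have "eventually (\<lambda>n. ?e n < 1) sequentially"
    using order_tendstoD(2)[OF lim, of 1] by simp
  then obtain n where n: "?e n < 1" by (auto simp: eventually_sequentially)
  have e: "(\<integral>\<^sup>+ x. ennreal (norm (g x - f n x) powr p) \<partial>M) = ?e n"
    by (simp add: norm_minus_commute)
  have "(\<integral>\<^sup>+ x. ennreal (norm (g x) powr p) \<partial>M) \<le>
     ennreal ((1 - 1/2) powr (1 - p)) * (\<integral>\<^sup>+ x. ennreal (norm (f n x) powr p) \<partial>M) +
     ennreal ((1/2) powr (1 - p)) * ?e n"
    unfolding e[symmetric] using assms(2,3) by (intro nn_integral_powr_split) auto
  also have "\<dots> < \<infinity>"
    using assms(4)[of n] less_trans[OF n ennreal_one_less_top]
    by (simp add: ennreal_mult_eq_top_iff less_top[symmetric])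
  finally show ?thesis .
qed

text \<open>Ensures that the integrals of p-th powers in the two quotients are genuine and not the
  default value 0 of a non-integrable function.\<close>

lemma W0_integrable:
  assumes "(u, G) \<in> W0 p \<Omega>" "\<Omega> \<in> sets lebesgue" "p \<ge> 1"
  shows "u \<in> borel_measurable (lebesgue_on \<Omega>)" "G \<in> borel_measurable (lebesgue_on \<Omega>)"
    "integrable (lebesgue_on \<Omega>) (\<lambda>x. \<bar>u x\<bar> powr p)"
    "integrable (lebesgue_on \<Omega>) (\<lambda>x. norm (G x) powr p)"
proof -
  obtain \<phi> where \<phi>: "\<And>n. \<phi> n \<in> test_functions \<Omega>" "Lp_tendsto p (lebesgue_on \<Omega>) \<phi> u"
    "Lp_tendsto p (lebesgue_on \<Omega>) (\<lambda>n. grad (\<phi> n)) G"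
    using assms by (auto simp: W0_def)
  show m [measurable]: "u \<in> borel_measurable (lebesgue_on \<Omega>)" "G \<in> borel_measurable (lebesgue_on \<Omega>)"
    using \<phi> by (auto simp: Lp_tendsto_def)
  have "(\<integral>\<^sup>+ x. ennreal (norm (u x) powr p) \<partial>lebesgue_on \<Omega>) < \<infinity>"
    using assms nn_integral_test_function(1)[OF \<phi>(1)] \<phi> test_functionsD(4)[OF \<phi>(1)]
    by (intro Lp_tendsto_nn_integral_finite[OF \<phi>(2)] continuous_imp_measurable_lebesgue_on) auto
  then show "integrable (lebesgue_on \<Omega>) (\<lambda>x. \<bar>u x\<bar> powr p)"
    by (intro integrableI_bounded) auto
  have "(\<integral>\<^sup>+ x. ennreal (norm (G x) powr p) \<partial>lebesgue_on \<Omega>) < \<infinity>"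
    using assms nn_integral_test_function(2)[OF \<phi>(1)] \<phi> continuous_grad_test_function[OF \<phi>(1)]
    by (intro Lp_tendsto_nn_integral_finite[OF \<phi>(3)] continuous_imp_measurable_lebesgue_on) auto
  then show "integrable (lebesgue_on \<Omega>) (\<lambda>x. norm (G x) powr p)"
    by (intro integrableI_bounded) auto
qed

lemma integral_powr_pos:
  assumes "integrable M (\<lambda>x. \<bar>u x :: real\<bar> powr p)" "\<not> (AE x in M. u x = 0)"
  shows "(\<integral>x. \<bar>u x\<bar> powr p \<partial>M) > 0"
proof -
  have "(\<integral>x. \<bar>u x\<bar> powr p \<partial>M) \<noteq> 0"
    using assms by (subst integral_nonneg_eq_0_iff_AE) auto
  moreover have "(\<integral>x. \<bar>u x\<bar> powr p \<partial>M) \<ge> 0" by (rule Bochner_Integration.integral_nonneg) auto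
  ultimately show ?thesis by linarith
qed

text \<open>Density argument. The passage from \<open>u\<close> to \<open>\<phi> n\<close> and that
  from \<open>grad (\<phi> n)\<close> to \<open>G\<close> each cost a factor (1 - \<theta>)^(1-p)
  and an error that vanishes as n grows; only afterwards does \<theta> tend to 0.\<close>

lemma W0_poincare:
  assumes "(u, G) \<in> W0 p \<Omega>" "\<Omega> \<in> sets lebesgue" "p > 1" "\<Lambda> \<ge> 0"
    and \<Lambda>: "\<And>\<phi>. \<phi> \<in> test_functions \<Omega> \<Longrightarrow>
      \<Lambda> * (LINT x|lborel. \<bar>\<phi> x\<bar> powr p) \<le> (LINT x|lborel. norm (grad \<phi> x) powr p)"
  shows "\<Lambda> * (LINT x|lebesgue_on \<Omega>. \<bar>u x\<bar> powr p) \<le> (LINT x|lebesgue_on \<Omega>. norm (G x) powr p)"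
proof -
  let ?M = "lebesgue_on \<Omega>"
  let ?N = "\<lambda>f. \<integral>\<^sup>+ x. ennreal (norm (f x) powr p) \<partial>?M"
  obtain \<phi> where \<phi>: "\<And>n. \<phi> n \<in> test_functions \<Omega>" "Lp_tendsto p ?M \<phi> u"
    "Lp_tendsto p ?M (\<lambda>n. grad (\<phi> n)) G"
    using assms by (auto simp: W0_def)
  note int = W0_integrable[OF assms(1,2)]
  have [measurable]: "u \<in> borel_measurable ?M" "G \<in> borel_measurable ?M" using int assms by auto
  have [measurable]: "\<phi> n \<in> borel_measurable ?M" for n
    using test_functionsD(4)[OF \<phi>(1)] by (rule continuous_imp_measurable_lebesgue_on)
  have [measurable]: "grad (\<phi> n) \<in> borel_measurable ?M" for n
    using continuous_grad_test_function[OF \<phi>(1)] by (rule continuous_imp_measurable_lebesgue_on)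
  define e where "e n = (\<integral>\<^sup>+ x. ennreal (norm (\<phi> n x - u x) powr p) \<partial>?M)" for n
  define e' where "e' n = (\<integral>\<^sup>+ x. ennreal (norm (grad (\<phi> n) x - G x) powr p) \<partial>?M)" for n
  have lim: "e \<longlonglongrightarrow> 0" "e' \<longlonglongrightarrow> 0" using \<phi> by (auto simp: Lp_tendsto_def e_def[abs_def] e'_def[abs_def])
  define A where "A = (LINT x|?M. \<bar>u x\<bar> powr p)"
  define B where "B = (LINT x|?M. norm (G x) powr p)"
  have A: "?N u = ennreal A" "A \<ge> 0" and B: "?N G = ennreal B" "B \<ge> 0"
    unfolding A_def B_def using int assms by (auto simp: nn_integral_eq_integral)
  have key: "\<Lambda> * A \<le> (1 - \<theta>) powr (1 - p) * ((1 - \<theta>) powr (1 - p) * B)" if \<theta>: "0 < \<theta>" "\<theta> < 1" for \<theta>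
  proof -
    define c where "c = (1 - \<theta>) powr (1 - p)"
    define d where "d = \<theta> powr (1 - p)"
    have cd: "c \<ge> 0" "d \<ge> 0" by (auto simp: c_def d_def)
    have *: "ennreal (\<Lambda> * A) \<le> ennreal c * (ennreal c * ennreal B + ennreal d * e' n) + ennreal (\<Lambda> * d) * e n" for n
    proof -
      have "?N u \<le> ennreal c * ?N (\<phi> n) + ennreal d * e n"
        using nn_integral_powr_split[of u ?M "\<phi> n" \<theta> p] \<theta> assms(3)
        by (simp add: e_def c_def d_def abs_minus_commute)
      then have "ennreal \<Lambda> * ennreal A \<le> ennreal \<Lambda> * (ennreal c * ?N (\<phi> n) + ennreal d * e n)"
        unfolding A by (rule mult_left_mono) simp
      also have "\<dots> = ennreal c * (ennreal \<Lambda> * ?N (\<phi> n)) + ennreal (\<Lambda> * d) * e n"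
        using assms(4) cd by (simp add: ennreal_mult distrib_left mult_ac)
      also have "ennreal \<Lambda> * ?N (\<phi> n) \<le> ?N (grad (\<phi> n))"
        using \<Lambda>[OF \<phi>(1), of n] nn_integral_test_function[OF \<phi>(1) assms(2), of p n] assms(3,4)
        by (simp add: ennreal_mult[symmetric] ennreal_leI)
      also have "?N (grad (\<phi> n)) \<le> ennreal c * ?N G + ennreal d * e' n"
        using nn_integral_powr_split[of "grad (\<phi> n)" ?M G \<theta> p] \<theta> assms(3)
        by (simp add: e'_def c_def d_def)
      finally show ?thesis
        using assms(4) A B by (simp add: ennreal_mult mult_left_mono add_right_mono)
    qed
    have "(\<lambda>n. ennreal c * (ennreal c * ennreal B + ennreal d * e' n) + ennreal (\<Lambda> * d) * e n)
      \<longlonglongrightarrow> ennreal c * (ennreal c * ennreal B + ennreal d * 0) + ennreal (\<Lambda> * d) * 0"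
      by (intro tendsto_add ennreal_tendsto_cmult tendsto_const lim) auto
    then have "ennreal (\<Lambda> * A) \<le> ennreal c * (ennreal c * ennreal B + ennreal d * 0) + ennreal (\<Lambda> * d) * 0"
      by (rule LIMSEQ_le_const) (use * in auto)
    then have "ennreal (\<Lambda> * A) \<le> ennreal (c * (c * B))"
      using cd B by (simp add: ennreal_mult)
    then show ?thesis using cd B by (simp add: c_def[symmetric])
  qed
  have "((\<lambda>\<theta>. (1 - \<theta>) powr (1 - p) * ((1 - \<theta>) powr (1 - p) * B)) \<longlongrightarrow>
     (1 - 0) powr (1 - p) * ((1 - 0) powr (1 - p) * B)) (at_right 0)"
    by (intro tendsto_intros) auto
  moreover have "eventually (\<lambda>\<theta>. \<Lambda> * A \<le> (1 - \<theta>) powr (1 - p) * ((1 - \<theta>) powr (1 - p) * B)) (at_right 0)"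
    using key by (auto simp: eventually_at_right_field intro!: exI[of _ 1])
  ultimately have "\<Lambda> * A \<le> (1 - 0) powr (1 - p) * ((1 - 0) powr (1 - p) * B)"
    by (intro tendsto_lowerbound[where F="at_right 0"]) auto
  then show ?thesis by (simp add: A_def B_def)
qed

lemma principal_eigenvalue_ge:
  assumes "open \<Omega>" "p > 1" "\<Lambda> \<ge> 0"
    and "\<And>\<phi>. \<phi> \<in> test_functions \<Omega> \<Longrightarrow>
      \<Lambda> * (LINT x|lborel. \<bar>\<phi> x\<bar> powr p) \<le> (LINT x|lborel. norm (grad \<phi> x) powr p)"
  shows "ereal \<Lambda> \<le> principal_eigenvalue p \<Omega>"
  unfolding principal_eigenvalue_def
proof (rule INF_greatest, clarify)
  fix u G assume uG: "(u, G) \<in> W0_nonzero p \<Omega>"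
  have L: "\<Omega> \<in> sets lebesgue" using assms(1) by simp
  from uG have W: "(u, G) \<in> W0 p \<Omega>" "\<not> (AE x in lebesgue_on \<Omega>. u x = 0)"
    by (auto simp: W0_nonzero_def)
  have "(LINT x|lebesgue_on \<Omega>. \<bar>u x\<bar> powr p) > 0"
    using W0_integrable(3)[OF W(1) L] W(2) assms(2) by (intro integral_powr_pos) auto
  then show "ereal \<Lambda> \<le> ereal ((LINT x|lebesgue_on \<Omega>. norm (G x) powr p) / (LINT x|lebesgue_on \<Omega>. \<bar>u x\<bar> powr p))"
    using W0_poincare[OF W(1) L assms(2-4)] by (simp add: pos_le_divide_eq)
qed

lemma torsional_rigidity_ge:
  assumes "open \<Omega>" "p > 1" "\<phi> \<in> test_functions \<Omega>" "(LINT x|lborel. \<bar>\<phi> x\<bar>) > 0"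
  shows "ereal ((LINT x|lborel. \<bar>\<phi> x\<bar>) powr p / (LINT x|lborel. norm (grad \<phi> x) powr p))
    \<le> torsional_rigidity p \<Omega>"
proof -
  have L: "\<Omega> \<in> sets lebesgue" using assms(1) by simp
  have 0: "\<phi> x = 0" "grad \<phi> x = 0" if "x \<notin> \<Omega>" for x
    using test_function_outside[of x \<phi>] test_functionsD(3)[OF assms(3)] that by auto
  note c [measurable] = borel_measurable_continuous_onI[OF test_functionsD(4)[OF assms(3)]]
    borel_measurable_continuous_onI[OF continuous_grad_test_function[OF assms(3)]]
  have eq: "(LINT x|lebesgue_on \<Omega>. \<bar>\<phi> x\<bar>) = (LINT x|lborel. \<bar>\<phi> x\<bar>)"
    "(LINT x|lebesgue_on \<Omega>. norm (grad \<phi> x) powr p) = (LINT x|lborel. norm (grad \<phi> x) powr p)"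
    using 0 L assms(2) by (intro integral_lebesgue_on_support; auto)+
  have "(\<phi>, grad \<phi>) \<in> W0 p \<Omega>"
    using assms(3) continuous_grad_test_function[OF assms(3)] test_functionsD(4)[OF assms(3)] assms(2)
    by (auto simp: W0_def Lp_tendsto_def intro!: exI[of _ "\<lambda>_. \<phi>"] continuous_imp_measurable_lebesgue_on)
  moreover have "\<not> (AE x in lebesgue_on \<Omega>. \<phi> x = 0)"
  proof
    assume "AE x in lebesgue_on \<Omega>. \<phi> x = 0"
    then have "(LINT x|lebesgue_on \<Omega>. \<bar>\<phi> x\<bar>) = 0" by (intro integral_eq_zero_AE) auto
    with eq assms(4) show False by simp
  qed
  ultimately have "(\<phi>, grad \<phi>) \<in> W0_nonzero p \<Omega>" by (simp add: W0_nonzero_def)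
  from SUP_upper[OF this, of "\<lambda>(u, G). ereal ((LINT x|lebesgue_on \<Omega>. \<bar>u x\<bar>) powr p / (LINT x|lebesgue_on \<Omega>. norm (G x) powr p))"]
  show ?thesis unfolding torsional_rigidity_def by (simp add: eq)
qed

section \<open>The upper bound of the product, and the tool for its lower bound\<close>

lemma F_p1_le_1:
  fixes \<Omega> :: "'a::euclidean_space set"
  assumes "open \<Omega>" "0 < emeasure lebesgue \<Omega>" "emeasure lebesgue \<Omega> < \<infinity>" "p > 1"
  shows "F_p1 p \<Omega> \<le> 1"
proof -
  let ?M = "lebesgue_on \<Omega>"
  define m where "m = measure lebesgue \<Omega> powr (p - 1)"
  have L: "\<Omega> \<in> sets lebesgue" using assms(1) by simp
  have m: "m > 0"
    using assms enn2real_positive_iff[of "emeasure lebesgue \<Omega>"] by (simp add: m_def measure_def)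
  have fin: "finite_measure ?M"
    using assms L by (intro finite_measureI) (simp add: emeasure_restrict_space)
  have mm: "measure ?M (space ?M) powr (p - 1) = m"
    using L by (simp add: m_def measure_restrict_space)
  define lam where "lam = principal_eigenvalue p \<Omega>"
  have lam0: "lam \<ge> 0"
    unfolding lam_def principal_eigenvalue_def
    by (rule INF_greatest) (auto intro!: divide_nonneg_nonneg)
  have "lam * torsional_rigidity p \<Omega> \<le> ereal m"
  proof (cases "W0_nonzero p \<Omega> = {}")
    case True
    then have "torsional_rigidity p \<Omega> = - \<infinity>"
      unfolding torsional_rigidity_def True by (simp add: bot_ereal_def)
    moreover have "lam = \<infinity>"
      unfolding lam_def principal_eigenvalue_def True by (simp add: top_ereal_def)
    ultimately show ?thesis by simp
  next
    case False
    then obtain u0 G0 where "(u0, G0) \<in> W0_nonzero p \<Omega>" by auto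
    from INF_lower[OF this, of "\<lambda>(u, G). ereal ((LINT x|lebesgue_on \<Omega>. norm (G x) powr p) / (LINT x|lebesgue_on \<Omega>. \<bar>u x\<bar> powr p))"]
    have "lam < \<infinity>"
      unfolding lam_def principal_eigenvalue_def by auto
    then obtain l where l: "lam = ereal l" "l \<ge> 0" using lam0 by (cases lam) auto
    show ?thesis
    \<comment> \<open>In \<open>ereal\<close> the product of 0 and \<infinity> is 0, so a vanishing
      \<open>l\<close> gives the bound at once. Otherwise \<open>l * D > 0\<close> makes the energy
      positive and the torsion quotient a genuine fraction.\<close>
    proof (cases "l = 0")
      case True
      then show ?thesis using l m by (simp add: zero_ereal_def[symmetric])
    next
      case False
      have "torsional_rigidity p \<Omega> \<le> ereal (m / l)"
        unfolding torsional_rigidity_def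
      proof (rule SUP_least, clarify)
        fix u G assume uG: "(u, G) \<in> W0_nonzero p \<Omega>"
        then have W: "(u, G) \<in> W0 p \<Omega>" "\<not> (AE x in ?M. u x = 0)" by (auto simp: W0_nonzero_def)
        note int = W0_integrable[OF W(1) L]
        define D where "D = (LINT x|?M. \<bar>u x\<bar> powr p)"
        define N where "N = (LINT x|?M. norm (G x) powr p)"
        have D: "D > 0" unfolding D_def using int W assms by (intro integral_powr_pos) auto
        have "(LINT x|?M. \<bar>u x\<bar>) powr p \<le> m * D"
          unfolding D_def mm[symmetric] using int assms fin by (intro integral_powr_le) auto
        moreover have "lam \<le> ereal (N / D)"
          unfolding lam_def principal_eigenvalue_def N_def D_def
          using INF_lower[OF uG, of "\<lambda>(u, G). ereal ((LINT x|lebesgue_on \<Omega>. norm (G x) powr p) / (LINT x|lebesgue_on \<Omega>. \<bar>u x\<bar> powr p))"]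
          by simp
        then have lD: "l * D \<le> N" using l D by (simp add: pos_le_divide_eq)
        moreover have "l * D > 0" using l False D by simp
        ultimately have "(LINT x|?M. \<bar>u x\<bar>) powr p / N \<le> m * D / (l * D)"
          using m D by (intro frac_le) auto
        also have "\<dots> = m / l" using D by simp
        finally show "ereal ((LINT x|?M. \<bar>u x\<bar>) powr p / (LINT x|?M. norm (G x) powr p)) \<le> ereal (m / l)"
          by (simp add: N_def)
      qed
      then have "lam * torsional_rigidity p \<Omega> \<le> ereal l * ereal (m / l)"
        unfolding l using l by (intro ereal_mult_left_mono) auto
      then show ?thesis using False by simp
    qed
  qed
  then have "F_p1 p \<Omega> \<le> ereal m / ereal m"
    unfolding F_p1_def lam_def m_def[symmetric] using m by (intro ereal_divide_right_mono) auto
  then show ?thesis using m by (simp add: one_ereal_def)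
qed

text \<open>Here \<Lambda> may be a Poincare constant inherited from any larger open set and
  \<open>V\<close> any bound of the volume; a single test function then gives a lower bound.\<close>

lemma F_p1_ge:
  fixes \<Omega> :: "'a::euclidean_space set"
  assumes "open \<Omega>" "0 < emeasure lebesgue \<Omega>" "emeasure lebesgue \<Omega> \<le> ennreal V" "p > 1" "\<Lambda> > 0" "V \<ge> 0"
    and "\<And>\<phi>. \<phi> \<in> test_functions \<Omega> \<Longrightarrow>
      \<Lambda> * (LINT x|lborel. \<bar>\<phi> x\<bar> powr p) \<le> (LINT x|lborel. norm (grad \<phi> x) powr p)"
    and "\<phi> \<in> test_functions \<Omega>" "(LINT x|lborel. \<bar>\<phi> x\<bar>) > 0"
  shows "ereal (\<Lambda> * ((LINT x|lborel. \<bar>\<phi> x\<bar>) powr p / (LINT x|lborel. norm (grad \<phi> x) powr p)) / V powr (p - 1))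
    \<le> F_p1 p \<Omega>"
proof -
  define m where "m = measure lebesgue \<Omega>"
  define T where "T = (LINT x|lborel. \<bar>\<phi> x\<bar>) powr p / (LINT x|lborel. norm (grad \<phi> x) powr p)"
  have T0: "T \<ge> 0" unfolding T_def by (intro divide_nonneg_nonneg Bochner_Integration.integral_nonneg) auto
  have m: "m > 0" "m \<le> V"
    using assms(2,3,6) le_less_trans[OF assms(3) ennreal_less_top]
    by (auto simp: m_def measure_def enn2real_positive_iff intro: enn2real_leI)
  have "ereal \<Lambda> * ereal T \<le> principal_eigenvalue p \<Omega> * torsional_rigidity p \<Omega>"
    using assms T0 principal_eigenvalue_ge[of \<Omega> p \<Lambda>] torsional_rigidity_ge[of \<Omega> p \<phi>]
    by (intro ereal_mult_mono) (auto simp: T_def intro: order_trans[of 0 "ereal \<Lambda>"])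
  then have "ereal (\<Lambda> * T) / ereal (m powr (p - 1)) \<le> F_p1 p \<Omega>"
    unfolding F_p1_def m_def[symmetric] using m by (intro ereal_divide_right_mono) auto
  moreover have "\<Lambda> * T / V powr (p - 1) \<le> \<Lambda> * T / m powr (p - 1)"
    using m assms T0 by (intro divide_left_mono mult_pos_pos powr_mono2) auto
  ultimately show ?thesis using m
    by (simp add: T_def[symmetric]) (meson ereal_less_eq(3) order_trans)
qed

subsection \<open>Translates of a test function\<close>

lemma nn_integral_lborel_translate:
  fixes f :: "'a::euclidean_space \<Rightarrow> ennreal"
  assumes [measurable]: "f \<in> borel_measurable borel"
  shows "(\<integral>\<^sup>+ x. f (x + a) \<partial>lborel) = (\<integral>\<^sup>+ x. f x \<partial>lborel)"
proof -
  have "(\<integral>\<^sup>+ x. f x \<partial>lborel) = (\<integral>\<^sup>+ x. f x \<partial>distr lborel borel ((+) a))"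
    by (simp add: lborel_distr_plus)
  also have "\<dots> = (\<integral>\<^sup>+ x. f (a + x) \<partial>lborel)"
    by (subst nn_integral_distr) auto
  finally show ?thesis by (simp add: add.commute)
qed

lemma nn_integral_lborel_swap:
  fixes f :: "'a::euclidean_space \<Rightarrow> 'b::euclidean_space \<Rightarrow> ennreal"
  assumes "(\<lambda>(x, y). f x y) \<in> borel_measurable borel"
  shows "(\<integral>\<^sup>+ y. (\<integral>\<^sup>+ x. f x y \<partial>lborel) \<partial>lborel) = (\<integral>\<^sup>+ x. (\<integral>\<^sup>+ y. f x y \<partial>lborel) \<partial>lborel)"
  using assms by (intro lborel_pair.Fubini') (simp add: lborel_prod)

text \<open>The increment is the integral of the derivative along the segment, and Jensen applies on
  [0, 1], which has measure 1. The bound is a nonnegative integral so that the order of integration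
  can be exchanged next.\<close>

lemma test_function_increment:
  fixes h :: "'a::euclidean_space"
  assumes \<phi>: "\<phi> \<in> test_functions \<Omega>" and p: "p \<ge> 1"
  shows "ennreal (\<bar>\<phi> (x + h) - \<phi> x\<bar> powr p)
    \<le> (\<integral>\<^sup>+ t. indicator {0..1} t * ennreal ((norm h * norm (grad \<phi> (x + t *\<^sub>R h))) powr p) \<partial>lborel)"
proof -
  let ?g = "\<lambda>t. grad \<phi> (x + t *\<^sub>R h) \<bullet> h"
  let ?M = "restrict_space lborel {0..1::real}"
  have "continuous_on UNIV (\<lambda>t. grad \<phi> (x + t *\<^sub>R h))"
    by (intro continuous_on_compose2[OF continuous_grad_test_function[OF \<phi>]] continuous_intros) auto
  then have cg: "continuous_on UNIV ?g" and cn: "continuous_on UNIV (\<lambda>t. norm (grad \<phi> (x + t *\<^sub>R h)))"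
    by (auto intro!: continuous_intros)
  have [measurable]: "?g \<in> borel_measurable borel" "(\<lambda>t. norm (grad \<phi> (x + t *\<^sub>R h))) \<in> borel_measurable borel"
    using cg cn by (auto intro: borel_measurable_continuous_onI)
  have D: "((\<lambda>t. \<phi> (x + t *\<^sub>R h)) has_real_derivative ?g t) (at t)" for t
  proof -
    have "((\<lambda>t. x + t *\<^sub>R h) has_derivative (\<lambda>s. s *\<^sub>R h)) (at t)"
      by (auto intro!: derivative_eq_intros)
    from has_derivative_compose[OF this GDERIV_test_function[OF \<phi>, unfolded gderiv_def]]
    show ?thesis by (simp add: has_field_derivative_def inner_commute mult_commute_abs)
  qed
  have "has_bochner_integral lborel (\<lambda>t. ?g t * indicator {0..1} t) (\<phi> (x + 1 *\<^sub>R h) - \<phi> (x + 0 *\<^sub>R h))"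
    using D cg by (intro has_bochner_integral_FTC_Icc_real) (auto simp: continuous_on_eq_continuous_at)
  then have I: "integrable lborel (\<lambda>t. ?g t * indicator {0..1} t)"
    "(\<integral>t. ?g t * indicator {0..1} t \<partial>lborel) = \<phi> (x + h) - \<phi> x"
    by (auto simp: has_bochner_integral_iff)
  have int: "integrable lborel (\<lambda>t. indicator {0..1} t *\<^sub>R (\<bar>?g t\<bar> powr p))"
  proof (intro borel_integrable_compact compact_Icc)
    have "continuous_on UNIV (\<lambda>t. \<bar>?g t\<bar> powr p)"
      using p by (intro continuous_on_powr_const continuous_on_rabs cg) auto
    then show "continuous_on {0..1} (\<lambda>t. \<bar>?g t\<bar> powr p)" by (rule continuous_on_subset) simp
  qed
  have int2: "integrable lborel (\<lambda>t. indicator {0..1} t * ((norm h * norm (grad \<phi> (x + t *\<^sub>R h))) powr p))"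
  proof -
    have "continuous_on UNIV (\<lambda>t. (norm h * norm (grad \<phi> (x + t *\<^sub>R h))) powr p)"
      using p by (intro continuous_on_powr_const continuous_on_mult continuous_on_const cn) auto
    then have "continuous_on {0..1} (\<lambda>t. (norm h * norm (grad \<phi> (x + t *\<^sub>R h))) powr p)"
      by (rule continuous_on_subset) simp
    from borel_integrable_compact[OF compact_Icc this] show ?thesis by simp
  qed
  have "\<bar>\<phi> (x + h) - \<phi> x\<bar> \<le> (\<integral>t. \<bar>?g t * indicator {0..1} t\<bar> \<partial>lborel)"
    unfolding I(2)[symmetric] by (rule integral_abs_bound)
  also have "\<dots> = (\<integral>t. \<bar>?g t\<bar> \<partial>?M)"
    by (subst integral_restrict_space) (auto simp: abs_mult mult.commute)
  finally have "\<bar>\<phi> (x + h) - \<phi> x\<bar> powr p \<le> (\<integral>t. \<bar>?g t\<bar> \<partial>?M) powr p"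
    using p by (intro powr_mono2) auto
  also have "\<dots> \<le> measure ?M (space ?M) powr (p - 1) * (\<integral>t. \<bar>?g t\<bar> powr p \<partial>?M)"
    using p int by (intro integral_powr_le finite_measureI)
      (auto simp: emeasure_restrict_space integrable_restrict_space space_restrict_space)
  also have "measure ?M (space ?M) powr (p - 1) = 1"
    by (simp add: measure_restrict_space space_restrict_space)
  also have "(\<integral>t. \<bar>?g t\<bar> powr p \<partial>?M) = (\<integral>t. indicator {0..1} t * (\<bar>?g t\<bar> powr p) \<partial>lborel)"
    by (subst integral_restrict_space) auto
  also have "\<dots> \<le> (\<integral>t. indicator {0..1} t * ((norm h * norm (grad \<phi> (x + t *\<^sub>R h))) powr p) \<partial>lborel)"
  proof (rule integral_mono)
    show "indicator {0..1} t * (\<bar>?g t\<bar> powr p) \<le> indicator {0..1} t * ((norm h * norm (grad \<phi> (x + t *\<^sub>R h))) powr p)" for t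
      using p Cauchy_Schwarz_ineq2[of "grad \<phi> (x + t *\<^sub>R h)" h]
      by (intro mult_left_mono powr_mono2) (auto simp: mult.commute)
  qed (use int int2 in auto)
  finally have "ennreal (\<bar>\<phi> (x + h) - \<phi> x\<bar> powr p)
     \<le> ennreal (\<integral>t. indicator {0..1} t * ((norm h * norm (grad \<phi> (x + t *\<^sub>R h))) powr p) \<partial>lborel)"
    by (simp add: ennreal_leI)
  also have "\<dots> = (\<integral>\<^sup>+ t. ennreal (indicator {0..1} t * ((norm h * norm (grad \<phi> (x + t *\<^sub>R h))) powr p)) \<partial>lborel)"
    using int2 by (subst nn_integral_eq_integral) auto
  also have "\<dots> = (\<integral>\<^sup>+ t. indicator {0..1} t * ennreal ((norm h * norm (grad \<phi> (x + t *\<^sub>R h))) powr p) \<partial>lborel)"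
    by (intro nn_integral_cong) (auto split: split_indicator)
  finally show ?thesis .
qed

text \<open>After the exchange of integrals, translation invariance makes the inner one the same for
  all \<open>t\<close>.\<close>

lemma test_function_translation_le:
  fixes h :: "'a::euclidean_space"
  assumes \<phi>: "\<phi> \<in> test_functions \<Omega>" and p: "p \<ge> 1"
  shows "(\<integral>\<^sup>+ x. ennreal (\<bar>\<phi> (x + h) - \<phi> x\<bar> powr p) \<partial>lborel)
    \<le> ennreal (norm h powr p * (LINT x|lborel. norm (grad \<phi> x) powr p))"
proof -
  define G where "G = (\<lambda>x. ennreal ((norm h * norm (grad \<phi> x)) powr p))"
  have [measurable]: "grad \<phi> \<in> borel_measurable borel"
    using continuous_grad_test_function[OF \<phi>] by (rule borel_measurable_continuous_onI)
  have [measurable]: "G \<in> borel_measurable borel" unfolding G_def by measurable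
  have "(\<integral>\<^sup>+ x. ennreal (\<bar>\<phi> (x + h) - \<phi> x\<bar> powr p) \<partial>lborel)
     \<le> (\<integral>\<^sup>+ x. (\<integral>\<^sup>+ t. indicator {0..1::real} t * G (x + t *\<^sub>R h) \<partial>lborel) \<partial>lborel)"
    unfolding G_def by (intro nn_integral_mono test_function_increment[OF \<phi> p])
  also have "\<dots> = (\<integral>\<^sup>+ t. (\<integral>\<^sup>+ x. indicator {0..1::real} t * G (x + t *\<^sub>R h) \<partial>lborel) \<partial>lborel)"
    by (rule nn_integral_lborel_swap[symmetric]) (simp add: borel_prod[symmetric])
  also have "\<dots> = (\<integral>\<^sup>+ t. indicator {0..1::real} t * (\<integral>\<^sup>+ x. G x \<partial>lborel) \<partial>lborel)"
    by (intro nn_integral_cong) (simp add: nn_integral_cmult nn_integral_lborel_translate)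
  also have "\<dots> = (\<integral>\<^sup>+ x. G x \<partial>lborel)"
    by (simp add: nn_integral_multc)
  also have "\<dots> = (\<integral>\<^sup>+ x. ennreal (norm h powr p) * ennreal (norm (grad \<phi> x) powr p) \<partial>lborel)"
    by (intro nn_integral_cong) (simp add: G_def powr_mult ennreal_mult)
  also have "\<dots> = ennreal (norm h powr p) * ennreal (LINT x|lborel. norm (grad \<phi> x) powr p)"
    using integrable_test_function(3)[OF \<phi>, of p] p
    by (subst nn_integral_cmult) (auto simp: nn_integral_eq_integral)
  finally show ?thesis by (simp add: ennreal_mult)
qed

text \<open>The source of both Poincare-type estimates: with displacements that lead into a hole it
  bounds the function itself, with those inside a unit cell it bounds the oscillation.\<close>

lemma test_function_averaged_translation_le:
  fixes H :: "'a::euclidean_space set"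
  assumes \<phi>: "\<phi> \<in> test_functions \<Omega>" and p: "p \<ge> 1"
    and H: "H \<in> sets borel" "\<And>h. h \<in> H \<Longrightarrow> norm h \<le> R"
  shows "(\<integral>\<^sup>+ x. (\<integral>\<^sup>+ h. indicator H h * ennreal (\<bar>\<phi> (x + h) - \<phi> x\<bar> powr p) \<partial>lborel) \<partial>lborel)
    \<le> emeasure lborel H * ennreal (R powr p * (LINT x|lborel. norm (grad \<phi> x) powr p))"
proof -
  have [measurable]: "\<phi> \<in> borel_measurable borel"
    using test_functionsD(4)[OF \<phi>] by (rule borel_measurable_continuous_onI)
  note [measurable] = H(1)
  define E where "E = (LINT x|lborel. norm (grad \<phi> x) powr p)"
  have E: "E \<ge> 0" unfolding E_def by (rule Bochner_Integration.integral_nonneg) auto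
  have "(\<integral>\<^sup>+ x. (\<integral>\<^sup>+ h. indicator H h * ennreal (\<bar>\<phi> (x + h) - \<phi> x\<bar> powr p) \<partial>lborel) \<partial>lborel)
    = (\<integral>\<^sup>+ h. (\<integral>\<^sup>+ x. indicator H h * ennreal (\<bar>\<phi> (x + h) - \<phi> x\<bar> powr p) \<partial>lborel) \<partial>lborel)"
    by (rule nn_integral_lborel_swap[symmetric]) (simp add: borel_prod[symmetric])
  also have "\<dots> = (\<integral>\<^sup>+ h. indicator H h * (\<integral>\<^sup>+ x. ennreal (\<bar>\<phi> (x + h) - \<phi> x\<bar> powr p) \<partial>lborel) \<partial>lborel)"
    by (intro nn_integral_cong) (simp add: nn_integral_cmult)
  also have "\<dots> \<le> (\<integral>\<^sup>+ h. indicator H h * ennreal (R powr p * E) \<partial>lborel)"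
  proof (intro nn_integral_mono)
    fix h
    have "(\<integral>\<^sup>+ x. ennreal (\<bar>\<phi> (x + h) - \<phi> x\<bar> powr p) \<partial>lborel) \<le> ennreal (R powr p * E)" if "h \<in> H"
    proof -
      have "ennreal (norm h powr p * E) \<le> ennreal (R powr p * E)"
        using H(2)[OF that] p E by (intro ennreal_leI mult_right_mono powr_mono2) auto
      with test_function_translation_le[OF \<phi> p, of h] show ?thesis
        unfolding E_def by (rule order_trans)
    qed
    then show "indicator H h * (\<integral>\<^sup>+ x. ennreal (\<bar>\<phi> (x + h) - \<phi> x\<bar> powr p) \<partial>lborel)
       \<le> indicator H h * ennreal (R powr p * E)"
      by (auto split: split_indicator)
  qed
  also have "\<dots> = emeasure lborel H * ennreal (R powr p * E)"
    by (simp add: nn_integral_multc)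
  finally show ?thesis by (simp add: E_def)
qed

subsection \<open>The integer lattice\<close>

text \<open>Half-open, so that the integer translates tile the space without overlap.\<close>

definition unit_cell :: "'a::euclidean_space set" where
  "unit_cell = {x. \<forall>b\<in>Basis. 0 \<le> x \<bullet> b \<and> x \<bullet> b < 1}"

definition lattice_box :: "int \<Rightarrow> int \<Rightarrow> 'a::euclidean_space set" where
  "lattice_box lo hi = {k. \<forall>b\<in>Basis. k \<bullet> b \<in> \<int> \<and> of_int lo \<le> k \<bullet> b \<and> k \<bullet> b < of_int hi}"

definition floor_vec :: "'a::euclidean_space \<Rightarrow> 'a" where
  "floor_vec x = (\<Sum>b\<in>Basis. of_int \<lfloor>x \<bullet> b\<rfloor> *\<^sub>R b)"

lemma floor_vec_inner: "b \<in> Basis \<Longrightarrow> floor_vec x \<bullet> b = of_int \<lfloor>x \<bullet> b\<rfloor>"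
  by (simp add: floor_vec_def inner_sum_left_Basis)

lemma bij_betw_lattice_box:
  "bij_betw (\<lambda>z. \<Sum>b\<in>Basis. of_int (z b) *\<^sub>R b) (Basis \<rightarrow>\<^sub>E {lo..<hi})
     (lattice_box lo hi :: 'a::euclidean_space set)"
proof (rule bij_betwI[where g="\<lambda>k. restrict (\<lambda>b. \<lfloor>k \<bullet> b\<rfloor>) Basis"])
  have inner: "(\<Sum>b\<in>Basis. of_int (z b) *\<^sub>R b) \<bullet> c = of_int (z c)"
    if "c \<in> Basis" for z :: "'a \<Rightarrow> int" and c
    using that by (rule inner_sum_left_Basis)
  show "(\<lambda>z. \<Sum>b\<in>Basis. of_int (z b) *\<^sub>R b) \<in> (Basis \<rightarrow>\<^sub>E {lo..<hi}) \<rightarrow> (lattice_box lo hi :: 'a set)"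
  proof
    fix z assume z: "z \<in> (Basis :: 'a set) \<rightarrow>\<^sub>E {lo..<hi}"
    show "(\<Sum>b\<in>Basis. of_int (z b) *\<^sub>R b) \<in> (lattice_box lo hi :: 'a set)"
      unfolding lattice_box_def using PiE_mem[OF z] by (simp add: inner)
  qed
  show "(\<lambda>k. restrict (\<lambda>b. \<lfloor>k \<bullet> b\<rfloor>) Basis) \<in> (lattice_box lo hi :: 'a set) \<rightarrow> (Basis \<rightarrow>\<^sub>E {lo..<hi})"
    by (auto simp: lattice_box_def le_floor_iff floor_less_iff)
  show "(\<lambda>b\<in>Basis. \<lfloor>(\<Sum>b\<in>Basis. of_int (z b) *\<^sub>R b) \<bullet> b\<rfloor>) = z"
    if "z \<in> (Basis :: 'a set) \<rightarrow>\<^sub>E {lo..<hi}" for z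
  proof
    fix c show "(\<lambda>b\<in>Basis. \<lfloor>(\<Sum>b\<in>Basis. of_int (z b) *\<^sub>R b) \<bullet> b\<rfloor>) c = z c"
      using PiE_arb[OF that] by (cases "c \<in> Basis") (simp_all add: inner)
  qed
  show "(\<Sum>b\<in>Basis. of_int ((\<lambda>b\<in>Basis. \<lfloor>k \<bullet> b\<rfloor>) b) *\<^sub>R b) = k" if k: "k \<in> lattice_box lo hi" for k :: 'a
  proof (rule euclidean_eqI)
    fix c :: 'a assume c: "c \<in> Basis"
    then obtain i where "k \<bullet> c = of_int i" using k by (auto simp: lattice_box_def elim!: Ints_cases)
    then show "(\<Sum>b\<in>Basis. of_int ((\<lambda>b\<in>Basis. \<lfloor>k \<bullet> b\<rfloor>) b) *\<^sub>R b) \<bullet> c = k \<bullet> c"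
      unfolding inner[OF c] using c by simp
  qed
qed

lemma finite_lattice_box: "finite (lattice_box lo hi :: 'a::euclidean_space set)"
  using bij_betw_finite[OF bij_betw_lattice_box[of lo hi]] by (auto intro: finite_PiE)

lemma card_lattice_box: "card (lattice_box lo hi :: 'a::euclidean_space set) = nat (hi - lo) ^ DIM('a)"
  using bij_betw_same_card[OF bij_betw_lattice_box[of lo hi, where 'a='a]]
  by (simp add: card_PiE)

lemma unit_cell_borel [measurable]: "(unit_cell :: 'a::euclidean_space set) \<in> sets borel"
  unfolding unit_cell_def by measurable

lemma emeasure_unit_cell: "emeasure lborel (unit_cell :: 'a::euclidean_space set) = 1"
proof (rule antisym)
  have "emeasure lborel (unit_cell :: 'a set) \<le> emeasure lborel (cbox 0 One :: 'a set)"
    by (rule emeasure_mono) (auto simp: unit_cell_def mem_box less_imp_le)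
  then show "emeasure lborel (unit_cell :: 'a set) \<le> 1" by (simp add: emeasure_lborel_cbox_eq)
  have "emeasure lborel (box 0 One :: 'a set) \<le> emeasure lborel (unit_cell :: 'a set)"
    by (rule emeasure_mono) (auto simp: unit_cell_def mem_box less_imp_le)
  then show "1 \<le> emeasure lborel (unit_cell :: 'a set)" by (simp add: emeasure_lborel_box_eq)
qed

lemma unit_cell_lattice_iff:
  assumes "k \<in> lattice_box lo hi"
  shows "x - k \<in> unit_cell \<longleftrightarrow> floor_vec x = k"
proof -
  have "x - k \<in> unit_cell \<longleftrightarrow> (\<forall>b\<in>Basis. floor_vec x \<bullet> b = k \<bullet> b)"
    unfolding unit_cell_def mem_Collect_eq
  proof (intro ball_cong refl)
    fix b :: 'a assume b: "b \<in> Basis"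
    then obtain i where "k \<bullet> b = of_int i" using assms by (auto simp: lattice_box_def elim!: Ints_cases)
    then show "(0 \<le> (x - k) \<bullet> b \<and> (x - k) \<bullet> b < 1) = (floor_vec x \<bullet> b = k \<bullet> b)"
      using b by (auto simp: floor_vec_inner inner_diff_left floor_eq_iff)
  qed
  then show ?thesis by (metis euclidean_eqI)
qed

text \<open>After the cells are translated to their places, at most one summand is nonzero at each
  point, namely that of \<open>k = floor_vec x\<close>.\<close>

lemma nn_integral_lattice_cells:
  fixes f :: "'a::euclidean_space \<Rightarrow> ennreal"
  assumes [measurable]: "f \<in> borel_measurable borel"
  shows "(\<Sum>k\<in>lattice_box lo hi. \<integral>\<^sup>+ x. indicator unit_cell x * f (x + k) \<partial>lborel)
    = (\<integral>\<^sup>+ x. of_bool (floor_vec x \<in> lattice_box lo hi) * f x \<partial>lborel)"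
proof -
  let ?K = "lattice_box lo hi :: 'a set"
  have "(\<Sum>k\<in>?K. \<integral>\<^sup>+ x. indicator unit_cell x * f (x + k) \<partial>lborel)
      = (\<Sum>k\<in>?K. \<integral>\<^sup>+ x. indicator unit_cell (x - k) * f x \<partial>lborel)"
  proof (intro sum.cong refl)
    fix k
    show "(\<integral>\<^sup>+ x. indicator unit_cell x * f (x + k) \<partial>lborel)
      = (\<integral>\<^sup>+ x. indicator unit_cell (x - k) * f x \<partial>lborel)"
      using nn_integral_lborel_translate[of "\<lambda>x. indicator unit_cell (x - k) * f x" k] by simp
  qed
  also have "\<dots> = (\<integral>\<^sup>+ x. (\<Sum>k\<in>?K. indicator unit_cell (x - k) * f x) \<partial>lborel)"
    by (subst nn_integral_sum) auto
  also have "\<dots> = (\<integral>\<^sup>+ x. of_bool (floor_vec x \<in> ?K) * f x \<partial>lborel)"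
  proof (intro nn_integral_cong)
    fix x :: 'a
    have "(\<Sum>k\<in>?K. indicator unit_cell (x - k) * f x) = (\<Sum>k\<in>?K. if floor_vec x = k then f x else 0)"
      by (intro sum.cong refl) (auto simp: unit_cell_lattice_iff indicator_def)
    then show "(\<Sum>k\<in>?K. indicator unit_cell (x - k) * f x) = of_bool (floor_vec x \<in> ?K) * f x"
      by (simp add: finite_lattice_box)
  qed
  finally show ?thesis .
qed

subsection \<open>The periodically perforated space\<close>

text \<open>A smooth, lattice-periodic substitute for the squared distance to the integer points,
  where it vanishes and nowhere else. Its sublevel sets are the holes.\<close>

definition lat_dist :: "'a::euclidean_space \<Rightarrow> real" where
  "lat_dist x = (\<Sum>b\<in>Basis. (sin (pi * (x \<bullet> b)))\<^sup>2)"

lemma lat_dist_nonneg: "lat_dist x \<ge> 0"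
  by (auto simp: lat_dist_def intro: sum_nonneg)

lemma C_k_lat_dist: "C_k k lat_dist"
  unfolding lat_dist_def[abs_def] power2_eq_square
  by (intro C_k_sum C_k_mult C_k_sin C_k_const C_k_inner) auto

lemma continuous_lat_dist: "continuous_on UNIV lat_dist"
  using C_k_lat_dist[of 0] by simp

lemma lat_dist_periodic:
  assumes "k \<in> lattice_box lo hi"
  shows "lat_dist (x + k) = lat_dist x"
  unfolding lat_dist_def
proof (intro sum.cong refl)
  fix b :: 'a assume b: "b \<in> Basis"
  then obtain i where "k \<bullet> b = of_int i" using assms by (auto simp: lattice_box_def elim!: Ints_cases)
  moreover have "(sin (pi * (x \<bullet> b) + pi * of_int i))\<^sup>2 = (sin (pi * (x \<bullet> b)))\<^sup>2"
    by (simp add: sin_add sin_integer_2pi power_mult_distrib cos_squared_eq)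
  ultimately show "(sin (pi * ((x + k) \<bullet> b)))\<^sup>2 = (sin (pi * (x \<bullet> b)))\<^sup>2"
    by (simp add: inner_add_left distrib_left)
qed

lemma lat_dist_0 [simp]: "lat_dist 0 = 0"
  by (simp add: lat_dist_def)

lemma floor_vec_near: "norm (floor_vec x - x) \<le> DIM('a)" for x :: "'a::euclidean_space"
proof -
  have "norm (floor_vec x - x) \<le> (\<Sum>b\<in>Basis. \<bar>(floor_vec x - x) \<bullet> b\<bar>)" by (rule norm_le_l1)
  also have "\<dots> \<le> (\<Sum>b\<in>(Basis::'a set). 1)"
    by (intro sum_mono) (simp add: inner_diff_left floor_vec_inner abs_le_iff; linarith)
  finally show ?thesis by simp
qed

lemma floor_vec_lattice: "\<exists>lo hi. floor_vec x \<in> lattice_box lo hi"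
proof -
  define I where "I = (\<lambda>b. \<lfloor>x \<bullet> b\<rfloor>) ` Basis"
  have "finite I" "\<And>b. b \<in> Basis \<Longrightarrow> \<lfloor>x \<bullet> b\<rfloor> \<in> I" by (auto simp: I_def)
  then have "Min I \<le> \<lfloor>x \<bullet> b\<rfloor>" "\<lfloor>x \<bullet> b\<rfloor> < Max I + 1" if "b \<in> Basis" for b
    using that Max_ge[of I "\<lfloor>x \<bullet> b\<rfloor>"] by auto
  then have "floor_vec x \<in> lattice_box (Min I) (Max I + 1)"
    by (fastforce simp: lattice_box_def floor_vec_inner)
  then show ?thesis by blast
qed

text \<open>From every point \<open>x\<close> a ball of displacements of fixed measure
  \<open>m\<close> leads into the hole at \<open>floor_vec x\<close>, where \<phi> vanishes. For
  these \<open>h\<close> the increment is \<phi> x up to sign, and the averaged translation estimate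
  applies with \<open>c = m / (V * R powr p)\<close>.\<close>

lemma perforated_poincare:
  fixes \<rho> :: real
  assumes "\<rho> > 0" "p \<ge> 1"
  shows "\<exists>c>0. \<forall>\<phi> \<in> test_functions {x::'a::euclidean_space. lat_dist x > \<rho>}.
     c * (LINT x|lborel. \<bar>\<phi> x\<bar> powr p) \<le> (LINT x|lborel. norm (grad \<phi> x) powr p)"
proof -
  have "isCont lat_dist (0::'a)" using continuous_lat_dist[where 'a='a] by (simp add: continuous_on_eq_continuous_at)
  from this[unfolded continuous_at_eps_delta, rule_format, OF assms(1)]
  obtain \<delta> where \<delta>: "\<delta> > 0" "\<And>z::'a. dist z 0 < \<delta> \<Longrightarrow> dist (lat_dist z) (lat_dist 0) < \<rho>"
    by auto
  \<comment> \<open>The centre of the hole is within \<open>DIM('a)\<close> of \<open>x\<close> and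
    the ball has radius \<delta>, so \<open>R\<close> bounds all displacements used.\<close>
  define R where "R = DIM('a) + \<delta>"
  define H where "H = (cball 0 R :: 'a set)"
  define m where "m = measure lborel (ball (0::'a) \<delta>)"
  define V where "V = measure lborel H"
  have pos: "m > 0" "V > 0" "R > 0" proof -
    show "R > 0" using \<delta>(1) unfolding R_def by (simp add: add_nonneg_pos)
    then show "V > 0" "m > 0" using \<delta>(1) by (simp_all add: m_def V_def H_def)
  qed
  have em: "emeasure lborel (ball x \<delta> :: 'a set) = ennreal m" for x
    using \<delta>(1) by (simp add: m_def emeasure_ball content_ball)
  have eV: "emeasure lborel H = ennreal V"
    using pos(3) by (simp add: V_def H_def emeasure_cball content_cball)
  define c where "c = m / (V * R powr p)"
  have "c * (LINT x|lborel. \<bar>\<phi> x\<bar> powr p) \<le> (LINT x|lborel. norm (grad \<phi> x) powr p)"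
    if \<phi>: "\<phi> \<in> test_functions {x::'a. lat_dist x > \<rho>}" for \<phi>
  proof -
    define A where "A = (LINT x|lborel. \<bar>\<phi> x\<bar> powr p)"
    define E where "E = (LINT x|lborel. norm (grad \<phi> x) powr p)"
    have E: "E \<ge> 0" unfolding E_def by (rule Bochner_Integration.integral_nonneg) auto
    have A: "A \<ge> 0" unfolding A_def by (rule Bochner_Integration.integral_nonneg) auto
    have [measurable]: "\<phi> \<in> borel_measurable borel"
      using test_functionsD(4)[OF \<phi>] by (rule borel_measurable_continuous_onI)
    have "ennreal (m * A) = ennreal m * (\<integral>\<^sup>+ x. ennreal (\<bar>\<phi> x\<bar> powr p) \<partial>lborel)"
      using integrable_test_function(2)[OF \<phi>, of p] assms pos A
      by (simp add: nn_integral_eq_integral A_def ennreal_mult)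
    also have "\<dots> = (\<integral>\<^sup>+ x. ennreal m * ennreal (\<bar>\<phi> x\<bar> powr p) \<partial>lborel)"
      by (subst nn_integral_cmult) auto
    also have "\<dots> \<le> (\<integral>\<^sup>+ x. (\<integral>\<^sup>+ h. indicator H h * ennreal (\<bar>\<phi> (x + h) - \<phi> x\<bar> powr p) \<partial>lborel) \<partial>lborel)"
    proof (rule nn_integral_mono)
      fix x :: 'a
      let ?B = "ball (floor_vec x - x) \<delta>"
      have "ennreal m * ennreal (\<bar>\<phi> x\<bar> powr p) = (\<integral>\<^sup>+ h. indicator ?B h * ennreal (\<bar>\<phi> x\<bar> powr p) \<partial>lborel)"
        unfolding em[of "floor_vec x - x", symmetric]
        by (subst nn_integral_multc) (auto intro: borel_measurable_indicator)
      also have "\<dots> \<le> (\<integral>\<^sup>+ h. indicator H h * ennreal (\<bar>\<phi> (x + h) - \<phi> x\<bar> powr p) \<partial>lborel)"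
      proof (rule nn_integral_mono)
        fix h
        have "h \<in> H \<and> \<phi> (x + h) = 0" if h: "h \<in> ?B"
        proof
          have "norm h \<le> norm (floor_vec x - x) + norm (h - (floor_vec x - x))"
            using norm_triangle_sub by blast
          then show "h \<in> H" using h floor_vec_near[of x]
            by (simp add: H_def R_def dist_norm norm_minus_commute[of h])
          obtain lo hi where k: "floor_vec x \<in> lattice_box lo hi" using floor_vec_lattice by blast
          have "dist (x + h - floor_vec x) 0 < \<delta>"
            using h by (simp add: dist_norm norm_minus_commute algebra_simps)
          from \<delta>(2)[OF this] have "lat_dist (x + h - floor_vec x) < \<rho>"
            by (simp add: dist_real_def)
          then have "lat_dist (x + h) < \<rho>"
            using lat_dist_periodic[OF k, of "x + h - floor_vec x"] by simp
          then have "x + h \<notin> closure {x. \<phi> x \<noteq> 0}" using test_functionsD(3)[OF \<phi>] by auto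
          then show "\<phi> (x + h) = 0" by (rule test_function_outside)
        qed
        then show "indicator ?B h * ennreal (\<bar>\<phi> x\<bar> powr p)
            \<le> indicator H h * ennreal (\<bar>\<phi> (x + h) - \<phi> x\<bar> powr p)"
          by (auto split: split_indicator)
      qed
      finally show "ennreal m * ennreal (\<bar>\<phi> x\<bar> powr p)
          \<le> (\<integral>\<^sup>+ h. indicator H h * ennreal (\<bar>\<phi> (x + h) - \<phi> x\<bar> powr p) \<partial>lborel)" .
    qed
    also have "\<dots> \<le> emeasure lborel H * ennreal (R powr p * E)"
      unfolding E_def using assms
      by (intro test_function_averaged_translation_le[OF \<phi>]) (auto simp: H_def)
    also have "\<dots> = ennreal (V * R powr p * E)"
      using eV pos E by (simp add: ennreal_mult[symmetric] mult.assoc)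
    finally have "m * A \<le> V * R powr p * E" using pos E by simp
    then show ?thesis using pos by (simp add: c_def A_def E_def field_simps)
  qed
  moreover have "c > 0" using pos by (simp add: c_def)
  ultimately show ?thesis by blast
qed

section \<open>The volume of neighbourhoods of the lattice\<close>

lemma sin_ge_two_div_pi:
  assumes "0 \<le> y" "y \<le> pi / 2"
  shows "2 / pi * y \<le> sin y"
proof -
  \<comment> \<open>Jordan's inequality: the concave sine lies above its chord from 0 to pi /
    2.\<close>
  have "convex_on {0..pi} (\<lambda>x. - sin x)"
    by (rule f''_ge0_imp_convex[where f'="\<lambda>x. - cos x" and f''=sin])
       (auto intro!: derivative_eq_intros simp: sin_ge_zero)
  from convex_onD[OF this, of "2 / pi * y" 0 "pi / 2"] assms
  show ?thesis by (simp add: field_simps)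
qed

lemma abs_sin_pi_ge: "2 * \<bar>x - of_int (round x)\<bar> \<le> \<bar>sin (pi * x)\<bar>"
proof -
  define y where "y = x - of_int (round x)"
  have y: "\<bar>y\<bar> \<le> 1 / 2" using of_int_round_abs_le[of x] by (simp add: y_def abs_minus_commute)
  have "sin (pi * x) = sin (pi * y + pi * of_int (round x))" by (simp add: y_def algebra_simps)
  then have "\<bar>sin (pi * x)\<bar> = \<bar>sin (pi * y)\<bar>"
    by (simp add: sin_add sin_integer_2pi abs_mult abs_square_eq_1[symmetric] cos_int_times_real cos_npi_int)
  also have "\<dots> = \<bar>sin (pi * \<bar>y\<bar>)\<bar>" by (simp add: abs_if)
  also have "\<dots> \<ge> 2 / pi * (pi * \<bar>y\<bar>)"
    using y by (intro order_trans[OF sin_ge_two_div_pi]) (auto simp: field_simps)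
  finally show ?thesis by (simp add: y_def)
qed

text \<open>If \<open>lat_dist x\<close> is at most t^2, every coordinate is within t / 2 of the
  nearest integer, so x lies in a cube of side t around the rounded point. Points of the ball round
  to coordinates between -M and M, which makes (2M+1)^d cubes.\<close>

lemma emeasure_lat_sublevel:
  fixes M :: nat
  assumes "t \<ge> 0"
  shows "emeasure lborel {x \<in> ball (0::'a::euclidean_space) (real M). lat_dist x \<le> t\<^sup>2}
    \<le> ennreal (real (2 * M + 1) ^ DIM('a) * t ^ DIM('a))"
proof -
  let ?K = "lattice_box (- int M) (int M + 1) :: 'a set"
  let ?C = "\<lambda>k::'a. cbox (k - (t / 2) *\<^sub>R One) (k + (t / 2) *\<^sub>R One)"
  have sub: "{x \<in> ball (0::'a) (real M). lat_dist x \<le> t\<^sup>2} \<subseteq> (\<Union>k\<in>?K. ?C k)"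
  proof clarify
    fix x :: 'a assume x: "x \<in> ball 0 (real M)" "lat_dist x \<le> t\<^sup>2"
    define k :: 'a where "k = (\<Sum>b\<in>Basis. of_int (round (x \<bullet> b)) *\<^sub>R b)"
    have k: "k \<bullet> b = of_int (round (x \<bullet> b))" if "b \<in> Basis" for b
      unfolding k_def using that by (rule inner_sum_left_Basis)
    have "\<bar>x \<bullet> b - k \<bullet> b\<bar> \<le> t / 2 \<and> k \<bullet> b \<in> \<int> \<and> - real M \<le> k \<bullet> b \<and> k \<bullet> b < real M + 1"
      if b: "b \<in> Basis" for b
    proof -
      have le: "(sin (pi * (x \<bullet> b)))\<^sup>2 \<le> lat_dist x"
        unfolding lat_dist_def
        by (rule member_le_sum[OF b, of "\<lambda>b. (sin (pi * (x \<bullet> b)))\<^sup>2"]) simp_all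
      have "\<bar>sin (pi * (x \<bullet> b))\<bar> \<le> t"
        using order_trans[OF le x(2)] assms by (simp add: abs_le_square_iff[symmetric])
      then have 1: "\<bar>x \<bullet> b - k \<bullet> b\<bar> \<le> t / 2"
        using abs_sin_pi_ge[of "x \<bullet> b"] k[OF b] by simp
      have "\<bar>x \<bullet> b\<bar> < real M"
        using x(1) Basis_le_norm[OF b, of x] by simp
      then have "of_int (- int M - 1) < (of_int (round (x \<bullet> b)) :: real)"
        and hi: "of_int (round (x \<bullet> b)) < real M + 1"
        using of_int_round_abs_le[of "x \<bullet> b"] by (simp_all; linarith)+
      then have "- int M \<le> round (x \<bullet> b)" unfolding of_int_less_iff by linarith
      then have "of_int (- int M) \<le> (of_int (round (x \<bullet> b)) :: real)" unfolding of_int_le_iff .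
      then have "- real M \<le> of_int (round (x \<bullet> b))" by simp
      with 1 hi show ?thesis by (simp add: k[OF b])
    qed
    note * = this
    have "k \<in> ?K" using * by (simp add: lattice_box_def)
    moreover have "x \<in> ?C k" unfolding mem_box
    proof
      fix b :: 'a assume b: "b \<in> Basis"
      then show "(k - (t / 2) *\<^sub>R One) \<bullet> b \<le> x \<bullet> b \<and> x \<bullet> b \<le> (k + (t / 2) *\<^sub>R One) \<bullet> b"
        using *[OF b] by (simp add: inner_diff_left inner_add_left abs_le_iff; linarith)
    qed
    ultimately    show "x \<in> (\<Union>k\<in>?K. ?C k)" by blast
  qed
  have "emeasure lborel {x \<in> ball (0::'a) (real M). lat_dist x \<le> t\<^sup>2} \<le> emeasure lborel (\<Union>k\<in>?K. ?C k)"
    using sub finite_lattice_box by (intro emeasure_mono) (auto intro!: sets.finite_UN)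
  also have "\<dots> \<le> (\<Sum>k\<in>?K. emeasure lborel (?C k))"
    using finite_lattice_box by (intro emeasure_subadditive_finite) auto
  also have "\<dots> = (\<Sum>k\<in>?K. ennreal (t ^ DIM('a)))"
  proof (intro sum.cong refl)
    fix k :: 'a
    have "emeasure lborel (?C k) = ennreal (\<Prod>b\<in>(Basis::'a set). ((k + (t / 2) *\<^sub>R One) - (k - (t / 2) *\<^sub>R One)) \<bullet> b)"
      using assms by (intro emeasure_lborel_cbox) (auto simp: inner_add_left inner_diff_left)
    also have "(\<Prod>b\<in>(Basis::'a set). ((k + (t / 2) *\<^sub>R One) - (k - (t / 2) *\<^sub>R One)) \<bullet> b) = t ^ DIM('a)"
      by (simp add: inner_add_left inner_diff_left)
    finally show "emeasure lborel (?C k) = ennreal (t ^ DIM('a))" .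
  qed
  also have "\<dots> = ennreal (real (2 * M + 1) ^ DIM('a) * t ^ DIM('a))"
  proof -
    have "card ?K = (2 * M + 1) ^ DIM('a)"
      by (simp add: card_lattice_box nat_add_distrib nat_mult_distrib)
    then show ?thesis using assms
      by (simp add: ennreal_mult ennreal_power ennreal_of_nat_eq_real_of_nat del: ennreal_plus)
  qed
  finally show ?thesis .
qed

section \<open>A logarithmic cutoff around the lattice\<close>

lemma flat_bounds: "0 \<le> flat t" "flat t \<le> 1" "0 \<le> flat' t" "flat' t \<le> 2"
proof -
  show "0 \<le> flat t" "flat t \<le> 1" "0 \<le> flat' t" by (auto simp: flat_def flat'_def)
  show "flat' t \<le> 2"
  proof (cases "t > 0")
    case True
    \<comment> \<open>With s = 1 / t the bound 2 is the inequality s^2 \<le> 2 exp(s).\<close>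
    have "1 + 1 / t + (1 / t)\<^sup>2 / 2 \<le> exp (1 / t)"
      using True by (intro exp_lower_Taylor_quadratic) auto
    moreover have "0 \<le> 1 / t" using True by simp
    ultimately have "(1 / t)\<^sup>2 \<le> 2 * exp (1 / t)" by linarith
    then have "(1 / t)\<^sup>2 * exp (- (1 / t)) \<le> 2 * exp (1 / t) * exp (- (1 / t))"
      by (intro mult_right_mono) auto
    also have "\<dots> = 2" by (simp add: exp_minus)
    finally show ?thesis using True by (simp add: flat'_def power_divide field_simps)
  qed (simp add: flat'_def)
qed

lemma flat_mono: "s \<le> t \<Longrightarrow> flat s \<le> flat t"
  by (auto simp: flat_def field_simps)

lemma flat_pos: "flat t > 0 \<longleftrightarrow> t > 0"
  by (simp add: flat_def)

lemma GDERIV_inner: "GDERIV (\<lambda>x. x \<bullet> b) x :> b"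
  by (auto simp: gderiv_def intro!: derivative_eq_intros)

text \<open>The analogue of |grad r^2| = 2 r. Hence the logarithm of \<open>lat_dist\<close> has a
  gradient of order 1 / r, the borderline singularity for p = d.\<close>

lemma lat_dist_grad: "\<exists>d. GDERIV lat_dist x :> d \<and> norm d \<le> 2 * pi * sqrt (lat_dist x)"
proof -
  define f where "f b = 2 * pi * sin (pi * (x \<bullet> b)) * cos (pi * (x \<bullet> b))" for b
  define d where "d = (\<Sum>b\<in>Basis. f b *\<^sub>R b)"
  have "GDERIV lat_dist x :> d"
    unfolding lat_dist_def[abs_def] d_def
  proof (rule GDERIV_sum)
    fix b :: 'a
    have "((\<lambda>t. (sin (pi * t))\<^sup>2) has_real_derivative f b) (at (x \<bullet> b))"
      by (auto intro!: derivative_eq_intros simp: f_def)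
    from GDERIV_DERIV_compose[OF GDERIV_inner this]
    show "GDERIV (\<lambda>x. (sin (pi * (x \<bullet> b)))\<^sup>2) x :> f b *\<^sub>R b" .
  qed simp
  moreover have "norm d \<le> 2 * pi * sqrt (lat_dist x)"
  proof -
    have d: "d \<bullet> b = f b" if "b \<in> Basis" for b
      unfolding d_def using that by (rule inner_sum_left_Basis)
    have "(norm d)\<^sup>2 = (\<Sum>b\<in>Basis. (f b)\<^sup>2)"
      by (simp add: norm_eq_sqrt_inner euclidean_inner[of d d] d power2_eq_square sum_nonneg)
    also have "\<dots> \<le> (\<Sum>b\<in>(Basis::'a set). (2 * pi)\<^sup>2 * (sin (pi * (x \<bullet> b)))\<^sup>2)"
    proof (intro sum_mono)
      fix b :: 'a
      have "(f b)\<^sup>2 = (2 * pi)\<^sup>2 * (sin (pi * (x \<bullet> b)))\<^sup>2 * (cos (pi * (x \<bullet> b)))\<^sup>2"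
        by (simp add: f_def power_mult_distrib)
      also have "\<dots> \<le> (2 * pi)\<^sup>2 * (sin (pi * (x \<bullet> b)))\<^sup>2 * 1"
        by (intro mult_left_mono) (auto simp: cos_squared_eq)
      finally show "(f b)\<^sup>2 \<le> (2 * pi)\<^sup>2 * (sin (pi * (x \<bullet> b)))\<^sup>2" by simp
    qed
    also have "\<dots> = (2 * pi * sqrt (lat_dist x))\<^sup>2"
      using lat_dist_nonneg[of x] by (simp add: power_mult_distrib sum_distrib_left[symmetric] lat_dist_def)
    finally show ?thesis by (rule power2_le_imp_le) (simp add: lat_dist_nonneg)
  qed
  ultimately show ?thesis by blast
qed

text \<open>Dyadic decomposition of the singularity at the lattice; this is where \<open>p \<le> d\<close> enters.\<close>

lemma lat_dist_powr_le:
  fixes x :: "'a::euclidean_space" and p :: real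
  assumes p: "0 < p" "p \<le> DIM('a)"
  shows "(lat_dist x + (1 / 4) ^ n) powr (- p / 2)
    \<le> 1 + (\<Sum>j\<le>n. 2 ^ DIM('a) * 2 ^ (DIM('a) * j) * of_bool (lat_dist x \<le> ((1 / 2) ^ j)\<^sup>2))"
proof -
  let ?D = "DIM('a)"
  define s where "s = lat_dist x"
  have s: "s \<ge> 0" by (simp add: s_def lat_dist_nonneg)
  let ?T = "\<lambda>j. 2 ^ ?D * 2 ^ (?D * j) * of_bool (s \<le> ((1 / 2) ^ j)\<^sup>2) :: real"
  have sum0: "(\<Sum>j\<le>n. ?T j) \<ge> 0" by (intro sum_nonneg) auto
  have q: "((1 / 4) ^ i) powr (- p / 2) \<le> 2 ^ (?D * i)" for i
  proof -
    have "((1 / 4) ^ i) powr (- p / 2) = ((1 / 4::real) powr (- p / 2)) ^ i"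
      by (simp add: powr_realpow[symmetric] powr_powr mult.commute)
    also have "(1 / 4::real) powr (- p / 2) = 2 powr p"
    proof -
      have "(1 / 4::real) = 2 powr (- 2)" by (simp add: powr_minus)
      then show ?thesis by (simp only: powr_powr) simp
    qed
    also have "(2 powr p) ^ i \<le> (2 powr ?D) ^ i"
      using p by (intro power_mono powr_mono) auto
    finally show ?thesis by (simp add: powr_realpow power_mult)
  qed
  have "(s + (1 / 4) ^ n) powr (- p / 2) \<le> 1 + (\<Sum>j\<le>n. ?T j)"
  proof (cases "s > 1")
    case True
    have "(1 / 4 :: real) ^ n > 0" by simp
    with True have "1 \<le> s + (1 / 4) ^ n" by linarith
    then have "(s + (1 / 4) ^ n) powr (- p / 2) \<le> 1 powr (- p / 2)"
      using p by (intro powr_mono2') auto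
    then show ?thesis using sum0 by simp
  next
    case False
    define P where "P j \<longleftrightarrow> s \<le> (1 / 4) ^ j" for j :: nat
    \<comment> \<open>The largest dyadic index whose sublevel set still contains x. Failure at
      \<open>Suc j\<close>, or \<open>j = n\<close>, bounds the left side by the scale
      \<open>Suc j\<close>; the extra factor 2^d in the sum pays for this shift by one.\<close>
    define j where "j = Greatest (\<lambda>j. P j \<and> j \<le> n)"
    have ex: "P 0 \<and> 0 \<le> n" using False by (simp add: P_def)
    have j: "P j" "j \<le> n"
      using GreatestI_nat[of "\<lambda>j. P j \<and> j \<le> n" 0 n] ex unfolding j_def by auto
    have "(1 / 4) ^ Suc j \<le> s + (1 / 4) ^ n"
    proof (cases "j = n")
      case True
      have "(1 / 4) ^ Suc n \<le> (1 / 4 :: real) ^ n" by (rule power_decreasing) auto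
      then show ?thesis using True s by simp
    next
      case False
      have "\<not> P (Suc j)"
      proof
        assume "P (Suc j)"
        then have "Suc j \<le> j"
          using Greatest_le_nat[of "\<lambda>j. P j \<and> j \<le> n" "Suc j" n] False j(2) unfolding j_def by auto
        then show False by simp
      qed
      moreover have "(1 / 4 :: real) ^ n > 0" by simp
      ultimately show ?thesis unfolding P_def by linarith
    qed
    then have "(s + (1 / 4) ^ n) powr (- p / 2) \<le> ((1 / 4) ^ Suc j) powr (- p / 2)"
      using p by (intro powr_mono2') auto
    also have "\<dots> \<le> 2 ^ (?D * Suc j)" by (rule q)
    also have "\<dots> = ?T j"
    proof -
      have "((1 / 2) ^ j)\<^sup>2 = (1 / 4 :: real) ^ j"
        by (simp add: power2_eq_square power_mult_distrib[symmetric])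
      then show ?thesis using j(1) by (simp add: P_def power_add mult.commute)
    qed
    also have "\<dots> \<le> (\<Sum>j\<le>n. ?T j)"
      using j(2) by (intro member_le_sum) auto
    finally show ?thesis by simp
  qed
  then show ?thesis by (simp add: s_def)
qed

text \<open>\<open>u\<close> is a bump of radius M times a logarithmic cutoff, which rises over n
  doublings of lat_dist + \<rho>, where \<rho> = 4^(-n). The bump has gradient at most 4 / M, the
  cutoff at most (c / n) (lat_dist + \<rho>)^(-1/2); here \<open>c\<close> collects the bound 2 of
  \<open>flat'\<close>, the 2 pi from the gradient of \<open>lat_dist\<close> and the 1 / ln 2 of
  the normalisation. The holes are given the level \<rho> / 2, so that the closed set lat_dist \<ge>
  \<rho> carrying the support fits into the open domain.\<close>

lemma perforated_test_function_estimate: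
  fixes M n :: nat and p :: real
  assumes M: "1 \<le> M" and n: "1 \<le> n" and p: "1 < p" "p \<le> DIM('a::euclidean_space)"
  defines "B \<equiv> measure lborel (ball (0::'a) (real M))"
    and "L \<equiv> real (2 * M + 1) ^ DIM('a)" and "c \<equiv> 4 * pi / ln 2"
  shows "\<exists>u\<in>test_functions {x::'a. lat_dist x > (1 / 4) ^ n / 2}.
     (LINT x|lborel. norm (grad u x) powr p)
       \<le> 2 powr (p - 1) * ((4 / M) powr p * B + (c / n) powr p * (B + 2 ^ DIM('a) * L * (real n + 1)))
     \<and> (flat (3 / 4) * flat 1) powr p * (B / 2 ^ DIM('a) - L * sqrt (2 * (1 / 2) ^ n) ^ DIM('a))
       \<le> (LINT x|lborel. \<bar>u x\<bar> powr p)"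
proof -
  let ?D = "DIM('a)"
  define \<rho> :: real where "\<rho> = (1 / 4) ^ n"
  \<comment> \<open>Normalised so that \<open>l\<close> climbs from 0 to 1 while lat_dist + \<rho>
    grows from 2 \<rho> by the factor 2^n.\<close>
  define K where "K = 1 / (n * ln 2 :: real)"
  have \<rho>: "\<rho> > 0" by (simp add: \<rho>_def)
  have K: "K > 0" using n by (simp add: K_def)
  have s\<rho>: "lat_dist x + \<rho> > 0" for x :: 'a
    using lat_dist_nonneg[of x] \<rho> by linarith
  define \<eta> where "\<eta> x = flat (1 + (- 1 / (real M)\<^sup>2) * (x \<bullet> x))" for x :: 'a
  define l where "l x = K * ln (lat_dist x + \<rho>) + (- K * ln (2 * \<rho>))" for x :: 'a
  define \<psi> where "\<psi> x = flat (l x)" for x :: 'a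
  define u where "u x = \<eta> x * \<psi> x" for x :: 'a
  have Cxx: "C_k k (\<lambda>x::'a. x \<bullet> x)" for k
    unfolding euclidean_inner[of x x for x]
    by (intro C_k_sum C_k_mult C_k_inner) auto
  have smooth: "C_k k u" for k
    unfolding u_def[abs_def] \<eta>_def \<psi>_def l_def
    by (intro C_k_mult C_k_flat C_k_add C_k_const Cxx C_k_ln C_k_lat_dist s\<rho>)
  have \<eta>0: "x \<in> ball 0 (real M)" if "\<eta> x \<noteq> 0" for x
  proof -
    have "\<eta> x > 0" using that flat_bounds(1) by (simp add: \<eta>_def less_le)
    then have "(x \<bullet> x) / (real M)\<^sup>2 < 1" by (simp add: \<eta>_def flat_pos)
    then have "(norm x)\<^sup>2 < (real M)\<^sup>2" using M by (simp add: power2_norm_eq_inner)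
    then show ?thesis by (simp add: power2_less_imp_less)
  qed
  have \<psi>0: "lat_dist x \<ge> \<rho>" if "\<psi> x \<noteq> 0" for x
  proof -
    have "\<psi> x > 0" using that flat_bounds(1) by (simp add: \<psi>_def less_le)
    then have "K * ln (2 * \<rho>) < K * ln (lat_dist x + \<rho>)" by (simp add: \<psi>_def flat_pos l_def)
    then have "ln (2 * \<rho>) < ln (lat_dist x + \<rho>)" using K by simp
    then show ?thesis using s\<rho>[of x] \<rho> by simp
  qed
  have u: "u \<in> test_functions {x. lat_dist x > (1 / 4) ^ n / 2}"
  proof (rule test_functionsI[where S="cball 0 (real M) \<inter> {x. lat_dist x \<ge> \<rho>}", OF smooth])
    have "closed {x::'a. lat_dist x \<ge> \<rho>}"
      using continuous_lat_dist by (intro closed_Collect_le continuous_on_const) auto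
    then show "compact (cball 0 (real M) \<inter> {x::'a. lat_dist x \<ge> \<rho>})" by (intro compact_Int_closed) auto
    show "cball 0 (real M) \<inter> {x::'a. lat_dist x \<ge> \<rho>} \<subseteq> {x. lat_dist x > (1 / 4) ^ n / 2}"
      unfolding \<rho>_def[symmetric] using \<rho> by auto
    show "x \<in> cball 0 (real M) \<inter> {x. lat_dist x \<ge> \<rho>}" if "u x \<noteq> 0" for x
      using \<eta>0[of x] \<psi>0[of x] that by (auto simp: u_def)
  qed
  have grad_le: "norm (grad u x) \<le> of_bool (x \<in> ball 0 (real M)) *
      (4 / M + c / n * (lat_dist x + \<rho>) powr (- 1 / 2))" for x
  proof -
    define t where "t = 1 + (- 1 / (real M)\<^sup>2) * (x \<bullet> x)"
    obtain d where d: "GDERIV lat_dist x :> d" "norm d \<le> 2 * pi * sqrt (lat_dist x)"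
      using lat_dist_grad by blast
    have "GDERIV (\<lambda>x. x \<bullet> x) x :> 2 *\<^sub>R x"
      by (auto simp: gderiv_def inner_commute intro!: derivative_eq_intros)
    moreover have "((\<lambda>r. flat (1 + (- 1 / (real M)\<^sup>2) * r)) has_real_derivative flat' t * (- 1 / (real M)\<^sup>2)) (at (x \<bullet> x))"
    proof -
      have "((\<lambda>r. 1 + a * r) has_real_derivative a) (at y)" for a y :: real
        by (auto intro!: derivative_eq_intros)
      from DERIV_chain2[OF flat_deriv this] show ?thesis unfolding t_def .
    qed
    ultimately have g\<eta>: "GDERIV \<eta> x :> (flat' t * (- 1 / (real M)\<^sup>2)) *\<^sub>R (2 *\<^sub>R x)"
      unfolding \<eta>_def[abs_def] by (rule GDERIV_DERIV_compose)
    have "((\<lambda>r. flat (K * ln (r + \<rho>) + (- K * ln (2 * \<rho>)))) has_real_derivative flat' (l x) * (K / (lat_dist x + \<rho>))) (at (lat_dist x))"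
      unfolding l_def using s\<rho>[of x]
      by (intro DERIV_chain2[OF flat_deriv]) (auto intro!: derivative_eq_intros)
    from GDERIV_DERIV_compose[OF d(1) this]
    have g\<psi>: "GDERIV \<psi> x :> (flat' (l x) * (K / (lat_dist x + \<rho>))) *\<^sub>R d"
      by (simp add: \<psi>_def[abs_def] l_def)
    from GDERIV_mult[OF g\<eta> g\<psi>]
    have gu: "grad u x = \<eta> x *\<^sub>R ((flat' (l x) * (K / (lat_dist x + \<rho>))) *\<^sub>R d) +
        \<psi> x *\<^sub>R ((flat' t * (- 1 / (real M)\<^sup>2)) *\<^sub>R (2 *\<^sub>R x))"
      unfolding u_def[abs_def] by (rule grad_eqI)
    show ?thesis
    proof (cases "x \<in> ball 0 (real M)")
      case True
      have "norm ((flat' t * (- 1 / (real M)\<^sup>2)) *\<^sub>R (2 *\<^sub>R x)) = flat' t * (2 * norm x / (real M)\<^sup>2)"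
        using flat_bounds(3)[of t] by (simp add: abs_mult)
      also have "\<dots> \<le> 2 * (2 * real M / (real M)\<^sup>2)"
        using True flat_bounds(3,4)[of t] by (intro mult_mono divide_right_mono) auto
      also have "\<dots> = 4 / M" using M by (simp add: power2_eq_square)
      finally have 1: "norm ((flat' t * (- 1 / (real M)\<^sup>2)) *\<^sub>R (2 *\<^sub>R x)) \<le> 4 / M" .
      have "norm ((flat' (l x) * (K / (lat_dist x + \<rho>))) *\<^sub>R d) = flat' (l x) * (K / (lat_dist x + \<rho>)) * norm d"
        using flat_bounds(3)[of "l x"] K s\<rho>[of x] by (simp add: abs_mult)
      also have "\<dots> \<le> 2 * (K / (lat_dist x + \<rho>)) * (2 * pi * sqrt (lat_dist x + \<rho>))"
      proof (intro mult_mono)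
        have "2 * pi * sqrt (lat_dist x) \<le> 2 * pi * sqrt (lat_dist x + \<rho>)"
          using \<rho> by (intro mult_left_mono) auto
        with d(2) show "norm d \<le> 2 * pi * sqrt (lat_dist x + \<rho>)" by linarith
      qed (use flat_bounds(3,4)[of "l x"] K s\<rho>[of x] in auto)
      also have "\<dots> = c / n * (sqrt (lat_dist x + \<rho>) / (lat_dist x + \<rho>))"
        by (simp add: c_def K_def mult_ac)
      also have "sqrt (lat_dist x + \<rho>) / (lat_dist x + \<rho>) = (lat_dist x + \<rho>) powr (1 / 2 - 1)"
        using s\<rho>[of x] by (simp only: powr_diff powr_half_sqrt[symmetric] less_imp_le powr_one)
      finally have 2: "norm ((flat' (l x) * (K / (lat_dist x + \<rho>))) *\<^sub>R d) \<le> c / n * (lat_dist x + \<rho>) powr (- 1 / 2)"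
        by simp
      have tri: "norm (a *\<^sub>R v + b *\<^sub>R w) \<le> a * norm v + b * norm w" if "a \<ge> 0" "b \<ge> 0" for a b and v w :: 'a
        using norm_triangle_ineq[of "a *\<^sub>R v" "b *\<^sub>R w"] that by simp
      have "norm (grad u x) \<le> \<eta> x * norm ((flat' (l x) * (K / (lat_dist x + \<rho>))) *\<^sub>R d) +
        \<psi> x * norm ((flat' t * (- 1 / (real M)\<^sup>2)) *\<^sub>R (2 *\<^sub>R x))"
        unfolding gu by (rule tri) (simp_all add: \<eta>_def \<psi>_def flat_bounds(1))
      also have "\<dots> \<le> 1 * (c / n * (lat_dist x + \<rho>) powr (- 1 / 2)) + 1 * (4 / M)"
        using 1 2 flat_bounds(1,2) by (intro add_mono mult_mono) (auto simp: \<eta>_def \<psi>_def)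
      finally show ?thesis using True by simp
    next
      case False
      then have "\<eta> x = 0" "t \<le> 0"
        using \<eta>0[of x] flat_pos[of t] flat_bounds(1)[of t] by (auto simp: \<eta>_def t_def)
      then show ?thesis using False by (simp add: gu flat'_def)
    qed
  qed
  define C where "C = 2 powr (p - 1) * ((4 / M) powr p * B + (c / n) powr p * (B + 2 ^ ?D * L * (real n + 1)))"
  have c0: "c > 0" by (simp add: c_def)
  have B0: "B \<ge> 0" "L \<ge> 0" by (simp_all add: B_def L_def)
  have eB: "emeasure lborel (ball (0::'a) (real M)) = ennreal B"
    by (simp add: B_def emeasure_ball content_ball)
  have [measurable]: "(lat_dist :: 'a \<Rightarrow> real) \<in> borel_measurable borel"
    using continuous_lat_dist by (rule borel_measurable_continuous_onI)
  let ?b = "indicator (ball (0::'a) (real M)) :: 'a \<Rightarrow> ennreal"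
  \<comment> \<open>The majorant is a combination of indicators, so that its integral is expressed
    through the volumes of sublevel sets.\<close>
  have "ennreal (LINT x|lborel. norm (grad u x) powr p) = (\<integral>\<^sup>+ x. ennreal (norm (grad u x) powr p) \<partial>lborel)"
    using integrable_test_function(3)[OF u, of p] p by (simp add: nn_integral_eq_integral)
  also have "\<dots> \<le> (\<integral>\<^sup>+ x. ennreal (2 powr (p - 1) * (4 / M) powr p) * ?b x + ennreal (2 powr (p - 1) * (c / n) powr p) *
      (?b x + (\<Sum>j\<le>n. ennreal (2 ^ ?D * 2 ^ (?D * j)) *
        indicator {x \<in> ball (0::'a) (real M). lat_dist x \<le> ((1 / 2) ^ j)\<^sup>2} x)) \<partial>lborel)"
  proof (rule nn_integral_mono)
    fix x :: 'a
    show "ennreal (norm (grad u x) powr p) \<le> ennreal (2 powr (p - 1) * (4 / M) powr p) * ?b x + ennreal (2 powr (p - 1) * (c / n) powr p) *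
      (?b x + (\<Sum>j\<le>n. ennreal (2 ^ ?D * 2 ^ (?D * j)) *
        indicator {x \<in> ball (0::'a) (real M). lat_dist x \<le> ((1 / 2) ^ j)\<^sup>2} x))"
    proof (cases "x \<in> ball 0 (real M)")
      case False
      then have "grad u x = 0" using grad_le[of x] by simp
      then show ?thesis using p by simp
    next
      case True
      let ?T = "\<Sum>j\<le>n. 2 ^ ?D * 2 ^ (?D * j) * of_bool (lat_dist x \<le> ((1 / 2) ^ j)\<^sup>2) :: real"
      have T0: "?T \<ge> 0" by (intro sum_nonneg) auto
      have "norm (grad u x) powr p \<le> (4 / M + c / n * (lat_dist x + \<rho>) powr (- 1 / 2)) powr p"
        using grad_le[of x] True p by (intro powr_mono2) auto
      also have "\<dots> \<le> 2 powr (p - 1) * ((4 / M) powr p + (c / n * (lat_dist x + \<rho>) powr (- 1 / 2)) powr p)"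
        using p c0 by (intro powr_add_le) auto
      also have "(c / n * (lat_dist x + \<rho>) powr (- 1 / 2)) powr p = (c / n) powr p * (lat_dist x + \<rho>) powr (- p / 2)"
        using c0 by (subst powr_mult) (simp_all add: powr_powr)
      also have "2 powr (p - 1) * ((4 / M) powr p + (c / n) powr p * (lat_dist x + \<rho>) powr (- p / 2))
        \<le> 2 powr (p - 1) * ((4 / M) powr p + (c / n) powr p * (1 + ?T))"
      proof (intro mult_left_mono add_left_mono powr_ge_zero)
        show "(lat_dist x + \<rho>) powr (- p / 2) \<le> 1 + ?T"
          unfolding \<rho>_def by (rule lat_dist_powr_le) (use p in auto)
      qed
      finally have "ennreal (norm (grad u x) powr p)
        \<le> ennreal (2 powr (p - 1) * ((4 / M) powr p + (c / n) powr p * (1 + ?T)))"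
        by (rule ennreal_leI)
      also have "\<dots> = ennreal (2 powr (p - 1) * (4 / M) powr p) + ennreal (2 powr (p - 1) * (c / n) powr p) * (1 + ennreal ?T)"
        using T0 by (simp add: distrib_left ennreal_plus[symmetric] ennreal_mult[symmetric] mult.assoc
            ennreal_1[symmetric] del: ennreal_plus ennreal_1)
      also have "ennreal ?T = (\<Sum>j\<le>n. ennreal (2 ^ ?D * 2 ^ (?D * j) * of_bool (lat_dist x \<le> ((1 / 2) ^ j)\<^sup>2)))"
        by (rule sum_ennreal[symmetric]) simp
      also have "\<dots> = (\<Sum>j\<le>n. ennreal (2 ^ ?D * 2 ^ (?D * j)) *
        indicator {x \<in> ball (0::'a) (real M). lat_dist x \<le> ((1 / 2) ^ j)\<^sup>2} x)"
        using True by (intro sum.cong refl) (simp add: indicator_def)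
      finally show ?thesis using True by simp
    qed
  qed
  also have "\<dots> = ennreal (2 powr (p - 1) * (4 / M) powr p) * ennreal B + ennreal (2 powr (p - 1) * (c / n) powr p) *
      (ennreal B + (\<Sum>j\<le>n. ennreal (2 ^ ?D * 2 ^ (?D * j)) *
        emeasure lborel {x \<in> ball (0::'a) (real M). lat_dist x \<le> ((1 / 2) ^ j)\<^sup>2}))"
  proof -
    have *: "(\<integral>\<^sup>+ x. k1 * indicator A x + k2 * (indicator A x + (\<Sum>j\<le>n. a j * indicator (S j) x)) \<partial>lborel)
        = k1 * emeasure lborel A + k2 * (emeasure lborel A + (\<Sum>j\<le>n. a j * emeasure lborel (S j)))"
      if [measurable]: "A \<in> sets borel" "\<And>j. S j \<in> sets borel" for k1 k2 a and A :: "'a set" and S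
    proof -
      have "(\<integral>\<^sup>+ x. k1 * indicator A x + k2 * (indicator A x + (\<Sum>j\<le>n. a j * indicator (S j) x)) \<partial>lborel)
        = (\<integral>\<^sup>+ x. k1 * indicator A x \<partial>lborel)
          + (\<integral>\<^sup>+ x. k2 * (indicator A x + (\<Sum>j\<le>n. a j * indicator (S j) x)) \<partial>lborel)"
        by (rule nn_integral_add) measurable
      also have "(\<integral>\<^sup>+ x. k2 * (indicator A x + (\<Sum>j\<le>n. a j * indicator (S j) x)) \<partial>lborel)
        = k2 * (\<integral>\<^sup>+ x. indicator A x + (\<Sum>j\<le>n. a j * indicator (S j) x) \<partial>lborel)"
        by (rule nn_integral_cmult) measurable
      also have "(\<integral>\<^sup>+ x. indicator A x + (\<Sum>j\<le>n. a j * indicator (S j) x) \<partial>lborel)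
        = (\<integral>\<^sup>+ x. indicator A x \<partial>lborel) + (\<integral>\<^sup>+ x. (\<Sum>j\<le>n. a j * indicator (S j) x) \<partial>lborel)"
        by (rule nn_integral_add) measurable
      also have "(\<integral>\<^sup>+ x. (\<Sum>j\<le>n. a j * indicator (S j) x) \<partial>lborel)
        = (\<Sum>j\<le>n. \<integral>\<^sup>+ x. a j * indicator (S j) x \<partial>lborel)"
        by (rule nn_integral_sum) measurable
      finally show ?thesis by (simp add: nn_integral_cmult_indicator)
    qed
    show ?thesis
      unfolding eB[symmetric] by (rule *) measurable
  qed
  also have "\<dots> \<le> ennreal (2 powr (p - 1) * (4 / M) powr p) * ennreal B + ennreal (2 powr (p - 1) * (c / n) powr p) *
      (ennreal B + (\<Sum>j\<le>n. ennreal (2 ^ ?D * 2 ^ (?D * j)) * ennreal (L * ((1 / 2) ^ j) ^ ?D)))"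
    unfolding L_def by (intro add_mono mult_left_mono sum_mono emeasure_lat_sublevel order_refl) auto
  also have "\<dots> = ennreal C"
  proof -
    \<comment> \<open>The weight of scale \<open>j\<close> cancels the volume bound of its sublevel
      set, so each of the n + 1 scales contributes the same amount. The total grows like n, which
      the factor n^(-p) beats because p > 1.\<close>
    have "2 ^ ?D * 2 ^ (?D * j) * (L * ((1 / 2) ^ j) ^ ?D) = 2 ^ ?D * L" for j
      by (simp add: power_mult[symmetric] power_divide mult.commute[of j])
    then have "(\<Sum>j\<le>n. ennreal (2 ^ ?D * 2 ^ (?D * j)) * ennreal (L * ((1 / 2) ^ j) ^ ?D)) = (\<Sum>j\<le>n. ennreal (2 ^ ?D * L))"
      using B0 by (intro sum.cong refl) (subst ennreal_mult[symmetric]; simp)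
    also have "\<dots> = ennreal (\<Sum>j\<le>n. 2 ^ ?D * L)" using B0 by (intro sum_ennreal) simp
    also have "(\<Sum>j\<le>n. 2 ^ ?D * L) = 2 ^ ?D * L * (real n + 1)" by simp
    finally show ?thesis
      unfolding C_def using B0
      by (simp add: ennreal_plus[symmetric] ennreal_mult[symmetric] distrib_left mult.assoc del: ennreal_plus)
  qed
  finally have energy: "(LINT x|lborel. norm (grad u x) powr p) \<le> C"
    using B0 by (simp add: C_def)
  \<comment> \<open>Where lat_dist exceeds t^2 = 2 * 2^(-n), the logarithm has reached
    \<open>l x \<ge> 1\<close>; on the ball of half the radius the bump is at least
    \<open>flat (3 / 4)\<close>.\<close>
  define t where "t = sqrt (2 * (1 / 2) ^ n)"
  define S where "S = {x \<in> ball (0::'a) (real M / 2). t\<^sup>2 < lat_dist x}"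
  define T where "T = {x \<in> ball (0::'a) (real M). lat_dist x \<le> t\<^sup>2}"
  have fin: "S \<in> fmeasurable lborel" "T \<in> fmeasurable lborel" proof -
    have "ball (0::'a) (real M) \<in> fmeasurable lborel"
      by (rule fmeasurableI) (simp_all add: eB)
    moreover have "S \<subseteq> ball 0 (real M)" "T \<subseteq> ball 0 (real M)" "S \<in> sets lborel" "T \<in> sets lborel"
      by (auto simp: S_def T_def)
    ultimately show "S \<in> fmeasurable lborel" "T \<in> fmeasurable lborel"
      by (auto intro: fmeasurableI2)
  qed
  have "B / 2 ^ ?D = measure lborel (ball (0::'a) (real M / 2))"
    by (simp add: B_def content_ball power_divide)
  also have "\<dots> \<le> measure lborel (S \<union> T)"
    using fin by (intro measure_mono_fmeasurable) (auto simp: S_def T_def)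
  also have "\<dots> \<le> measure lborel S + measure lborel T"
    using fin by (intro measure_Un_le) auto
  also have "measure lborel T \<le> L * t ^ ?D"
    using emeasure_lat_sublevel[of t M, where 'a='a] B0
    by (auto simp: T_def L_def measure_def t_def intro!: enn2real_leI)
  finally have S: "B / 2 ^ ?D - L * t ^ ?D \<le> measure lborel S" by simp
  define \<kappa> where "\<kappa> = (flat (3 / 4) * flat 1) powr p"
  have "\<kappa> * (B / 2 ^ ?D - L * t ^ ?D) \<le> \<kappa> * measure lborel S"
    using S by (intro mult_left_mono) (auto simp: \<kappa>_def)
  also have "\<dots> = (LINT x|lborel. \<kappa> * indicator S x)"
    using fin by simp
  also have "\<dots> \<le> (LINT x|lborel. \<bar>u x\<bar> powr p)"
  proof (rule integral_mono)
    show "integrable lborel (\<lambda>x. \<kappa> * indicator S x)"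
      using fin by (intro integrable_mult_right) (auto simp: fmeasurable_def intro!: integrable_indicator)
    show "integrable lborel (\<lambda>x. \<bar>u x\<bar> powr p)" using integrable_test_function(2)[OF u] p by simp
    fix x :: 'a
    show "\<kappa> * indicator S x \<le> \<bar>u x\<bar> powr p"
    proof (cases "x \<in> S")
      case True
      have "norm x \<le> real M / 2" using True by (auto simp: S_def)
      then have "(norm x)\<^sup>2 \<le> (real M / 2)\<^sup>2" by (intro power_mono) auto
      then have "(x \<bullet> x) / (real M)\<^sup>2 \<le> 1 / 4" using M by (simp add: power2_norm_eq_inner power_divide field_simps)
      then have 1: "flat (3 / 4) \<le> \<eta> x" unfolding \<eta>_def by (intro flat_mono) simp
      have "t\<^sup>2 = 2 * (1 / 2) ^ n" by (simp add: t_def)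
      also have "(1 / 2 :: real) ^ n = \<rho> * 2 ^ n"
        by (simp add: \<rho>_def power_mult_distrib[symmetric])
      finally have "2 * \<rho> * 2 ^ n \<le> lat_dist x + \<rho>" using True \<rho> by (simp add: S_def)
      then have "ln (2 * \<rho> * 2 ^ n) \<le> ln (lat_dist x + \<rho>)" using \<rho> s\<rho>[of x] by simp
      then have "ln (2 * \<rho>) + n * ln 2 \<le> ln (lat_dist x + \<rho>)"
        using \<rho> by (simp add: ln_mult_pos ln_realpow)
      then have "K * (ln (2 * \<rho>) + n * ln 2) \<le> K * ln (lat_dist x + \<rho>)"
        using K by (intro mult_left_mono) auto
      moreover have "K * (n * ln 2) = 1" using n by (simp add: K_def)
      ultimately have "1 \<le> l x" by (simp add: l_def distrib_left)
      then have 2: "flat 1 \<le> \<psi> x" unfolding \<psi>_def by (rule flat_mono)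
      have "flat (3 / 4) * flat 1 \<le> \<eta> x * \<psi> x"
        using 1 2 flat_bounds(1) by (intro mult_mono) (auto simp: \<eta>_def)
      then have "\<kappa> \<le> \<bar>u x\<bar> powr p"
        unfolding \<kappa>_def u_def using p flat_bounds(1) by (intro powr_mono2) auto
      then show ?thesis using True by simp
    qed simp
  qed
  finally have "\<kappa> * (B / 2 ^ ?D - L * t ^ ?D) \<le> (LINT x|lborel. \<bar>u x\<bar> powr p)" .
  with energy u show ?thesis by (auto simp: C_def \<kappa>_def t_def)
qed

text \<open>M is chosen before n: the first energy term is small relative to the volume
  \<open>B\<close> once M is large, and with M, hence \<open>B\<close> and \<open>L\<close>, fixed
  the second decays like n^(1-p). Each is made at most a quarter of \<epsilon> \<kappa> B / 2^d,
  while the mass keeps at least half of \<kappa> B / 2^d.\<close>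

lemma perforated_low_quotient:
  fixes p \<epsilon> :: real
  assumes p: "1 < p" "p \<le> DIM('a::euclidean_space)" and \<epsilon>: "\<epsilon> > 0"
  shows "\<exists>\<rho>>0. \<exists>u\<in>test_functions {x::'a. lat_dist x > \<rho>}.
     0 < (LINT x|lborel. \<bar>u x\<bar> powr p) \<and>
     (LINT x|lborel. norm (grad u x) powr p) \<le> \<epsilon> * (LINT x|lborel. \<bar>u x\<bar> powr p)"
proof -
  let ?D = "DIM('a)"
  define \<kappa> where "\<kappa> = (flat (3 / 4) * flat 1) powr p"
  define c where "c = 4 * pi / ln 2"
  have pos: "\<kappa> > 0" "c > 0"
    using flat_pos[of 1] flat_pos[of "3/4"] by (simp_all add: \<kappa>_def c_def)
  have neg: "(\<lambda>n. real n powr (- r)) \<longlonglongrightarrow> 0" if "r > 0" for r :: real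
    using that filterlim_real_sequentially by (intro tendsto_neg_powr) auto
  have "(\<lambda>M. 2 powr (p - 1) * (4 powr p * real M powr (- p))) \<longlonglongrightarrow> 2 powr (p - 1) * (4 powr p * 0)"
    using p by (intro tendsto_mult tendsto_const neg) auto
  then have "eventually (\<lambda>M. 2 powr (p - 1) * (4 powr p * real M powr (- p)) < \<epsilon> * \<kappa> / 2 ^ ?D / 4) sequentially"
    by (rule order_tendstoD(2)) (use \<epsilon> pos in simp)
  then obtain M :: nat where M: "1 \<le> M" "2 powr (p - 1) * (4 powr p * real M powr (- p)) < \<epsilon> * \<kappa> / 2 ^ ?D / 4"
    by (metis (no_types, lifting) eventually_sequentially eventually_conj eventually_ge_at_top le_refl)
  define B where "B = measure lborel (ball (0::'a) (real M))"
  define L where "L = real (2 * M + 1) ^ ?D"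
  have B: "B > 0" "L \<ge> 0" using M(1) by (auto simp: B_def L_def)
  \<comment> \<open>The factor 2 comes from n + 1 \<le> 2 n.\<close>
  define A where "A = c powr p * (B + 2 ^ ?D * L * 2)"
  have "(\<lambda>n. 2 powr (p - 1) * (A * real n powr (- (p - 1)))) \<longlonglongrightarrow> 2 powr (p - 1) * (A * 0)"
    using p by (intro tendsto_mult tendsto_const neg) auto
  then have ev1: "eventually (\<lambda>n. 2 powr (p - 1) * (A * real n powr (- (p - 1))) < \<epsilon> * \<kappa> * B / 2 ^ ?D / 4) sequentially"
    by (rule order_tendstoD(2)) (use \<epsilon> pos B in simp)
  have "(\<lambda>n. L * sqrt (2 * (1 / 2) ^ n) ^ ?D) \<longlonglongrightarrow> L * sqrt (2 * 0) ^ ?D"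
    by (intro tendsto_mult tendsto_const tendsto_power tendsto_real_sqrt LIMSEQ_realpow_zero) auto
  then have ev2: "eventually (\<lambda>n. L * sqrt (2 * (1 / 2) ^ n) ^ ?D < B / 2 ^ ?D / 2) sequentially"
    by (rule order_tendstoD(2)) (use B in \<open>simp add: power_0_left\<close>)
  from eventually_conj[OF ev1 eventually_conj[OF ev2 eventually_ge_at_top[of 1]]]
  obtain n :: nat where n: "1 \<le> n" "2 powr (p - 1) * (A * real n powr (- (p - 1))) < \<epsilon> * \<kappa> * B / 2 ^ ?D / 4"
    "L * sqrt (2 * (1 / 2) ^ n) ^ ?D < B / 2 ^ ?D / 2"
    unfolding eventually_sequentially by blast
  obtain u where u: "u \<in> test_functions {x::'a. lat_dist x > (1 / 4) ^ n / 2}"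
    and E: "(LINT x|lborel. norm (grad u x) powr p)
       \<le> 2 powr (p - 1) * ((4 / M) powr p * B + (c / n) powr p * (B + 2 ^ ?D * L * (real n + 1)))"
    and m: "\<kappa> * (B / 2 ^ ?D - L * sqrt (2 * (1 / 2) ^ n) ^ ?D) \<le> (LINT x|lborel. \<bar>u x\<bar> powr p)"
    using perforated_test_function_estimate[OF M(1) n(1) p] unfolding B_def L_def c_def \<kappa>_def by blast
  have m2: "\<kappa> * (B / 2 ^ ?D / 2) \<le> (LINT x|lborel. \<bar>u x\<bar> powr p)"
  proof (rule order_trans[OF mult_left_mono m])
    have "2 * (B / 2 ^ ?D / 2) = B / 2 ^ ?D" by simp
    with n(3) show "B / 2 ^ ?D / 2 \<le> B / 2 ^ ?D - L * sqrt (2 * (1 / 2) ^ n) ^ ?D" by linarith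
  qed (use pos in simp)
  have "(4 / M) powr p = 4 powr p * real M powr (- p)"
    by (simp add: powr_divide powr_minus_divide)
  then have E1: "2 powr (p - 1) * ((4 / M) powr p * B) \<le> \<epsilon> * \<kappa> / 2 ^ ?D / 4 * B"
    using mult_right_mono[OF less_imp_le[OF M(2)], of B] B by (simp add: mult.assoc)
  have "(c / n) powr p * (B + 2 ^ ?D * L * (real n + 1)) \<le> (c / n) powr p * ((B + 2 ^ ?D * L * 2) * n)"
  proof (intro mult_left_mono)
    have "B * 1 \<le> B * n" "(2 ^ ?D * L) * (real n + 1) \<le> (2 ^ ?D * L) * (2 * n)"
      using B n(1) by (intro mult_left_mono; simp)+
    then have "B * 1 + (2 ^ ?D * L) * (real n + 1) \<le> B * n + (2 ^ ?D * L) * (2 * n)" by (rule add_mono)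
    also have "\<dots> = (B + 2 ^ ?D * L * 2) * n" by (simp add: algebra_simps)
    finally show "B + 2 ^ ?D * L * (real n + 1) \<le> (B + 2 ^ ?D * L * 2) * n" by simp
  qed simp
  also have "\<dots> = A * real n powr (- (p - 1))"
    using n(1) by (simp add: A_def powr_divide powr_diff field_simps)
  finally have E2: "2 powr (p - 1) * ((c / n) powr p * (B + 2 ^ ?D * L * (real n + 1))) \<le> \<epsilon> * \<kappa> * B / 2 ^ ?D / 4"
    using n(2) by (smt (verit) mult_left_mono powr_ge_zero)
  have "(LINT x|lborel. norm (grad u x) powr p) \<le> \<epsilon> * (\<kappa> * (B / 2 ^ ?D / 2))"
    using E E1 E2 by (simp add: distrib_left)
  also have "\<dots> \<le> \<epsilon> * (LINT x|lborel. \<bar>u x\<bar> powr p)"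
    using m2 \<epsilon> by (intro mult_left_mono) auto
  finally have "(LINT x|lborel. norm (grad u x) powr p) \<le> \<epsilon> * (LINT x|lborel. \<bar>u x\<bar> powr p)" .
  moreover have "0 < \<kappa> * (B / 2 ^ ?D / 2)" using pos B by simp
  with m2 have "0 < (LINT x|lborel. \<bar>u x\<bar> powr p)" by linarith
  ultimately show ?thesis using u by (intro exI[of _ "(1 / 4) ^ n / 2"]) auto
qed

subsection \<open>Combining lattice translates\<close>

text \<open>
  \<open>\<delta>\<close> makes the \<open>\<ell>\<^sup>p\<close> norm of the translates smooth; the subtracted constant is its value where all
  translates of \<open>u\<close> vanish, so that the supports stay inside those of the translates.
\<close>

definition lp_sum :: "real \<Rightarrow> real \<Rightarrow> 'a set \<Rightarrow> ('a::euclidean_space \<Rightarrow> real) \<Rightarrow> 'a \<Rightarrow> real" where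
  "lp_sum p \<delta> K u x =
     (\<Sum>k\<in>K. ((u (x - k))\<^sup>2 + \<delta>\<^sup>2) powr (p / 2)) powr (1 / p) - real (card K) powr (1 / p) * \<delta>"

lemma sum_square_pos: "\<delta> > 0 \<Longrightarrow> (a::real)\<^sup>2 + \<delta>\<^sup>2 > 0"
  by (simp add: add_nonneg_pos)

lemma square_powr_half: "\<delta> > 0 \<Longrightarrow> (\<delta>\<^sup>2) powr (p / 2) = \<delta> powr (p::real)"
  by (subst powr_numeral[symmetric]) (simp_all only: powr_powr less_imp_le, simp)

lemma C_k_lp_sum:
  assumes "\<And>k. C_k k u" "finite K" "K \<noteq> {}" "\<delta> > 0"
  shows "C_k n (lp_sum p \<delta> K u)"
proof -
  have "C_k n (\<lambda>x. u (x - k))" for n k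
    using C_k_translate[OF assms(1), where a="- k"] by simp
  then have "C_k n (\<lambda>x. (\<Sum>k\<in>K. (u (x - k) * u (x - k) + \<delta>\<^sup>2) powr (p / 2)) powr (1 / p)
      + - (real (card K) powr (1 / p) * \<delta>))"
    using assms sum_square_pos[OF assms(4)]
    by (intro C_k_add C_k_powr C_k_sum C_k_mult C_k_const sum_pos)
      (auto simp: power2_eq_square powr_gt_zero less_imp_neq[symmetric])
  then show ?thesis unfolding lp_sum_def[abs_def] by (simp add: power2_eq_square)
qed

lemma lp_sum_nonneg:
  assumes "finite K" "\<delta> > 0" "p > 0"
  shows "lp_sum p \<delta> K u x \<ge> 0"
proof -
  have "real (card K) * \<delta> powr p = (\<Sum>k\<in>K. (\<delta>\<^sup>2) powr (p / 2))"
    using assms by (simp add: square_powr_half)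
  also have "\<dots> \<le> (\<Sum>k\<in>K. ((u (x - k))\<^sup>2 + \<delta>\<^sup>2) powr (p / 2))"
    using assms by (intro sum_mono powr_mono2) auto
  finally have "(real (card K) * \<delta> powr p) powr (1 / p)
      \<le> (\<Sum>k\<in>K. ((u (x - k))\<^sup>2 + \<delta>\<^sup>2) powr (p / 2)) powr (1 / p)"
    using assms by (intro powr_mono2) auto
  then show ?thesis using assms by (simp add: lp_sum_def powr_mult powr_powr)
qed

lemma lp_sum_eq_0:
  assumes "finite K" "\<delta> > 0" "p > 0" "\<And>k. k \<in> K \<Longrightarrow> u (x - k) = 0"
  shows "lp_sum p \<delta> K u x = 0"
proof -
  have "(\<Sum>k\<in>K. ((u (x - k))\<^sup>2 + \<delta>\<^sup>2) powr (p / 2)) = real (card K) * \<delta> powr p"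
    using assms by (simp add: square_powr_half)
  then show ?thesis using assms by (simp add: lp_sum_def powr_mult powr_powr)
qed

text \<open>The gradient of the l^p norm combines the single gradients with coefficients of norm at
  most 1 in the dual exponent. Hoelder's inequality then gives, pointwise, that energies add at
  most.\<close>

lemma grad_lp_sum_le:
  fixes u :: "'a::euclidean_space \<Rightarrow> real"
  assumes u: "\<And>x. u differentiable (at x)" and K: "finite K" "K \<noteq> {}" and "\<delta> > 0" "p > 1"
  shows "norm (grad (lp_sum p \<delta> K u) x) powr p \<le> (\<Sum>k\<in>K. norm (grad u (x - k)) powr p)"
proof -
  define q where "q k = (u (x - k))\<^sup>2 + \<delta>\<^sup>2" for k
  define a where "a k = q k powr (1 / 2)" for k
  define S where "S = (\<Sum>k\<in>K. a k powr p)"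
  have q: "q k > 0" for k unfolding q_def using assms by (intro sum_square_pos) auto
  have a: "a k > 0" for k using q[of k] by (simp add: a_def)
  have ap: "a k powr p = q k powr (p / 2)" for k by (simp add: a_def powr_powr)
  have S: "S > 0" unfolding S_def using K a by (intro sum_pos) (auto simp: less_imp_neq[symmetric])
  have gk: "GDERIV (\<lambda>x. ((u (x - k))\<^sup>2 + \<delta>\<^sup>2) powr (p / 2)) x :> (p * a k powr (p - 2) * u (x - k)) *\<^sub>R grad u (x - k)" for k
  proof -
    have 1: "GDERIV (\<lambda>x. u (x - k)) x :> grad u (x - k)"
      using GDERIV_translate[of u x "- k"] GDERIV_grad[OF u] by simp
    have "((\<lambda>r. (r\<^sup>2 + \<delta>\<^sup>2) powr (p / 2)) has_real_derivative
        (p / 2) * (r\<^sup>2 + \<delta>\<^sup>2) powr (p / 2 - 1) * (2 * r)) (at r)" for r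
      using sum_square_pos[OF \<open>\<delta> > 0\<close>, of r]
      by (auto intro!: derivative_eq_intros simp: field_simps)
    from GDERIV_DERIV_compose[OF 1 this]
    have "GDERIV (\<lambda>x. ((u (x - k))\<^sup>2 + \<delta>\<^sup>2) powr (p / 2)) x
      :> ((p / 2) * q k powr (p / 2 - 1) * (2 * u (x - k))) *\<^sub>R grad u (x - k)"
      by (simp add: q_def)
    moreover have "q k powr (p / 2 - 1) = a k powr (p - 2)"
      by (simp add: a_def powr_powr diff_divide_distrib)
    ultimately show ?thesis by (simp add: mult_ac)
  qed
  have "((\<lambda>r. r powr (1 / p) - real (card K) powr (1 / p) * \<delta>) has_real_derivative
      (1 / p) * S powr (1 / p - 1)) (at S)"
    using S by (auto intro!: derivative_eq_intros)
  moreover have "(\<Sum>k\<in>K. ((u (x - k))\<^sup>2 + \<delta>\<^sup>2) powr (p / 2)) = S"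
    by (simp add: S_def ap q_def)
  ultimately have "GDERIV (lp_sum p \<delta> K u) x :> ((1 / p) * S powr (1 / p - 1)) *\<^sub>R
      (\<Sum>k\<in>K. (p * a k powr (p - 2) * u (x - k)) *\<^sub>R grad u (x - k))"
    unfolding lp_sum_def[abs_def]
    by (intro GDERIV_DERIV_compose[OF GDERIV_sum[OF K(1) gk]]) simp
  then have g: "grad (lp_sum p \<delta> K u) x = ((1 / p) * S powr (1 / p - 1)) *\<^sub>R
      (\<Sum>k\<in>K. (p * a k powr (p - 2) * u (x - k)) *\<^sub>R grad u (x - k))"
    by (rule grad_eqI)
  have "norm (grad (lp_sum p \<delta> K u) x) \<le> ((1 / p) * S powr (1 / p - 1)) *
      (\<Sum>k\<in>K. p * (a k powr (p - 1) * norm (grad u (x - k))))"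
  proof -
    have "norm (\<Sum>k\<in>K. (p * a k powr (p - 2) * u (x - k)) *\<^sub>R grad u (x - k))
        \<le> (\<Sum>k\<in>K. p * (a k powr (p - 1) * norm (grad u (x - k))))"
    proof (rule sum_norm_le)
      fix k
      \<comment> \<open>Replacing |u| by the larger \<open>a k\<close> turns the chain rule factor
        a^(p-2) u into a^(p-1), the form of \<open>holder_sum_normalised\<close>.\<close>
      have "\<bar>u (x - k)\<bar> = sqrt ((u (x - k))\<^sup>2)" by simp
      also have "\<dots> \<le> sqrt (q k)" unfolding q_def by (intro real_sqrt_le_mono) simp
      also have "\<dots> = a k" using q[of k] by (simp add: a_def powr_half_sqrt)
      finally have "a k powr (p - 2) * \<bar>u (x - k)\<bar> \<le> a k powr (p - 2) * a k"
        by (intro mult_left_mono) auto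
      also have "\<dots> = a k powr (p - 1)"
        using a[of k] powr_add[of "a k" "p - 2" 1] by simp
      finally have "p * (a k powr (p - 2) * \<bar>u (x - k)\<bar>) * norm (grad u (x - k))
          \<le> p * a k powr (p - 1) * norm (grad u (x - k))"
        using assms by (intro mult_right_mono mult_left_mono) auto
      then show "norm ((p * a k powr (p - 2) * u (x - k)) *\<^sub>R grad u (x - k))
          \<le> p * (a k powr (p - 1) * norm (grad u (x - k)))"
        using assms by (simp add: abs_mult mult.assoc)
    qed
    moreover have c: "(1 / p) * S powr (1 / p - 1) \<ge> 0" using assms by simp
    ultimately show ?thesis unfolding g norm_scaleR abs_of_nonneg[OF c] by (rule mult_left_mono)
  qed
  also have "\<dots> = S powr (1 / p - 1) * (\<Sum>k\<in>K. a k powr (p - 1) * norm (grad u (x - k)))"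
    using assms by (simp add: sum_distrib_left[symmetric])
  finally have "norm (grad (lp_sum p \<delta> K u) x) powr p
      \<le> (S powr (1 / p - 1) * (\<Sum>k\<in>K. a k powr (p - 1) * norm (grad u (x - k)))) powr p"
    using assms by (intro powr_mono2) auto
  also have "\<dots> \<le> (\<Sum>k\<in>K. norm (grad u (x - k)) powr p)"
    unfolding S_def using K a assms by (intro holder_sum_normalised) auto
  finally show ?thesis .
qed

section \<open>Folding lattice sums into the unit cell\<close>

lemma lattice_box_Ints: "k \<in> lattice_box lo hi \<Longrightarrow> b \<in> Basis \<Longrightarrow> \<exists>i. k \<bullet> b = of_int i \<and> lo \<le> i \<and> i < hi"
  unfolding lattice_box_def by (auto elim!: Ints_cases)

lemma lattice_boxI:
  assumes "\<And>b. b \<in> Basis \<Longrightarrow> \<exists>i. k \<bullet> b = of_int i \<and> lo \<le> i \<and> i < hi"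
  shows "k \<in> lattice_box lo hi"
  unfolding lattice_box_def
proof (intro CollectI ballI)
  fix b :: 'a assume "b \<in> Basis"
  then obtain i where "k \<bullet> b = of_int i" "lo \<le> i" "i < hi" using assms by blast
  then show "k \<bullet> b \<in> \<int> \<and> of_int lo \<le> k \<bullet> b \<and> k \<bullet> b < of_int hi" by simp
qed

text \<open>In the half-open convention the largest coordinate of \<open>l\<close> is d - 1, hence
  the shift by 1 in the lower bound.\<close>

lemma lattice_box_diff:
  assumes j: "j \<in> lattice_box a b" and l: "l \<in> lattice_box c d"
  shows "j - l \<in> lattice_box (a - d + 1) (b - c)"
proof (rule lattice_boxI)
  fix e :: 'a assume e: "e \<in> Basis"
  obtain i i' where "j \<bullet> e = of_int i \<and> a \<le> i \<and> i < b" "l \<bullet> e = of_int i' \<and> c \<le> i' \<and> i' < d"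
    using lattice_box_Ints[OF j e] lattice_box_Ints[OF l e] by blast
  then show "\<exists>i. (j - l) \<bullet> e = of_int i \<and> a - d + 1 \<le> i \<and> i < b - c"
    by (intro exI[of _ "i - i'"]) (auto simp: inner_diff_left)
qed

lemma lattice_box_mono: "k \<in> lattice_box a b \<Longrightarrow> c \<le> a \<Longrightarrow> b \<le> d \<Longrightarrow> k \<in> lattice_box c d"
  by (rule lattice_boxI) (drule (1) lattice_box_Ints, force)

text \<open>A cell whose index keeps distance M from the faces of the cube sees all translates that
  can reach it, indexed by l = j - k. The sum is therefore the same in every such cell; this is the
  periodicity of \<open>W\<close> away from the boundary.\<close>

lemma lattice_sum_cell:
  fixes F :: "'a::euclidean_space \<Rightarrow> real" and M N :: int
  assumes F: "\<And>y b. F y \<noteq> 0 \<Longrightarrow> b \<in> Basis \<Longrightarrow> \<bar>y \<bullet> b\<bar> < M"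
    and x: "x \<in> unit_cell" and j: "j \<in> lattice_box M (N - M)"
  shows "(\<Sum>k\<in>lattice_box 0 N. F (x + j - k)) = (\<Sum>l\<in>lattice_box (- M) M. F (x + l))"
proof -
  let ?L = "lattice_box (- M) M :: 'a set" and ?K = "lattice_box 0 N :: 'a set"
  have sub: "(\<lambda>l. j - l) ` ?L \<subseteq> ?K"
  proof (rule image_subsetI)
    fix l :: 'a assume "l \<in> ?L"
    from lattice_box_diff[OF j this] show "j - l \<in> ?K" by (rule lattice_box_mono) auto
  qed
  have "(\<Sum>l\<in>?L. F (x + l)) = (\<Sum>k\<in>(\<lambda>l. j - l) ` ?L. F (x + j - k))"
    by (subst sum.reindex) (auto simp: inj_on_def)
  also have "\<dots> = (\<Sum>k\<in>?K. F (x + j - k))"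
  proof (rule sum.mono_neutral_left[OF finite_lattice_box sub], rule ballI)
    fix k assume k: "k \<in> ?K - (\<lambda>l. j - l) ` ?L"
    show "F (x + j - k) = 0"
    proof (rule ccontr)
      assume nz: "F (x + j - k) \<noteq> 0"
      have "j - k \<in> ?L"
      proof (rule lattice_boxI)
        fix b :: 'a assume b: "b \<in> Basis"
        obtain i i' where i: "j \<bullet> b = of_int i" "k \<bullet> b = of_int i'"
          using lattice_box_Ints[OF j b] k lattice_box_Ints[of k 0 N b] b by blast
        have "\<bar>(x + j - k) \<bullet> b\<bar> < M" using F[OF nz b] .
        moreover have "0 \<le> x \<bullet> b" "x \<bullet> b < 1" using x b by (auto simp: unit_cell_def)
        ultimately have "of_int (i - i') < (of_int M :: real)" "of_int (- M - 1) < (of_int (i - i') :: real)"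
          by (auto simp: inner_add_left inner_diff_left i)
        then have "i - i' < M" "- M \<le> i - i'" unfolding of_int_less_iff by auto
        then show "\<exists>i. (j - k) \<bullet> b = of_int i \<and> - M \<le> i \<and> i < M"
          by (intro exI[of _ "i - i'"]) (auto simp: inner_diff_left i)
      qed
      then have "k \<in> (\<lambda>l. j - l) ` ?L" by (intro image_eqI[of _ _ "j - k"]) auto
      with k show False by simp
    qed
  qed
  finally show ?thesis by simp
qed

text \<open>Unfolding: the cells with index in the box cover the set where \<open>f\<close> is
  nonzero.\<close>

lemma lattice_mass:
  fixes f :: "'a::euclidean_space \<Rightarrow> ennreal" and M :: int
  assumes [measurable]: "f \<in> borel_measurable borel"
    and f: "\<And>y b. f y \<noteq> 0 \<Longrightarrow> b \<in> Basis \<Longrightarrow> \<bar>y \<bullet> b\<bar> < M"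
  shows "(\<integral>\<^sup>+ x. indicator unit_cell x * (\<Sum>l\<in>lattice_box (- M) M. f (x + l)) \<partial>lborel) = (\<integral>\<^sup>+ x. f x \<partial>lborel)"
proof -
  have "(\<integral>\<^sup>+ x. indicator unit_cell x * (\<Sum>l\<in>lattice_box (- M) M. f (x + l)) \<partial>lborel)
      = (\<integral>\<^sup>+ x. (\<Sum>l\<in>lattice_box (- M) M. indicator unit_cell x * f (x + l)) \<partial>lborel)"
    by (simp add: sum_distrib_left)
  also have "\<dots> = (\<Sum>l\<in>lattice_box (- M) M. \<integral>\<^sup>+ x. indicator unit_cell x * f (x + l) \<partial>lborel)"
    by (rule nn_integral_sum) measurable
  also have "\<dots> = (\<integral>\<^sup>+ x. of_bool (floor_vec x \<in> lattice_box (- M) M) * f x \<partial>lborel)"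
    by (rule nn_integral_lattice_cells) fact
  also have "\<dots> = (\<integral>\<^sup>+ x. f x \<partial>lborel)"
  proof (intro nn_integral_cong)
    fix x :: 'a
    have "floor_vec x \<in> lattice_box (- M) M" if "f x \<noteq> 0"
    proof (rule lattice_boxI)
      fix b :: 'a assume b: "b \<in> Basis"
      then show "\<exists>i. floor_vec x \<bullet> b = of_int i \<and> - M \<le> i \<and> i < M"
        using f[OF that b] by (auto simp: floor_vec_inner le_floor_iff floor_less_iff abs_less_iff)
    qed
    then show "of_bool (floor_vec x \<in> lattice_box (- M) M) * f x = f x" by auto
  qed
  finally show ?thesis .
qed

lemma lp_sum_energy_le:
  fixes u :: "'a::euclidean_space \<Rightarrow> real"
  assumes u: "u \<in> test_functions \<Omega>" and W: "lp_sum p \<delta> K u \<in> test_functions \<Omega>'"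
    and "finite K" "K \<noteq> {}" "\<delta> > 0" "p > 1"
  shows "(LINT x|lborel. norm (grad (lp_sum p \<delta> K u) x) powr p)
     \<le> real (card K) * (LINT x|lborel. norm (grad u x) powr p)"
proof -
  define E where "E = (LINT x|lborel. norm (grad u x) powr p)"
  have E: "E \<ge> 0" unfolding E_def by (rule Bochner_Integration.integral_nonneg) auto
  have [measurable]: "grad u \<in> borel_measurable borel"
    using continuous_grad_test_function[OF u] by (rule borel_measurable_continuous_onI)
  have "ennreal (LINT x|lborel. norm (grad (lp_sum p \<delta> K u) x) powr p)
      = (\<integral>\<^sup>+ x. ennreal (norm (grad (lp_sum p \<delta> K u) x) powr p) \<partial>lborel)"
    using integrable_test_function(3)[OF W, of p] assms by (simp add: nn_integral_eq_integral)
  also have "\<dots> \<le> (\<integral>\<^sup>+ x. (\<Sum>k\<in>K. ennreal (norm (grad u (x - k)) powr p)) \<partial>lborel)"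
    using grad_lp_sum_le[OF test_functionsD(5)[OF u] assms(3-6)]
    by (intro nn_integral_mono) (simp add: ennreal_leI)
  also have "\<dots> = (\<Sum>k\<in>K. \<integral>\<^sup>+ x. ennreal (norm (grad u (x - k)) powr p) \<partial>lborel)"
    by (rule nn_integral_sum) measurable
  also have "\<dots> = (\<Sum>k\<in>K. ennreal E)"
  proof (intro sum.cong refl)
    fix k
    have "(\<integral>\<^sup>+ x. ennreal (norm (grad u (x - k)) powr p) \<partial>lborel) = (\<integral>\<^sup>+ x. ennreal (norm (grad u x) powr p) \<partial>lborel)"
      using nn_integral_lborel_translate[of "\<lambda>x. ennreal (norm (grad u x) powr p)" "- k"] by simp
    also have "\<dots> = ennreal E"
      unfolding E_def using integrable_test_function(3)[OF u, of p] assms by (simp add: nn_integral_eq_integral)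
    finally show "(\<integral>\<^sup>+ x. ennreal (norm (grad u (x - k)) powr p) \<partial>lborel) = ennreal E" .
  qed
  also have "\<dots> = ennreal (real (card K) * E)"
    using E by (simp add: ennreal_mult ennreal_of_nat_eq_real_of_nat)
  finally show ?thesis using E by (simp add: E_def)
qed

text \<open>The holes are periodic, so the translated supports still avoid them. They reach at most
  M beyond the cube, and the margin M + 1 leaves room for an open box.\<close>

lemma lp_sum_test_function:
  fixes u :: "'a::euclidean_space \<Rightarrow> real"
  assumes u: "u \<in> test_functions {x. lat_dist x > \<rho>}"
    and M: "\<And>x. u x \<noteq> 0 \<Longrightarrow> norm x \<le> real M" and "\<delta> > 0" "p > 1"
    and N: "0 < N"
  shows "lp_sum p \<delta> (lattice_box 0 (int N)) u \<in>
     test_functions ({x. lat_dist x > \<rho>} \<inter> box (- (real M + 1) *\<^sub>R One) ((real N + real M + 1) *\<^sub>R One))"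
proof (rule test_functionsI)
  let ?K = "lattice_box 0 (int N) :: 'a set"
  let ?C = "closure {x. u x \<noteq> 0}"
  have "0 \<in> ?K" using N by (auto simp: lattice_box_def)
  then show "C_k k (lp_sum p \<delta> ?K u)" for k
    using test_functionsD(1)[OF u] assms finite_lattice_box by (intro C_k_lp_sum) auto
  show "compact (\<Union>k\<in>?K. (\<lambda>x. x + k) ` ?C)"
  proof (intro compact_UN finite_lattice_box)
    fix k
    have "compact ((+) k ` ?C)" using test_functionsD(2)[OF u] by (rule compact_translation)
    then show "compact ((\<lambda>x. x + k) ` ?C)" by (simp add: add.commute)
  qed
  have nC: "norm x \<le> real M" if "x \<in> ?C" for x
  proof -
    have "?C \<subseteq> cball 0 (real M)" by (rule closure_minimal) (auto simp: M)
    then show ?thesis using that by auto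
  qed
  show "(\<Union>k\<in>?K. (\<lambda>x. x + k) ` ?C)
      \<subseteq> {x. lat_dist x > \<rho>} \<inter> box (- (real M + 1) *\<^sub>R One) ((real N + real M + 1) *\<^sub>R One)"
  proof (intro UN_least image_subsetI IntI)
    fix k y assume k: "k \<in> ?K" and y: "y \<in> ?C"
    have "lat_dist y > \<rho>" using test_functionsD(3)[OF u] y by auto
    then show "y + k \<in> {x. lat_dist x > \<rho>}" using lat_dist_periodic[OF k, of y] by simp
    show "y + k \<in> box (- (real M + 1) *\<^sub>R One) ((real N + real M + 1) *\<^sub>R One)"
      unfolding mem_box
    proof
      fix b :: 'a assume b: "b \<in> Basis"
      have "\<bar>y \<bullet> b\<bar> \<le> real M" using nC[OF y] Basis_le_norm[OF b, of y] by linarith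
      moreover have "0 \<le> k \<bullet> b" "k \<bullet> b < real N" using k b by (auto simp: lattice_box_def)
      ultimately show "(- (real M + 1) *\<^sub>R One) \<bullet> b < (y + k) \<bullet> b \<and>
          (y + k) \<bullet> b < ((real N + real M + 1) *\<^sub>R One) \<bullet> b"
        using b by (simp add: inner_add_left; linarith)
    qed
  qed
  fix x assume nz: "lp_sum p \<delta> ?K u x \<noteq> 0"
  have "\<exists>k\<in>?K. u (x - k) \<noteq> 0"
  proof (rule ccontr)
    assume "\<not> ?thesis"
    then have "lp_sum p \<delta> ?K u x = 0" using assms finite_lattice_box by (intro lp_sum_eq_0) auto
    with nz show False by simp
  qed
  then obtain k where k: "k \<in> ?K" and "u (x - k) \<noteq> 0" by blast
  then have C: "x - k \<in> ?C" by (intro subsetD[OF closure_subset]) simp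
  have "x \<in> (\<lambda>x. x + k) ` ?C"
    by (rule image_eqI[of _ _ "x - k"]) (simp_all only: C diff_add_cancel)
  with k show "x \<in> (\<Union>k\<in>?K. (\<lambda>x. x + k) ` ?C)" by (rule UN_I)
qed

subsection \<open>Oscillation in the unit cell\<close>

lemma integrable_unit_cell:
  fixes f :: "'a::euclidean_space \<Rightarrow> real"
  assumes "continuous_on UNIV f"
  shows "integrable (restrict_space lborel unit_cell) f"
proof -
  have "integrable lborel (\<lambda>x. indicator (cbox 0 One :: 'a set) x *\<^sub>R f x)"
    using assms by (intro borel_integrable_compact compact_cbox) (rule continuous_on_subset, auto)
  then have "integrable lborel (\<lambda>x. indicator unit_cell x *\<^sub>R (indicator (cbox 0 One :: 'a set) x *\<^sub>R f x))"
    by (rule integrable_mult_indicator[rotated]) simp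
  moreover have "(\<lambda>x. indicator unit_cell x *\<^sub>R (indicator (cbox 0 One :: 'a set) x *\<^sub>R f x))
      = (\<lambda>x. indicator unit_cell x *\<^sub>R f x)"
    by (auto simp: fun_eq_iff indicator_def unit_cell_def mem_box less_imp_le)
  ultimately show ?thesis by (simp add: integrable_restrict_space)
qed

lemma finite_measure_unit_cell: "finite_measure (restrict_space lborel (unit_cell :: 'a::euclidean_space set))"
  by (rule finite_measureI, subst emeasure_restrict_space)
     (simp_all add: space_restrict_space emeasure_unit_cell)

lemma measure_unit_cell:
  "measure (restrict_space lborel (unit_cell :: 'a::euclidean_space set))
     (space (restrict_space lborel (unit_cell :: 'a set))) = 1"
  by (subst measure_restrict_space) (simp_all add: space_restrict_space measure_def emeasure_unit_cell)

lemma nn_integral_unit_cell_const: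
  "(\<integral>\<^sup>+ x. indicator (unit_cell :: 'a::euclidean_space set) x * c \<partial>lborel) = c"
  by (simp add: nn_integral_multc emeasure_unit_cell)

lemma unit_cell_diff:
  fixes x h :: "'a::euclidean_space"
  assumes "x \<in> unit_cell" "x + h \<in> unit_cell"
  shows "norm h \<le> DIM('a)"
proof -
  have "norm h \<le> (\<Sum>b\<in>Basis. \<bar>h \<bullet> b\<bar>)" by (rule norm_le_l1)
  also have "\<dots> \<le> (\<Sum>b\<in>(Basis::'a set). 1)"
    using assms by (intro sum_mono) (force simp: unit_cell_def inner_add_left abs_le_iff)
  finally show ?thesis by simp
qed

lemma borel_measurable_nn_integral_lborel:
  fixes f :: "'a::euclidean_space \<Rightarrow> 'b::euclidean_space \<Rightarrow> ennreal"
  assumes "(\<lambda>(x, y). f x y) \<in> borel_measurable (borel \<Otimes>\<^sub>M borel)"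
  shows "(\<lambda>x. \<integral>\<^sup>+ y. f x y \<partial>lborel) \<in> borel_measurable borel"
proof -
  have "sets (borel \<Otimes>\<^sub>M lborel) = sets (borel \<Otimes>\<^sub>M borel :: ('a \<times> 'b) measure)"
    by (intro sets_pair_measure_cong) auto
  from measurable_cong_sets[OF this refl] assms
  have "(\<lambda>(x, y). f x y) \<in> borel_measurable (borel \<Otimes>\<^sub>M lborel)" by blast
  then show ?thesis by (rule lborel.borel_measurable_nn_integral)
qed

text \<open>Two points of a cell are \<open>x\<close> and \<open>x + h\<close> with |h| \<le> d. All
  cells of the box carry the same profile \<open>w\<close>, so their oscillations add up to at most
  the translation average of \<open>W\<close>, and a single cell bears only its share of the
  energy.\<close>

lemma cells_oscillation_le:
  fixes W :: "'a::euclidean_space \<Rightarrow> real"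
  assumes W: "W \<in> test_functions \<Omega>" and p: "p \<ge> 1"
    and w: "\<And>x j. x \<in> unit_cell \<Longrightarrow> j \<in> lattice_box lo hi \<Longrightarrow> W (x + j) = w x"
  shows "of_nat (card (lattice_box lo hi :: 'a set)) *
     (\<integral>\<^sup>+ x. indicator unit_cell x * (\<integral>\<^sup>+ y. indicator unit_cell y * ennreal (\<bar>w x - w y\<bar> powr p) \<partial>lborel) \<partial>lborel)
     \<le> emeasure lborel (cball (0::'a) DIM('a)) * ennreal (DIM('a) powr p * (LINT x|lborel. norm (grad W x) powr p))"
proof -
  let ?J = "lattice_box lo hi :: 'a set" and ?H = "cball (0::'a) DIM('a)"
  have [measurable]: "W \<in> borel_measurable borel"
    using test_functionsD(4)[OF W] by (rule borel_measurable_continuous_onI)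
  define g where "g x = (\<integral>\<^sup>+ h. indicator ?H h * ennreal (\<bar>W (x + h) - W x\<bar> powr p) \<partial>lborel)" for x
  have [measurable]: "?H \<in> sets borel" by simp
  have [measurable]: "g \<in> borel_measurable borel"
    unfolding g_def by (rule borel_measurable_nn_integral_lborel) measurable
  let ?P = "\<integral>\<^sup>+ x. indicator unit_cell x * (\<integral>\<^sup>+ y. indicator unit_cell y * ennreal (\<bar>w x - w y\<bar> powr p) \<partial>lborel) \<partial>lborel"
  have "of_nat (card ?J) * ?P = (\<Sum>j\<in>?J. ?P)" by simp
  also have "\<dots> \<le> (\<Sum>j\<in>?J. \<integral>\<^sup>+ x. indicator unit_cell x * g (x + j) \<partial>lborel)"
  proof (intro sum_mono nn_integral_mono)
    fix j x :: 'a assume j: "j \<in> ?J"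
    show "indicator unit_cell x * (\<integral>\<^sup>+ y. indicator unit_cell y * ennreal (\<bar>w x - w y\<bar> powr p) \<partial>lborel)
        \<le> indicator unit_cell x * g (x + j)"
    proof (cases "x \<in> unit_cell")
      case x: True
      have "(\<integral>\<^sup>+ y. indicator unit_cell y * ennreal (\<bar>w x - w y\<bar> powr p) \<partial>lborel)
          = (\<integral>\<^sup>+ y. indicator unit_cell y * ennreal (\<bar>W (x + j) - W (y + j)\<bar> powr p) \<partial>lborel)"
        using w[OF _ j] x by (intro nn_integral_cong) (auto split: split_indicator)
      also have "\<dots> = (\<integral>\<^sup>+ h. indicator unit_cell (h + x) * ennreal (\<bar>W (x + j) - W ((h + x) + j)\<bar> powr p) \<partial>lborel)"
        by (rule nn_integral_lborel_translate[symmetric]) measurable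
      also have "\<dots> \<le> g (x + j)"
        unfolding g_def
      proof (rule nn_integral_mono)
        fix h
        have "h \<in> ?H" if "h + x \<in> unit_cell"
          using unit_cell_diff[OF x, of h] that by (simp add: add.commute)
        then show "indicator unit_cell (h + x) * ennreal (\<bar>W (x + j) - W ((h + x) + j)\<bar> powr p)
            \<le> indicator ?H h * ennreal (\<bar>W (x + j + h) - W (x + j)\<bar> powr p)"
          by (auto simp: abs_minus_commute add_ac split: split_indicator)
      qed
      finally show ?thesis using x by simp
    qed simp
  qed
  also have "\<dots> = (\<integral>\<^sup>+ x. of_bool (floor_vec x \<in> ?J) * g x \<partial>lborel)"
    by (rule nn_integral_lattice_cells) measurable
  also have "\<dots> \<le> (\<integral>\<^sup>+ x. g x \<partial>lborel)"
    by (intro nn_integral_mono) auto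
  also have "\<dots> \<le> emeasure lborel ?H * ennreal (DIM('a) powr p * (LINT x|lborel. norm (grad W x) powr p))"
    unfolding g_def by (rule test_function_averaged_translation_le[OF W p]) auto
  finally show ?thesis .
qed

text \<open>Only the cells of the box are counted; elsewhere \<open>W\<close> is
  nonnegative.\<close>

lemma card_mult_integral_cell_le:
  fixes W :: "'a::euclidean_space \<Rightarrow> real"
  assumes W: "W \<in> test_functions \<Omega>" "\<And>x. W x \<ge> 0" and wc: "continuous_on UNIV w"
    and w: "\<And>x j. x \<in> unit_cell \<Longrightarrow> j \<in> lattice_box lo hi \<Longrightarrow> W (x + j) = w x"
    and w0: "\<And>x. w x \<ge> 0"
  shows "real (card (lattice_box lo hi :: 'a set)) * (LINT x|restrict_space lborel unit_cell. w x)
     \<le> (LINT x|lborel. W x)"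
proof -
  let ?J = "lattice_box lo hi :: 'a set"
  let ?m = "LINT x|restrict_space lborel unit_cell. w x"
  have [measurable]: "W \<in> borel_measurable borel"
    using test_functionsD(4)[OF W(1)] by (rule borel_measurable_continuous_onI)
  have m0: "?m \<ge> 0" using w0 by (intro Bochner_Integration.integral_nonneg) auto
  have m: "ennreal ?m = (\<integral>\<^sup>+ x. indicator unit_cell x * ennreal (w x) \<partial>lborel)"
    using nn_integral_eq_integral[OF integrable_unit_cell[OF wc]] w0
    by (simp add: nn_integral_restrict_space mult.commute)
  have "ennreal (real (card ?J) * ?m) = (\<Sum>j\<in>?J. ennreal ?m)"
    using m0 by (simp add: ennreal_mult ennreal_of_nat_eq_real_of_nat)
  also have "\<dots> = (\<Sum>j\<in>?J. \<integral>\<^sup>+ x. indicator unit_cell x * ennreal (W (x + j)) \<partial>lborel)"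
    unfolding m using w by (intro sum.cong refl nn_integral_cong) (auto split: split_indicator)
  also have "\<dots> = (\<integral>\<^sup>+ x. of_bool (floor_vec x \<in> ?J) * ennreal (W x) \<partial>lborel)"
    by (rule nn_integral_lattice_cells) measurable
  also have "\<dots> \<le> (\<integral>\<^sup>+ x. ennreal (W x) \<partial>lborel)"
    by (intro nn_integral_mono) auto
  also have "\<dots> = ennreal (LINT x|lborel. W x)"
    using integrable_test_function(1)[OF W(1), of 1] W(2) by (simp add: nn_integral_eq_integral)
  finally show ?thesis using W(2) by (simp add: Bochner_Integration.integral_nonneg)
qed

text \<open>A reverse Hoelder inequality up to oscillation: \<open>w x\<close> exceeds the mean by
  at most the average of |w x - w y|, and the weighted splitting keeps the coefficient of the mean
  near 1. The offset \<kappa> will be the constant subtracted in \<open>lp_sum\<close>.\<close>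

lemma powr_le_mean_plus_oscillation:
  fixes w :: "'a::euclidean_space \<Rightarrow> real"
  defines "Q \<equiv> restrict_space lborel (unit_cell :: 'a set)"
  assumes wc: "continuous_on UNIV w" and w0: "\<And>x. w x \<ge> 0" and "\<kappa> \<ge> 0" "0 < \<theta>" "\<theta> < 1" "p \<ge> 1"
  shows "(w x + \<kappa>) powr p \<le> (1 - \<theta>) powr (1 - p) * (LINT y|Q. w y) powr p
    + \<theta> powr (1 - p) * 2 powr (p - 1) * (\<kappa> powr p + (LINT y|Q. \<bar>w x - w y\<bar> powr p))"
proof -
  interpret finite_measure Q unfolding Q_def by (rule finite_measure_unit_cell)
  define m where "m = (LINT y|Q. w y)"
  define d where "d = (LINT y|Q. \<bar>w x - w y\<bar>)"
  define r where "r = (LINT y|Q. \<bar>w x - w y\<bar> powr p)"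
  have m0: "m \<ge> 0" unfolding m_def using w0 by (intro Bochner_Integration.integral_nonneg) auto
  have d0: "d \<ge> 0" unfolding d_def by (intro Bochner_Integration.integral_nonneg) auto
  have c: "continuous_on UNIV (\<lambda>y. \<bar>w x - w y\<bar>)"
    by (intro continuous_on_rabs continuous_on_diff continuous_on_const wc)
  have cp: "continuous_on UNIV (\<lambda>y. \<bar>w x - w y\<bar> powr p)"
    using assms by (intro continuous_on_powr_const c) auto
  have int: "integrable Q w" "integrable Q (\<lambda>y. \<bar>w x - w y\<bar>)" "integrable Q (\<lambda>y. \<bar>w x - w y\<bar> powr p)"
    unfolding Q_def by (intro integrable_unit_cell wc c cp)+
  have mQ: "measure Q (space Q) = 1" unfolding Q_def by (rule measure_unit_cell)
  have "w x - m = (LINT y|Q. w x - w y)"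
    using int(1) mQ by (simp add: m_def)
  also have "\<dots> \<le> d"
    unfolding d_def using int by (intro integral_mono) auto
  finally have "w x + \<kappa> \<le> m + (\<kappa> + d)" by simp
  then have "(w x + \<kappa>) powr p \<le> (m + (\<kappa> + d)) powr p"
    using w0[of x] assms by (intro powr_mono2) auto
  also have "\<dots> \<le> (1 - \<theta>) powr (1 - p) * m powr p + \<theta> powr (1 - p) * (\<kappa> + d) powr p"
    using assms m0 d0 by (intro powr_add_le_split) auto
  also have "(\<kappa> + d) powr p \<le> 2 powr (p - 1) * (\<kappa> powr p + d powr p)"
    using assms d0 by (intro powr_add_le) auto
  also have "d powr p \<le> r"
    using integral_powr_le[OF finite_measure_axioms \<open>p \<ge> 1\<close> _ int(3)] mQ by (simp add: d_def r_def)
  finally show ?thesis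
    unfolding m_def r_def by (simp add: mult_left_mono mult.assoc)
qed

text \<open>The witness \<open>m\<close> is the mean of \<open>W\<close> over an interior cell.
  Folded into the unit cell, the mass of \<open>u\<close> is at most the integral of (w +
  \<kappa>)^p. Apart from the factors of the splitting, this is bounded by m^p, the smoothing error
  N^d \<delta>^p and one cell's share of the energy N^d E.\<close>

lemma cell_estimate:
  fixes u :: "'a::euclidean_space \<Rightarrow> real" and M N :: nat and p \<rho> \<delta> \<theta> :: real
  assumes u: "u \<in> test_functions {x. lat_dist x > \<rho>}" and M: "\<And>x. u x \<noteq> 0 \<Longrightarrow> norm x < real M"
    and \<delta>: "\<delta> > 0" and p: "p > 1" and N: "2 * M < N" and \<theta>: "0 < \<theta>" "\<theta> < 1"
  defines "W \<equiv> lp_sum p \<delta> (lattice_box 0 (int N)) u"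
    and "E \<equiv> LINT x|lborel. norm (grad u x) powr p"
    and "c \<equiv> real (N - 2 * M) ^ DIM('a)"
    and "V \<equiv> measure lborel (cball (0::'a) DIM('a))"
  shows "\<exists>m\<ge>0. c * m \<le> (LINT x|lborel. W x) \<and>
     (LINT x|lborel. \<bar>u x\<bar> powr p) \<le> (1 - \<theta>) powr (1 - p) * m powr p
       + \<theta> powr (1 - p) * 2 powr (p - 1) * (real N ^ DIM('a) * \<delta> powr p + V * DIM('a) powr p * (real N ^ DIM('a) * E) / c)"
proof -
  let ?D = "DIM('a)"
  let ?K = "lattice_box 0 (int N) :: 'a set" and ?L = "lattice_box (- int M) (int M) :: 'a set"
    and ?J = "lattice_box (int M) (int N - int M) :: 'a set"
  have cK: "card ?K = N ^ ?D" and cJ: "card ?J = (N - 2 * M) ^ ?D" and cL: "card ?L = (2 * M) ^ ?D"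
    using N by (auto simp: card_lattice_box nat_diff_distrib nat_mult_distrib intro!: arg_cong[where f="\<lambda>n. n ^ _"])
  have K0: "?K \<noteq> {}" using cK N by (auto intro: ccontr)
  have c0: "c > 0" using N by (simp add: c_def)
  have "?J \<noteq> {}" using cJ N by (auto intro: ccontr)
  then obtain j0 where j0: "j0 \<in> ?J" by blast
  have Wt: "W \<in> test_functions ({x. lat_dist x > \<rho>} \<inter> box (- (real M + 1) *\<^sub>R One) ((real N + real M + 1) *\<^sub>R One))"
    unfolding W_def using M N \<delta> p by (intro lp_sum_test_function[OF u]) (auto simp: less_imp_le)
  have W0: "W x \<ge> 0" for x
    unfolding W_def using \<delta> p by (intro lp_sum_nonneg finite_lattice_box) auto
  define \<kappa> where "\<kappa> = real (card ?K) powr (1 / p) * \<delta>"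
  have \<kappa>0: "\<kappa> \<ge> 0" using \<delta> by (simp add: \<kappa>_def)
  have \<kappa>p: "\<kappa> powr p = real N ^ ?D * \<delta> powr p"
    using p \<delta> by (simp add: \<kappa>_def powr_mult powr_powr cK)
  \<comment> \<open>Subtracting the value at u = 0 confines \<open>F\<close> to the support of
    \<open>u\<close>, as \<open>lattice_sum_cell\<close> requires; \<open>G\<close> restores the
    constant for all translates.\<close>
  define F where "F y = ((u y)\<^sup>2 + \<delta>\<^sup>2) powr (p / 2) - (\<delta>\<^sup>2) powr (p / 2)" for y
  define G where "G x = (\<Sum>l\<in>?L. F (x + l)) + real (card ?K) * (\<delta>\<^sup>2) powr (p / 2)" for x
  have FM: "\<bar>y \<bullet> b\<bar> < int M" if "u y \<noteq> 0" "b \<in> Basis" for y b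
    using M[OF that(1)] Basis_le_norm[OF that(2), of y] by simp
  have Wj: "W (x + j) = G x powr (1 / p) - \<kappa>" if x: "x \<in> unit_cell" and j: "j \<in> ?J" for x j
  proof -
    have "(\<Sum>k\<in>?K. ((u (x + j - k))\<^sup>2 + \<delta>\<^sup>2) powr (p / 2)) = (\<Sum>k\<in>?K. F (x + j - k)) + real (card ?K) * (\<delta>\<^sup>2) powr (p / 2)"
      by (simp add: F_def sum_subtractf)
    also have "(\<Sum>k\<in>?K. F (x + j - k)) = (\<Sum>l\<in>?L. F (x + l))"
    proof (rule lattice_sum_cell[OF _ x j])
      fix y b :: 'a assume "F y \<noteq> 0" "b \<in> Basis"
      then show "\<bar>y \<bullet> b\<bar> < int M" by (intro FM) (auto simp: F_def)
    qed
    finally show ?thesis by (simp add: W_def lp_sum_def \<kappa>_def G_def)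
  qed
  define w where "w x = W (x + j0)" for x
  have w: "W (x + j) = w x" if "x \<in> unit_cell" "j \<in> ?J" for x j
    using Wj that j0 by (simp add: w_def)
  have w0: "w x \<ge> 0" for x by (simp add: w_def W0)
  have wc: "continuous_on UNIV w"
    unfolding w_def by (intro continuous_on_compose2[OF test_functionsD(4)[OF Wt]] continuous_intros) auto
  have sum_le: "(\<Sum>l\<in>?L. \<bar>u (x + l)\<bar> powr p) \<le> (w x + \<kappa>) powr p" if x: "x \<in> unit_cell" for x
  proof -
    have ge: "\<bar>a\<bar> powr p \<le> (a\<^sup>2 + \<delta>\<^sup>2) powr (p / 2)" for a :: real
    proof (cases "a = 0")
      case False
      then have "\<bar>a\<bar> powr p = (a\<^sup>2) powr (p / 2)" using square_powr_half[of "\<bar>a\<bar>" p] by simp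
      also have "\<dots> \<le> (a\<^sup>2 + \<delta>\<^sup>2) powr (p / 2)" using p by (intro powr_mono2) auto
      finally show ?thesis .
    qed simp
    have "(\<Sum>l\<in>?L. \<bar>u (x + l)\<bar> powr p) \<le> (\<Sum>l\<in>?L. F (x + l) + (\<delta>\<^sup>2) powr (p / 2))"
      by (intro sum_mono) (simp add: F_def ge)
    also have "\<dots> = (\<Sum>l\<in>?L. F (x + l)) + real (card ?L) * (\<delta>\<^sup>2) powr (p / 2)"
      by (simp add: sum.distrib)
    also have "\<dots> \<le> G x"
    proof -
      \<comment> \<open>Since 2 M < N, the constants in \<open>G\<close> suffice for all translates
        in \<open>?L\<close>.\<close>
      have "card ?L \<le> card ?K" unfolding cK cL using N by (intro power_mono) auto
      then show ?thesis unfolding G_def by (intro add_left_mono mult_right_mono) auto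
    qed
    finally have le: "(\<Sum>l\<in>?L. \<bar>u (x + l)\<bar> powr p) \<le> G x" .
    have "0 \<le> (\<Sum>l\<in>?L. \<bar>u (x + l)\<bar> powr p)" by (intro sum_nonneg) auto
    with le have "G x \<ge> 0" by linarith
    then have "(w x + \<kappa>) powr p = G x"
      using Wj[OF x j0] p by (simp add: w_def powr_powr)
    with le show ?thesis by simp
  qed
  define Q where "Q = restrict_space lborel (unit_cell :: 'a set)"
  define m where "m = (LINT y|Q. w y)"
  have m0: "m \<ge> 0" unfolding m_def using w0 by (intro Bochner_Integration.integral_nonneg) auto
  have mW: "c * m \<le> (LINT x|lborel. W x)"
    using card_mult_integral_cell_le[where lo="int M" and hi="int N - int M", OF Wt W0 wc w w0] by (simp add: cJ c_def m_def Q_def)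
  define r where "r x = (LINT y|Q. \<bar>w x - w y\<bar> powr p)" for x
  have r: "ennreal (r x) = (\<integral>\<^sup>+ y. indicator unit_cell y * ennreal (\<bar>w x - w y\<bar> powr p) \<partial>lborel)" for x
  proof -
    have "continuous_on UNIV (\<lambda>y. \<bar>w x - w y\<bar> powr p)"
      using p by (intro continuous_on_powr_const continuous_on_rabs continuous_on_diff continuous_on_const wc) auto
    from nn_integral_eq_integral[OF integrable_unit_cell[OF this]]
    show ?thesis by (simp add: r_def Q_def nn_integral_restrict_space mult.commute)
  qed
  define P where "P = (\<integral>\<^sup>+ x. indicator unit_cell x * ennreal (r x) \<partial>lborel)"
  have [measurable]: "w \<in> borel_measurable borel" "u \<in> borel_measurable borel"
    using wc test_functionsD(4)[OF u] by (auto intro: borel_measurable_continuous_onI)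
  have [measurable]: "(\<lambda>x. ennreal (r x)) \<in> borel_measurable borel" 
    unfolding r by (rule borel_measurable_nn_integral_lborel) measurable
  have E0: "E \<ge> 0" unfolding E_def by (rule Bochner_Integration.integral_nonneg) auto
  have EW: "(LINT x|lborel. norm (grad W x) powr p) \<le> real N ^ ?D * E"
    using lp_sum_energy_le[OF u Wt[unfolded W_def] finite_lattice_box K0 \<delta> p] by (simp add: cK E_def W_def)
  have eV: "emeasure lborel (cball (0::'a) DIM('a)) = ennreal V"
    by (simp add: V_def emeasure_cball content_cball)
  have V0: "V \<ge> 0" by (simp add: V_def)
  have "ennreal c * P \<le> ennreal V * ennreal (?D powr p * (LINT x|lborel. norm (grad W x) powr p))"
    using cells_oscillation_le[where lo="int M" and hi="int N - int M", OF Wt less_imp_le[OF p] w]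
    by (simp add: P_def r eV cJ c_def ennreal_of_nat_eq_real_of_nat)
  also have "\<dots> \<le> ennreal V * ennreal (?D powr p * (real N ^ ?D * E))"
    using EW by (intro mult_left_mono ennreal_leI) auto
  also have "\<dots> = ennreal (V * ?D powr p * (real N ^ ?D * E))"
    using V0 E0 by (simp add: ennreal_mult mult.assoc)
  finally have cP: "ennreal c * P \<le> ennreal (V * ?D powr p * (real N ^ ?D * E))" .
  define X where "X = V * ?D powr p * (real N ^ ?D * E) / c"
  have X0: "X \<ge> 0" using V0 E0 c0 by (simp add: X_def)
  \<comment> \<open>An infinite \<open>P\<close> has to be excluded before dividing; the finite
    bound on \<open>ennreal c * P\<close> does it.\<close>
  have P: "P \<le> ennreal X"
  proof (cases P)
    case (real s)
    then have "c * s \<le> V * ?D powr p * (real N ^ ?D * E)"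
      using cP c0 V0 E0 by (simp add: ennreal_mult[symmetric])
    then show ?thesis using real c0 by (simp add: X_def pos_le_divide_eq mult.commute ennreal_leI)
  next
    case top
    then show ?thesis using cP c0 by (simp add: ennreal_mult_top top_unique)
  qed
  define c1 where "c1 = (1 - \<theta>) powr (1 - p)"
  define c2 where "c2 = \<theta> powr (1 - p) * 2 powr (p - 1)"
  have c12: "c1 \<ge> 0" "c2 \<ge> 0" by (simp_all add: c1_def c2_def)
  have "ennreal (LINT x|lborel. \<bar>u x\<bar> powr p) = (\<integral>\<^sup>+ x. ennreal (\<bar>u x\<bar> powr p) \<partial>lborel)"
    using integrable_test_function(2)[OF u, of p] p by (simp add: nn_integral_eq_integral)
  also have "\<dots> = (\<integral>\<^sup>+ x. indicator unit_cell x * (\<Sum>l\<in>?L. ennreal (\<bar>u (x + l)\<bar> powr p)) \<partial>lborel)"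
  proof (rule lattice_mass[symmetric])
    fix y b :: 'a assume "ennreal (\<bar>u y\<bar> powr p) \<noteq> 0" "b \<in> Basis"
    then show "\<bar>y \<bullet> b\<bar> < int M" by (intro FM) auto
  qed measurable
  also have "\<dots> \<le> (\<integral>\<^sup>+ x. indicator unit_cell x * ennreal (c1 * m powr p + c2 * \<kappa> powr p)
      + ennreal c2 * (indicator unit_cell x * ennreal (r x)) \<partial>lborel)"
  proof (rule nn_integral_mono)
    fix x :: 'a
    show "indicator unit_cell x * (\<Sum>l\<in>?L. ennreal (\<bar>u (x + l)\<bar> powr p))
      \<le> indicator unit_cell x * ennreal (c1 * m powr p + c2 * \<kappa> powr p) + ennreal c2 * (indicator unit_cell x * ennreal (r x))"
    proof (cases "x \<in> unit_cell")
      case True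
      have r0: "r x \<ge> 0" unfolding r_def by (intro Bochner_Integration.integral_nonneg) auto
      have "(\<Sum>l\<in>?L. \<bar>u (x + l)\<bar> powr p) \<le> (w x + \<kappa>) powr p" by (rule sum_le[OF True])
      also have "\<dots> \<le> c1 * m powr p + c2 * (\<kappa> powr p + r x)"
        unfolding c1_def c2_def m_def r_def Q_def
        using powr_le_mean_plus_oscillation[OF wc w0 \<kappa>0 \<theta>, of p x] p by simp
      finally have "ennreal (\<Sum>l\<in>?L. \<bar>u (x + l)\<bar> powr p) \<le> ennreal ((c1 * m powr p + c2 * \<kappa> powr p) + c2 * r x)"
        by (intro ennreal_leI) (simp add: distrib_left)
      also have "\<dots> = ennreal (c1 * m powr p + c2 * \<kappa> powr p) + ennreal c2 * ennreal (r x)"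
        using c12 r0 by (simp add: ennreal_plus ennreal_mult)
      finally show ?thesis using True by simp
    qed simp
  qed
  also have "\<dots> = (\<integral>\<^sup>+ x. indicator unit_cell x * ennreal (c1 * m powr p + c2 * \<kappa> powr p) \<partial>(lborel :: 'a measure))
      + (\<integral>\<^sup>+ x. ennreal c2 * (indicator unit_cell x * ennreal (r x)) \<partial>lborel)"
    by (rule nn_integral_add) measurable
  also have "(\<integral>\<^sup>+ x. ennreal c2 * (indicator unit_cell x * ennreal (r x)) \<partial>lborel) = ennreal c2 * P"
    unfolding P_def by (rule nn_integral_cmult) measurable
  also have "(\<integral>\<^sup>+ x. indicator unit_cell x * ennreal (c1 * m powr p + c2 * \<kappa> powr p) \<partial>(lborel :: 'a measure))
      = ennreal (c1 * m powr p + c2 * \<kappa> powr p)"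
    by (rule nn_integral_unit_cell_const)
  also have "ennreal (c1 * m powr p + c2 * \<kappa> powr p) + ennreal c2 * P
      \<le> ennreal (c1 * m powr p + c2 * \<kappa> powr p) + ennreal c2 * ennreal X"
    using P by (intro add_left_mono mult_left_mono) auto
  also have "\<dots> = ennreal (c1 * m powr p + c2 * (\<kappa> powr p + X))"
    using c12 X0 by (simp add: ennreal_mult[symmetric] ennreal_plus[symmetric] distrib_left add.assoc del: ennreal_plus)
  finally have "(LINT x|lborel. \<bar>u x\<bar> powr p) \<le> c1 * m powr p + c2 * (\<kappa> powr p + X)"
  proof (rule ennreal_le_iff[THEN iffD1, rotated])
    show "0 \<le> c1 * m powr p + c2 * (\<kappa> powr p + X)"
      using c12 X0 by (intro add_nonneg_nonneg mult_nonneg_nonneg) auto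
  qed
  then show ?thesis using m0 mW by (auto simp: c1_def c2_def \<kappa>p X_def)
qed

subsection \<open>Sets with almost maximal product\<close>

lemma shifted_ratio_tendsto_1: "(\<lambda>N. (real N - a) / (real N + b)) \<longlonglongrightarrow> 1"
proof -
  have top: "filterlim (\<lambda>N. b + real N) at_top sequentially"
    by (rule filterlim_tendsto_add_at_top[OF tendsto_const filterlim_real_sequentially])
  have "(\<lambda>N. 1 - (a + b) * inverse (b + real N)) \<longlonglongrightarrow> 1 - (a + b) * 0"
    by (intro tendsto_diff tendsto_mult tendsto_const tendsto_compose_filtermap[THEN iffD1]
        filterlim_compose[OF tendsto_inverse_0_at_top[OF filterlim_ident] top])
  then have "(\<lambda>N. 1 - (a + b) * inverse (b + real N)) \<longlonglongrightarrow> 1" by simp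
  moreover have "eventually (\<lambda>N. b + real N > 0) sequentially"
    using top by (simp add: filterlim_at_top_dense)
  then have "eventually (\<lambda>N. 1 - (a + b) * inverse (b + real N) = (real N - a) / (real N + b)) sequentially"
    by eventually_elim (simp add: field_simps)
  ultimately show ?thesis by (rule Lim_transform_eventually)
qed

text \<open>The three powers are the number of interior cells, the number of translates and the
  volume of the enclosing box. The quotient measures the loss at the boundary of the cube.\<close>

lemma volume_ratio_tendsto_1:
  fixes M D :: nat
  shows "(\<lambda>N. (real (N - 2 * M) ^ D) powr p / (real N ^ D * ((real N + 2 * real M + 2) ^ D) powr (p - 1))) \<longlonglongrightarrow> 1"
proof -
  have "(\<lambda>N. ((real N - 2 * real M) / (real N + 0)) ^ D *
      (((real N - 2 * real M) / (real N + (2 * real M + 2))) ^ D) powr (p - 1)) \<longlonglongrightarrow> 1 ^ D * (1 ^ D) powr (p - 1)"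
    by (intro tendsto_mult tendsto_power tendsto_powr shifted_ratio_tendsto_1 tendsto_const) auto
  then have "(\<lambda>N. ((real N - 2 * real M) / (real N + 0)) ^ D *
      (((real N - 2 * real M) / (real N + (2 * real M + 2))) ^ D) powr (p - 1)) \<longlonglongrightarrow> 1" by simp
  moreover have "eventually (\<lambda>N. ((real N - 2 * real M) / (real N + 0)) ^ D *
      (((real N - 2 * real M) / (real N + (2 * real M + 2))) ^ D) powr (p - 1)
      = (real (N - 2 * M) ^ D) powr p / (real N ^ D * ((real N + 2 * real M + 2) ^ D) powr (p - 1))) sequentially"
    using eventually_gt_at_top[of "2 * M"]
  proof eventually_elim
    case (elim N)
    define x where "x = real (N - 2 * M) ^ D"
    have x: "(real N - 2 * real M) ^ D = x" using elim by (simp add: x_def of_nat_diff)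
    have "x > 0" using elim by (simp add: x_def)
    then have "x powr p = x * x powr (p - 1)" using powr_add[of x 1 "p - 1"] by simp
    then show ?case
      using \<open>x > 0\<close> elim by (simp add: power_divide x x_def[symmetric] powr_divide add.assoc)
  qed
  ultimately show ?thesis by (rule Lim_transform_eventually)
qed

text \<open>The factors record the losses: (1 - \<theta>)^p from replacing the mass of
  \<open>u\<close> by m^p, 1 - \<theta> from the boundary of the cube, and 1 / (1 + \<theta>)
  because \<open>u\<close> attains the infimum only up to this factor.\<close>

lemma near_optimal_set:
  fixes p \<theta> :: real
  assumes p: "1 < p" "p \<le> DIM('a::euclidean_space)" and \<theta>: "0 < \<theta>" "\<theta> < 1"
  shows "\<exists>\<Omega>::'a set. open \<Omega> \<and> 0 < emeasure lebesgue \<Omega> \<and> emeasure lebesgue \<Omega> < \<infinity> \<and>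
     ereal ((1 - \<theta>) powr p * (1 - \<theta>) / (1 + \<theta>)) \<le> F_p1 p \<Omega>"
proof -
  let ?D = "DIM('a)"
  let ?mass = "\<lambda>\<phi>::'a \<Rightarrow> real. LINT x|lborel. \<bar>\<phi> x\<bar> powr p"
  let ?energy = "\<lambda>\<phi>::'a \<Rightarrow> real. LINT x|lborel. norm (grad \<phi> x) powr p"
  have mass0: "?mass \<phi> \<ge> 0" and energy0: "?energy \<phi> \<ge> 0" for \<phi>
    by (rule Bochner_Integration.integral_nonneg, simp)+
  define V where "V = measure lborel (cball (0::'a) ?D)"
  define c2 where "c2 = \<theta> powr (1 - p) * 2 powr (p - 1)"
  define C where "C = 2 ^ ?D * V * ?D powr p"
  \<comment> \<open>Fixed by c2 (1 + C) \<eta> = \<theta>: an energy of at most \<eta> times the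
    mass \<open>A\<close> then produces an error of at most \<theta> A. The factor 2^d in
    \<open>C\<close> is the bound for n / c.\<close>
  define \<eta> where "\<eta> = \<theta> / (c2 * (1 + C))"
  have C0: "C \<ge> 0" by (simp add: C_def V_def)
  have c20: "c2 > 0" using \<theta> by (simp add: c2_def)
  have \<eta>0: "\<eta> > 0" using \<theta> c20 C0 by (simp add: \<eta>_def)
  have c2\<eta>: "c2 * (1 + C) * \<eta> = \<theta>" using c20 C0 by (simp add: \<eta>_def)
  \<comment> \<open>Half of \<eta>, because the quotient of the later choice \<open>u\<close> may
    exceed \<Lambda> by the factor 1 + \<theta> < 2.\<close>
  obtain \<rho> u0 where \<rho>: "\<rho> > 0" and u0: "u0 \<in> test_functions {x::'a. lat_dist x > \<rho>}"
    "0 < ?mass u0" "?energy u0 \<le> (\<eta> / 2) * ?mass u0"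
    using perforated_low_quotient[OF p, of "\<eta> / 2"] \<eta>0 by auto
  define T where "T = test_functions {x::'a. lat_dist x > \<rho>}"
  obtain \<gamma> where \<gamma>: "\<gamma> > 0" "\<And>\<phi>. \<phi> \<in> T \<Longrightarrow> \<gamma> * ?mass \<phi> \<le> ?energy \<phi>"
    using perforated_poincare[OF \<rho>, of p, where 'a='a] p unfolding T_def by auto
  \<comment> \<open>Positive mass keeps quotients by 0 out of the infimum; the constant \<gamma>
    makes the infimum positive.\<close>
  define R where "R = {?energy \<phi> / ?mass \<phi> | \<phi>. \<phi> \<in> T \<and> ?mass \<phi> > 0}"
  define \<Lambda> where "\<Lambda> = Inf R"
  have Rne: "?energy u0 / ?mass u0 \<in> R" using u0 by (auto simp: R_def T_def)
  have R\<gamma>: "\<gamma> \<le> y" if "y \<in> R" for y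
    using that \<gamma>(2) by (auto simp: R_def pos_le_divide_eq)
  have bdd: "bdd_below R" using R\<gamma> by (auto simp: bdd_below_def)
  have "\<gamma> \<le> \<Lambda>" unfolding \<Lambda>_def using Rne R\<gamma> by (intro cInf_greatest) auto
  then have \<Lambda>0: "\<Lambda> > 0" using \<gamma>(1) by linarith
  have "\<Lambda> \<le> ?energy u0 / ?mass u0" unfolding \<Lambda>_def using Rne bdd by (rule cInf_lower)
  also have "\<dots> \<le> \<eta> / 2" using u0 by (simp add: pos_divide_le_eq)
  finally have \<Lambda>\<eta>: "\<Lambda> \<le> \<eta> / 2" .
  have \<Lambda>: "\<Lambda> * ?mass \<phi> \<le> ?energy \<phi>" if "\<phi> \<in> T" for \<phi>
  proof (cases "?mass \<phi> > 0")
    case True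
    then have "\<Lambda> \<le> ?energy \<phi> / ?mass \<phi>"
      unfolding \<Lambda>_def using that by (intro cInf_lower bdd) (auto simp: R_def)
    then show ?thesis using True by (simp add: pos_le_divide_eq)
  next
    case False
    then have "?mass \<phi> = 0" using mass0[of \<phi>] by linarith
    then show ?thesis using energy0[of \<phi>] by simp
  qed
  have "Inf R < (1 + \<theta>) * \<Lambda>" using \<Lambda>0 \<theta> by (simp add: \<Lambda>_def[symmetric])
  then obtain y where "y \<in> R" "y < (1 + \<theta>) * \<Lambda>" using Rne cInf_lessD[of R] by blast
  then obtain u where u: "u \<in> T" "?mass u > 0" "?energy u / ?mass u < (1 + \<theta>) * \<Lambda>"
    by (auto simp: R_def)
  define A where "A = ?mass u"
  define E where "E = ?energy u"
  have A0: "A > 0" using u by (simp add: A_def)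
  have E\<Lambda>: "E \<le> (1 + \<theta>) * \<Lambda> * A" using u(2,3) by (simp add: A_def E_def pos_divide_less_eq less_imp_le)
  have E0: "E > 0" using \<Lambda>[OF u(1)] mult_pos_pos[OF \<Lambda>0 A0] by (simp add: A_def E_def)
  have "(1 + \<theta>) * \<Lambda> \<le> 2 * (\<eta> / 2)" using \<Lambda>\<eta> \<theta> \<Lambda>0 by (intro mult_mono) auto
  then have "(1 + \<theta>) * \<Lambda> * A \<le> \<eta> * A" using A0 by (intro mult_right_mono) auto
  then have E\<eta>: "E \<le> \<eta> * A" using E\<Lambda> by linarith
  have uT: "u \<in> test_functions {x. lat_dist x > \<rho>}" using u(1) by (simp add: T_def)
  obtain B where B: "\<And>x. u x \<noteq> 0 \<Longrightarrow> norm x \<le> B"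
  proof -
    have "bounded {x. u x \<noteq> 0}"
      using compact_imp_bounded[OF test_functionsD(2)[OF uT]] closure_subset by (rule bounded_subset)
    then show ?thesis using that by (auto simp: bounded_iff)
  qed
  obtain M :: nat where "B < real M" using reals_Archimedean2 by blast
  then have M: "norm x < real M" if "u x \<noteq> 0" for x using B[OF that] by linarith
  have "eventually (\<lambda>N. 1 - \<theta> < (real (N - 2 * M) ^ ?D) powr p / (real N ^ ?D * ((real N + 2 * real M + 2) ^ ?D) powr (p - 1))) sequentially"
    by (rule order_tendstoD(1)[OF volume_ratio_tendsto_1]) (use \<theta> in simp)
  from eventually_conj[OF this eventually_ge_at_top[of "4 * M + 1"]]
  obtain N :: nat where N: "1 - \<theta> < (real (N - 2 * M) ^ ?D) powr p / (real N ^ ?D * ((real N + 2 * real M + 2) ^ ?D) powr (p - 1))"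
    "4 * M + 1 \<le> N"
    unfolding eventually_sequentially by blast
  define n where "n = real N ^ ?D"
  define c where "c = real (N - 2 * M) ^ ?D"
  define vol where "vol = (real N + 2 * real M + 2) ^ ?D"
  have n0: "n > 0" and c0: "c > 0" and vol0: "vol > 0"
    using N(2) by (auto simp: n_def c_def vol_def intro!: zero_less_power)
  \<comment> \<open>Makes the total smoothing error n \<delta>^p equal to \<open>E\<close>, the
    order of the oscillation error.\<close>
  define \<delta> where "\<delta> = (E / n) powr (1 / p)"
  have \<delta>0: "\<delta> > 0" using E0 n0 by (simp add: \<delta>_def)
  have \<delta>p: "n * \<delta> powr p = E" using E0 n0 p by (simp add: \<delta>_def powr_powr)
  define W where "W = lp_sum p \<delta> (lattice_box 0 (int N)) u"
  have N2: "2 * M < N" using N(2) by simp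
  obtain m where m: "m \<ge> 0" "c * m \<le> (LINT x|lborel. W x)"
    "A \<le> (1 - \<theta>) powr (1 - p) * m powr p + c2 * (n * \<delta> powr p + V * ?D powr p * (n * E) / c)"
    using cell_estimate[OF uT M \<delta>0 p(1) N2 \<theta>]
    unfolding W_def c_def A_def E_def V_def n_def c2_def by blast
  \<comment> \<open>The choice 4 M + 1 \<le> N keeps at least half of the side of the cube in the
    interior.\<close>
  have "real N \<le> 2 * real (N - 2 * M)" using N(2) by (simp add: of_nat_diff)
  then have "n \<le> 2 ^ ?D * c"
    unfolding n_def c_def power_mult_distrib[symmetric] by (intro power_mono) auto
  then have "n / c \<le> 2 ^ ?D" using c0 by (simp add: pos_divide_le_eq)
  then have "V * ?D powr p * E * (n / c) \<le> V * ?D powr p * E * 2 ^ ?D"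
    using E0 by (intro mult_left_mono) (auto simp: V_def)
  then have "n * \<delta> powr p + V * ?D powr p * (n * E) / c \<le> (1 + C) * E"
    by (simp add: \<delta>p C_def algebra_simps)
  also have "\<dots> \<le> (1 + C) * (\<eta> * A)" using E\<eta> C0 by (intro mult_left_mono) auto
  finally have "c2 * (n * \<delta> powr p + V * ?D powr p * (n * E) / c) \<le> c2 * ((1 + C) * (\<eta> * A))"
    using c20 by (intro mult_left_mono) auto
  also have "\<dots> = \<theta> * A" using c2\<eta> by (simp add: mult.assoc[symmetric])
  finally have "(1 - \<theta>) * A \<le> (1 - \<theta>) powr (1 - p) * m powr p"
    using m(3) by (simp add: algebra_simps)
  then have "(1 - \<theta>) powr (p - 1) * ((1 - \<theta>) * A) \<le> (1 - \<theta>) powr (p - 1) * ((1 - \<theta>) powr (1 - p) * m powr p)"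
    by (intro mult_left_mono) auto
  moreover have "(1 - \<theta>) powr (p - 1) * (1 - \<theta>) powr (1 - p) = 1"
    using \<theta> by (simp add: powr_add[symmetric])
  moreover have "(1 - \<theta>) powr (p - 1) * (1 - \<theta>) = (1 - \<theta>) powr p"
    using \<theta> powr_add[of "1 - \<theta>" "p - 1" 1] by simp
  ultimately have mp: "(1 - \<theta>) powr p * A \<le> m powr p" by (simp add: mult.assoc[symmetric])
  have "(1 - \<theta>) powr p * A > 0" using \<theta> A0 by simp
  with mp have "m powr p > 0" by linarith
  then have m0: "m > 0" using m(1) by (cases "m = 0") auto
  define \<Omega> where "\<Omega> = {x::'a. lat_dist x > \<rho>} \<inter> box (- (real M + 1) *\<^sub>R One) ((real N + real M + 1) *\<^sub>R One)"
  have WT: "W \<in> test_functions \<Omega>"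
    unfolding W_def \<Omega>_def using M N2 \<delta>0 p by (intro lp_sum_test_function[OF uT]) (auto simp: less_imp_le)
  have W0: "W x \<ge> 0" for x
    unfolding W_def using \<delta>0 p by (intro lp_sum_nonneg finite_lattice_box) auto
  have openO: "open \<Omega>"
    unfolding \<Omega>_def using continuous_lat_dist
    by (intro open_Int open_box open_Collect_less continuous_on_const)
  have I: "(LINT x|lborel. \<bar>W x\<bar>) = (LINT x|lborel. W x)" using W0 by simp
  have I0: "(LINT x|lborel. \<bar>W x\<bar>) > 0" unfolding I using m(2) mult_pos_pos[OF c0 m0] by linarith
  have TO: "\<phi> \<in> T" if "\<phi> \<in> test_functions \<Omega>" for \<phi>
    using that unfolding T_def test_functions_def \<Omega>_def by auto
  have "\<not> (AE x in lborel. W x = 0)"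
  proof
    assume "AE x in lborel. W x = 0"
    then have "(LINT x|lborel. W x) = 0" by (rule integral_eq_zero_AE)
    with I0 I show False by simp
  qed
  then have "?mass W > 0"
    using integrable_test_function(2)[OF WT, of p] p by (intro integral_powr_pos) auto
  then have EW0: "?energy W > 0"
    using \<Lambda>[OF TO[OF WT]] mult_pos_pos[OF \<Lambda>0] by fastforce
  have "(lattice_box 0 (int N) :: 'a set) \<noteq> {}"
    using N2 card_lattice_box[of 0 "int N", where 'a='a] by auto
  then have EW: "?energy W \<le> n * E"
    using lp_sum_energy_le[OF uT WT[unfolded W_def] finite_lattice_box _ \<delta>0 p(1)]
    by (simp add: W_def E_def n_def card_lattice_box)
  have eO: "emeasure lebesgue \<Omega> \<le> ennreal vol"
  proof -
    have "emeasure lebesgue \<Omega> = emeasure lborel \<Omega>" using openO by simp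
    also have "\<dots> \<le> emeasure lborel (box (- (real M + 1) *\<^sub>R One) ((real N + real M + 1) *\<^sub>R One) :: 'a set)"
      unfolding \<Omega>_def by (intro emeasure_mono) auto
    also have "\<dots> = ennreal (\<Prod>b\<in>(Basis::'a set). (((real N + real M + 1) *\<^sub>R One) - (- (real M + 1) *\<^sub>R One)) \<bullet> b)"
      by (intro emeasure_lborel_box) auto
    also have "(\<Prod>b\<in>(Basis::'a set). (((real N + real M + 1) *\<^sub>R One) - (- (real M + 1) *\<^sub>R One)) \<bullet> b)
        = (\<Prod>b\<in>(Basis::'a set). real N + 2 * real M + 2)"
      by (intro prod.cong refl) (simp add: inner_diff_left)
    finally show ?thesis by (simp add: vol_def)
  qed
  have eO0: "0 < emeasure lebesgue \<Omega>"
  proof -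
    have "\<Omega> \<noteq> {}"
    proof
      assume "\<Omega> = {}"
      then have "{x. W x \<noteq> 0} = {}" using test_functionsD(3)[OF WT] by auto
      then have "(LINT x|lborel. W x) = 0" by simp
      with I0 I show False by simp
    qed
    then have "\<not> negligible \<Omega>" using openO by (rule open_not_negligible[rotated])
    then have "emeasure lebesgue \<Omega> \<noteq> 0"
      using openO by (auto simp: negligible_iff_null_sets null_sets_def)
    then show ?thesis by (simp add: zero_less_iff_neq_zero)
  qed
  have "(1 - \<theta>) powr p * (1 - \<theta>) / (1 + \<theta>) \<le> \<Lambda> * ((LINT x|lborel. \<bar>W x\<bar>) powr p / ?energy W) / vol powr (p - 1)"
  proof -
    have 1: "(1 - \<theta>) * (n * vol powr (p - 1)) \<le> c powr p"
      using N(1) n0 vol0 by (simp add: n_def c_def vol_def pos_less_divide_eq less_imp_le)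
    have "(c * m) powr p / (n * ((1 + \<theta>) * \<Lambda> * A)) \<le> (LINT x|lborel. \<bar>W x\<bar>) powr p / ?energy W"
    proof (rule frac_le)
      show "(c * m) powr p \<le> (LINT x|lborel. \<bar>W x\<bar>) powr p"
        unfolding I using m c0 p by (intro powr_mono2) auto
      have "n * E \<le> n * ((1 + \<theta>) * \<Lambda> * A)" using E\<Lambda> n0 by (intro mult_left_mono) auto
      with EW show "?energy W \<le> n * ((1 + \<theta>) * \<Lambda> * A)" by linarith
    qed (use EW0 in auto)
    then have 2: "\<Lambda> * ((c * m) powr p / (n * ((1 + \<theta>) * \<Lambda> * A))) / vol powr (p - 1)
        \<le> \<Lambda> * ((LINT x|lborel. \<bar>W x\<bar>) powr p / ?energy W) / vol powr (p - 1)"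
      using \<Lambda>0 by (intro divide_right_mono mult_left_mono) auto
    have "((1 - \<theta>) * (n * vol powr (p - 1))) * ((1 - \<theta>) powr p * A) \<le> c powr p * m powr p"
      using 1 mp A0 by (intro mult_mono) auto
    also have "\<dots> = (c * m) powr p" using c0 m0 by (simp add: powr_mult)
    finally have 3: "((1 - \<theta>) * (n * vol powr (p - 1))) * ((1 - \<theta>) powr p * A) \<le> (c * m) powr p" .
    \<comment> \<open>Here \<Lambda>, \<open>A\<close>, \<open>n\<close> and the volume cancel, so
      the bound does not deteriorate as \<Lambda> tends to 0.\<close>
    have "(1 - \<theta>) powr p * (1 - \<theta>) / (1 + \<theta>)
        = \<Lambda> * ((((1 - \<theta>) * (n * vol powr (p - 1))) * ((1 - \<theta>) powr p * A)) / (n * ((1 + \<theta>) * \<Lambda> * A))) / vol powr (p - 1)"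
    proof -
      have *: "x * y / z = \<Lambda> * (((y * (n * v)) * (x * A)) / (n * (z * \<Lambda> * A))) / v"
        if "z > 0" "v > 0" for x y z v :: real
        using that \<Lambda>0 n0 A0 by (simp add: field_simps)
      show ?thesis by (rule *) (use \<theta> vol0 in auto)
    qed
    also have "\<dots> \<le> \<Lambda> * ((c * m) powr p / (n * ((1 + \<theta>) * \<Lambda> * A))) / vol powr (p - 1)"
      using 3 \<Lambda>0 n0 A0 \<theta> by (intro divide_right_mono mult_left_mono) auto
    finally show ?thesis using 2 by linarith
  qed
  then have "ereal ((1 - \<theta>) powr p * (1 - \<theta>) / (1 + \<theta>))
      \<le> ereal (\<Lambda> * ((LINT x|lborel. \<bar>W x\<bar>) powr p / ?energy W) / vol powr (p - 1))" by simp
  also have "\<dots> \<le> F_p1 p \<Omega>"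
    using \<Lambda> TO by (intro F_p1_ge[OF openO eO0 eO p(1) \<Lambda>0 less_imp_le[OF vol0] _ WT I0]) auto
  finally show ?thesis
    using openO eO0 le_less_trans[OF eO ennreal_less_top] by (intro exI[of _ \<Omega>]) auto
qed

theorem proposition2p4:
  fixes p :: real
  assumes "1 < p" and "p \<le> real CARD('d::finite)"
  shows "(SUP \<Omega> \<in> {\<Omega> :: (real ^ 'd) set.
            open \<Omega> \<and> 0 < emeasure lebesgue \<Omega> \<and> emeasure lebesgue \<Omega> < \<infinity>}. F_p1 p \<Omega>) = 1"
    (is "?S = 1")
proof (rule antisym)
  show "?S \<le> 1"
    using assms(1) by (intro SUP_least F_p1_le_1) auto
  define f where "f \<theta> = (1 - \<theta>) powr p * (1 - \<theta>) / (1 + \<theta>)" for \<theta> :: real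
  have "ereal (f \<theta>) \<le> ?S" if "0 < \<theta>" "\<theta> < 1" for \<theta>
  proof -
    have "p \<le> DIM(real ^ 'd)" using assms(2) by simp
    from near_optimal_set[OF assms(1) this that]
    obtain \<Omega> :: "(real ^ 'd) set" where "open \<Omega>" "0 < emeasure lebesgue \<Omega>" "emeasure lebesgue \<Omega> < \<infinity>"
      "ereal (f \<theta>) \<le> F_p1 p \<Omega>"
      unfolding f_def by blast
    then show ?thesis by (intro SUP_upper2[of \<Omega>]) auto
  qed
  then have "eventually (\<lambda>\<theta>. ereal (f \<theta>) \<le> ?S) (at_right 0)"
    unfolding eventually_at_right_field by (intro exI[of _ 1]) auto
  moreover have "(f \<longlongrightarrow> (1 - 0) powr p * (1 - 0) / (1 + 0)) (at_right 0)"
    unfolding f_def by (intro tendsto_intros) auto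
  then have "((\<lambda>\<theta>. ereal (f \<theta>)) \<longlongrightarrow> ereal 1) (at_right 0)"
    by (intro tendsto_ereal) simp
  ultimately have "ereal 1 \<le> ?S"
    by (intro tendsto_upperbound[where F="at_right (0::real)"]) auto
  then show "1 \<le> ?S" by (simp add: one_ereal_def)
qed

end
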